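(* Let $F=\{f_1,\ldots,f_n\}\subset\mathbb{C}[x_1,\ldots,x_n]$ and let $\hat{\mathbf{x}}_e\in\mathbb{C}^n$ be an isolated singular solution of $F$ of multiplicity $\mu$ such that the Jacobian $F'(\hat{\mathbf{x}}_e)$ has corank one. Then for every constant $c>0$ there exist constants $\varepsilon_0>0$ and $C>0$ such that the following holds. Let $\hat{\mathbf{x}}\in\mathbb{C}^n$ with $\|\hat{\mathbf{x}}-\hat{\mathbf{x}}_e\|=\varepsilon$, $0<\varepsilon<\varepsilon_0$, be such that the smallest singular value $\sigma_n$ of $F'(\hat{\mathbf{x}})$ is positive, and such that the point $\hat{\mathbf{x}}+\hat{\mathbf{y}}$ produced in step 1 of the algorithm MultipleRootRefinerBreadthOne (described in the context) satisfies $\|\hat{\mathbf{x}}+\hat{\mathbf{y}}-\hat{\mathbf{x}}_e\|\ge c\,\varepsilon$. Then the refined solution $\hat{\mathbf{x}}_{\mathrm{new}}=\hat{\mathbf{x}}+\hat{\mathbf{y}}+\delta\,\mathbf{r}_1$ returned by the algorithm (with the multiplicity $\mu$) satisfies $$\|\hat{\mathbf{x}}_{\mathrm{new}}-\hat{\mathbf{x}}_e\|\le C\,\varepsilon^2 .$$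
   Context: Norms are $l^2$-norms. The multiplicity of an isolated solution $\hat{\mathbf{x}}_e$ of $F$ is $\dim_{\mathbb{C}}\mathbb{C}[\mathbf{x}]/Q$, where $Q$ is the isolated primary component of the ideal $(f_1,\ldots,f_n)$ whose associated prime is the maximal ideal of $\hat{\mathbf{x}}_e$. The corank of a matrix is the dimension of its (right) null space. Differential operators: $D(\alpha)=D(\alpha_1,\ldots,\alpha_n)=\frac{1}{\alpha_1!\cdots\alpha_n!}\frac{\partial^{\alpha_1+\cdots+\alpha_n}}{\partial z_1^{\alpha_1}\cdots\partial z_n^{\alpha_n}}$. The linear operator $\Psi_j$ is defined by $\Psi_j(D(\alpha))=D(\alpha_1,\ldots,\alpha_j+1,\ldots,\alpha_n)$. For an operator $Q=\sum_\alpha c_\alpha D(\alpha)$, $\Psi_j(Q)_{\alpha_1=\cdots=\alpha_{j-1}=0}$ means that $\Psi_j$ is applied only to the part of $Q$ consisting of the terms $c_\alpha D(\alpha)$ with $\alpha_1=\cdots=\alpha_{j-1}=0$. For an operator $L$ and a system $H=(h_1,\ldots,h_n)$, $L(H)_{\mathbf{z}=\hat{\mathbf{z}}}$ is the column vector of the values $L(h_i)(\hat{\mathbf{z}})$. Algorithm MultipleRootRefinerBreadthOne, on input $F$, $\hat{\mathbf{x}}$ (with $\mu$ the multiplicity of the nearby exact solution): 1. Let $A=F'(\hat{\mathbf{x}})$, $\mathbf{b}=-F(\hat{\mathbf{x}})$, $\sigma_n$ the smallest singular value of $A$, $A^*$ the conjugate transpose. Solve $(A^*A+\sigma_nI_n)\hat{\mathbf{y}}=A^*\mathbf{b}$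 for $\hat{\mathbf{y}}$. 2. Let $\mathbf{r}_1$, $\|\mathbf{r}_1\|=1$, be a right singular vector of $F'(\hat{\mathbf{x}}+\hat{\mathbf{y}})$ for its smallest singular value; complete it to a unitary matrix $R=[\mathbf{r}_1,\ldots,\mathbf{r}_n]$; set $H(\mathbf{z})=F(R\mathbf{z})$ and $\hat{\mathbf{z}}=R^{-1}(\hat{\mathbf{x}}+\hat{\mathbf{y}})$. 3. Compute the numerical closed basis $L_0,\ldots,L_{\mu-1}$ of the approximate Max Noether space of $H$ at $\hat{\mathbf{z}}$, that is, the operators constructed recursively as follows. Put $L_0=D(0,\ldots,0)$, $L_1=D(1,0,\ldots,0)$. For $k=2,\ldots,\mu-1$, given $L_1,\ldots,L_{k-1}$ and the scalars $a_{i,j}$ ($2\le i\le k-1$, $2\le j\le n$), set $$Q_{k,j}=a_{2,j}L_{k-2}+\cdots+a_{k-1,j}L_1\ (2\le j\le n;\ Q_{2,j}=0),$$ $$P_k=\Psi_1(L_{k-1})+\Psi_2(Q_{k,2})_{\alpha_1=0}+\cdots+\Psi_n(Q_{k,n})_{\alpha_1=\cdots=\alpha_{n-1}=0},$$ let $[1,a_{k,2},\ldots,a_{k,n}]^T$ be the right singular vector, scaled to have first entry $1$, for the smallest singular value of the $n\times n$ matrix $\left[P_k(H)_{\mathbf{z}=\hat{\mathbf{z}}},\frac{\partial H(\hat{\mathbf{z}})}{\partial z_2},\ldots,\frac{\partial H(\hat{\mathbf{z}})}{\partial z_n}\right]$, and put $L_k=P_k+a_{k,2}\frac{\partial}{\partial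 z_2}+\cdots+a_{k,n}\frac{\partial}{\partial z_n}$. 4. Compute $P_\mu=\Psi_1(L_{\mu-1})+\Psi_2(Q_{\mu,2})_{\alpha_1=0}+\cdots+\Psi_n(Q_{\mu,n})_{\alpha_1=\cdots=\alpha_{n-1}=0}$, where $Q_{\mu,j}=a_{2,j}L_{\mu-2}+\cdots+a_{\mu-1,j}L_1$ for $2\le j\le n$ (with $Q_{\mu,j}=0$ if $\mu=2$), solve the $n\times n$ linear system $\left[P_\mu(H)_{\mathbf{z}=\hat{\mathbf{z}}},\frac{\partial H(\hat{\mathbf{z}})}{\partial z_2},\ldots,\frac{\partial H(\hat{\mathbf{z}})}{\partial z_n}\right]\mathbf{v}=-L_{\mu-1}(H)_{\mathbf{z}=\hat{\mathbf{z}}}$ for $\mathbf{v}=[v_1,\ldots,v_n]^T$, and set $\delta=v_1/\mu$. 5. Return $\hat{\mathbf{x}}+\hat{\mathbf{y}}+\delta\,\mathbf{r}_1$. *)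

theory Defs
  imports "HOL-Analysis.Analysis" "HOL-Library.Poly_Mapping"
begin

text \<open>
  Coordinates are indexed by a finite linearly ordered type \<open>'n\<close>, so that \<open>n = CARD('n)\<close> and the
  order on \<open>'n\<close> is the numbering \<open>1 < 2 < \<dots> < n\<close> of the coordinates.
  A multi-index is an element of \<open>nat ^ 'n\<close>.  Polynomials and differential operators
  \<open>\<Sum>\<^sub>\<alpha> c\<^sub>\<alpha> D(\<alpha>)\<close> are both finitely supported families of complex numbers indexed by multi-indices;
  the ring structure on the former is the convolution product of \<^theory>\<open>HOL-Library.Poly_Mapping\<close>.
\<close>

type_synonym 'n multi_index = "nat ^ 'n"
type_synonym 'n cvec = "complex ^ 'n"
type_synonym 'n cmat = "complex ^ 'n ^ 'n"
type_synonym 'n cpoly = "'n multi_index \<Rightarrow>\<^sub>0 complex"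
type_synonym 'n diff_op = "'n multi_index \<Rightarrow>\<^sub>0 complex"

definition first_index :: "'n::{finite,linorder}" where
  "first_index = Min UNIV"


section \<open>Polynomials and ideals\<close>

definition poly_eval :: "'n::finite cpoly \<Rightarrow> 'n cvec \<Rightarrow> complex" where
  "poly_eval p x = (\<Sum>\<alpha>\<in>Poly_Mapping.keys p. Poly_Mapping.lookup p \<alpha> * (\<Prod>i\<in>UNIV. (x $ i) ^ (\<alpha> $ i)))"

definition const_poly :: "complex \<Rightarrow> 'n::finite cpoly" where
  "const_poly c = Poly_Mapping.single 0 c"

definition system_map :: "('n::finite \<Rightarrow> 'n cpoly) \<Rightarrow> 'n cvec \<Rightarrow> 'n cvec" where
  "system_map F x = (\<chi> i. poly_eval (F i) x)"

definition is_ideal :: "'a::comm_ring_1 set \<Rightarrow> bool" where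
  "is_ideal = module.subspace (*)"

definition ideal_generated :: "'a::comm_ring_1 set \<Rightarrow> 'a set" where
  "ideal_generated = module.span (*)"

definition radical :: "'a::comm_ring_1 set \<Rightarrow> 'a set" where
  "radical I = {p. \<exists>k>0. p ^ k \<in> I}"

definition primary_ideal :: "'a::comm_ring_1 set \<Rightarrow> bool" where
  "primary_ideal Q \<longleftrightarrow> is_ideal Q \<and> Q \<noteq> UNIV \<and>
     (\<forall>p q. p * q \<in> Q \<longrightarrow> p \<in> Q \<or> (\<exists>k>0. q ^ k \<in> Q))"

definition minimal_primary_decomposition :: "'a::comm_ring_1 set \<Rightarrow> 'a set set \<Rightarrow> bool" where
  "minimal_primary_decomposition I \<Q> \<longleftrightarrow>
     finite \<Q> \<and> (\<forall>Q\<in>\<Q>. primary_ideal Q) \<and> \<Inter>\<Q> = I \<and>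
     inj_on radical \<Q> \<and> (\<forall>Q\<in>\<Q>. \<Inter>(\<Q> - {Q}) \<noteq> I)"

text \<open>
  A component is isolated when its associated prime is minimal among the associated primes.
  Isolated components do not depend on the chosen minimal decomposition.
\<close>

definition isolated_primary_component :: "'a::comm_ring_1 set \<Rightarrow> 'a set \<Rightarrow> 'a set \<Rightarrow> bool" where
  "isolated_primary_component I P Q \<longleftrightarrow>
     (\<exists>\<Q>. minimal_primary_decomposition I \<Q> \<and> Q \<in> \<Q> \<and> radical Q = P \<and>
          (\<forall>Q'\<in>\<Q>. radical Q' \<subseteq> P \<longrightarrow> radical Q' = P))"

definition maximal_ideal_at :: "'n::finite cvec \<Rightarrow> 'n cpoly set" where
  "maximal_ideal_at x = {p. poly_eval p x = 0}"

text \<open>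
  \<open>quotient_basis Q B\<close>: the residue classes of the elements of \<open>B\<close> are pairwise distinct and form a
  basis of the complex vector space \<open>\<complex>[x]/Q\<close>.
\<close>

definition quotient_basis :: "'n::finite cpoly set \<Rightarrow> 'n cpoly set \<Rightarrow> bool" where
  "quotient_basis Q B \<longleftrightarrow> finite B \<and>
     (\<forall>p. \<exists>!c. (\<forall>b. b \<notin> B \<longrightarrow> c b = 0) \<and> p - (\<Sum>b\<in>B. const_poly (c b) * b) \<in> Q)"

definition quotient_has_dim :: "'n::finite cpoly set \<Rightarrow> nat \<Rightarrow> bool" where
  "quotient_has_dim Q d \<longleftrightarrow> (\<exists>B. quotient_basis Q B \<and> card B = d)"

definition has_multiplicity :: "('n::finite \<Rightarrow> 'n cpoly) \<Rightarrow> 'n cvec \<Rightarrow> nat \<Rightarrow> bool" where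
  "has_multiplicity F x \<mu> \<longleftrightarrow>
     (\<exists>Q. isolated_primary_component (ideal_generated (range F)) (maximal_ideal_at x) Q \<and>
          quotient_has_dim Q \<mu>)"


section \<open>Matrices\<close>

definition corank :: "complex ^ 'n ^ 'm \<Rightarrow> nat" where
  "corank A = vec.dim {v. A *v v = 0}"

definition conj_transpose :: "complex ^ 'n ^ 'm \<Rightarrow> complex ^ 'm ^ 'n" where
  "conj_transpose A = (\<chi> i j. cnj (A $ j $ i))"

definition unitary_matrix :: "'n::finite cmat \<Rightarrow> bool" where
  "unitary_matrix R \<longleftrightarrow> conj_transpose R ** R = mat 1 \<and> R ** conj_transpose R = mat 1"

definition singular_pair ::
    "'n::finite cmat \<Rightarrow> real \<Rightarrow> 'n cvec \<Rightarrow> 'n cvec \<Rightarrow> bool" where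
  "singular_pair A \<sigma> u v \<longleftrightarrow> \<sigma> \<ge> 0 \<and> norm u = 1 \<and> norm v = 1 \<and>
     A *v v = complex_of_real \<sigma> *s u \<and> conj_transpose A *v u = complex_of_real \<sigma> *s v"

definition singular_value :: "'n::finite cmat \<Rightarrow> real \<Rightarrow> bool" where
  "singular_value A \<sigma> \<longleftrightarrow> (\<exists>u v. singular_pair A \<sigma> u v)"

definition right_singular_vector :: "'n::finite cmat \<Rightarrow> real \<Rightarrow> 'n cvec \<Rightarrow> bool" where
  "right_singular_vector A \<sigma> v \<longleftrightarrow> (\<exists>u. singular_pair A \<sigma> u v)"

definition smallest_singular_value :: "'n::finite cmat \<Rightarrow> real" where
  "smallest_singular_value A = (LEAST \<sigma>. singular_value A \<sigma>)"

definition scaled_min_right_singular_vector ::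
    "'n::{finite,linorder} cmat \<Rightarrow> 'n cvec \<Rightarrow> bool" where
  "scaled_min_right_singular_vector A a \<longleftrightarrow>
     (\<exists>v. right_singular_vector A (smallest_singular_value A) v \<and> v $ first_index \<noteq> 0 \<and>
          a = inverse (v $ first_index) *s v)"


section \<open>Differentiation and differential operators\<close>

definition partial_deriv :: "'n::finite \<Rightarrow> ('n cvec \<Rightarrow> complex) \<Rightarrow> 'n cvec \<Rightarrow> complex" where
  "partial_deriv i g z = deriv (\<lambda>t. g (z + t *s axis i 1)) 0"

definition complex_jacobian :: "('n::finite cvec \<Rightarrow> 'n cvec) \<Rightarrow> 'n cvec \<Rightarrow> 'n cmat" where
  "complex_jacobian H z = (\<chi> i j. partial_deriv j (\<lambda>w. H w $ i) z)"

definition D_op :: "'n::{finite,linorder} multi_index \<Rightarrow> 'n diff_op" where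
  "D_op \<alpha> = Poly_Mapping.single \<alpha> 1"

definition apply_D ::
    "'n::{finite,linorder} multi_index \<Rightarrow> ('n cvec \<Rightarrow> complex) \<Rightarrow> 'n cvec \<Rightarrow> complex" where
  "apply_D \<alpha> g z =
     (1 / (\<Prod>i\<in>UNIV. fact (\<alpha> $ i))) *
     foldr (\<lambda>i. partial_deriv i ^^ (\<alpha> $ i)) (sorted_list_of_set UNIV) g z"

definition apply_op ::
    "'n::{finite,linorder} diff_op \<Rightarrow> ('n cvec \<Rightarrow> complex) \<Rightarrow> 'n cvec \<Rightarrow> complex" where
  "apply_op L g z = (\<Sum>\<alpha>\<in>Poly_Mapping.keys L. Poly_Mapping.lookup L \<alpha> * apply_D \<alpha> g z)"

definition apply_op_system ::
    "'n::{finite,linorder} diff_op \<Rightarrow> ('n cvec \<Rightarrow> 'n cvec) \<Rightarrow> 'n cvec \<Rightarrow> 'n cvec" where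
  "apply_op_system L H z = (\<chi> i. apply_op L (\<lambda>w. H w $ i) z)"

definition op_scale :: "complex \<Rightarrow> 'n::finite diff_op \<Rightarrow> 'n diff_op" where
  "op_scale c L = Poly_Mapping.map (\<lambda>x. c * x) L"

definition Psi :: "'n::finite \<Rightarrow> 'n diff_op \<Rightarrow> 'n diff_op" where
  "Psi j L = (\<Sum>\<alpha>\<in>Poly_Mapping.keys L. Poly_Mapping.single (\<alpha> + axis j 1) (Poly_Mapping.lookup L \<alpha>))"

text \<open>The part of an operator consisting of the terms with \<open>\<alpha>\<^sub>1 = \<dots> = \<alpha>\<^bsub>j-1\<^esub> = 0\<close>.\<close>

definition part_vanishing_below :: "'n::{finite,linorder} \<Rightarrow> 'n diff_op \<Rightarrow> 'n diff_op" where
  "part_vanishing_below j L =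
     (\<Sum>\<alpha>\<in>{\<alpha>\<in>Poly_Mapping.keys L. \<forall>i<j. \<alpha> $ i = 0}. Poly_Mapping.single \<alpha> (Poly_Mapping.lookup L \<alpha>))"


section \<open>The algorithm MultipleRootRefinerBreadthOne\<close>

text \<open>
  The steps are relations between inputs and outputs because singular vectors, the unitary completion
  and solutions of linear systems involve choices.  The \<open>k\<close>-th scaled singular vector
  \<open>[1, a\<^bsub>k,2\<^esub>, \<dots>, a\<^bsub>k,n\<^esub>]\<close> is \<open>a k\<close>.
\<close>

definition refiner_step1 :: "('n::finite \<Rightarrow> 'n cpoly) \<Rightarrow> 'n cvec \<Rightarrow> 'n cvec \<Rightarrow> bool" where
  "refiner_step1 F x y \<longleftrightarrow>
     (let A = complex_jacobian (system_map F) x;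
          b = - system_map F x;
          \<sigma> = smallest_singular_value A
      in (conj_transpose A ** A + mat (complex_of_real \<sigma>)) *v y = conj_transpose A *v b)"

text \<open>\<open>w\<close> is the point \<open>x + y\<close> obtained in step 1.\<close>

definition refiner_step2 ::
    "('n::{finite,linorder} \<Rightarrow> 'n cpoly) \<Rightarrow> 'n cvec \<Rightarrow> 'n cmat \<Rightarrow> bool" where
  "refiner_step2 F w R \<longleftrightarrow>
     (let J = complex_jacobian (system_map F) w
      in unitary_matrix R \<and>
         right_singular_vector J (smallest_singular_value J) (column first_index R))"

definition Q_op ::
    "(nat \<Rightarrow> 'n cvec) \<Rightarrow> (nat \<Rightarrow> 'n diff_op) \<Rightarrow> nat \<Rightarrow> 'n::{finite,linorder} \<Rightarrow> 'n diff_op" where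
  "Q_op a L k j = (\<Sum>i\<in>{2..<k}. op_scale (a i $ j) (L (k - i)))"

definition P_op ::
    "(nat \<Rightarrow> 'n cvec) \<Rightarrow> (nat \<Rightarrow> 'n diff_op) \<Rightarrow> nat \<Rightarrow> 'n::{finite,linorder} diff_op" where
  "P_op a L k = Psi first_index (L (k - 1)) +
     (\<Sum>j\<in>UNIV - {first_index}. Psi j (part_vanishing_below j (Q_op a L k j)))"

text \<open>The matrix \<open>[P(H)(z), \<partial>H(z)/\<partial>z\<^sub>2, \<dots>, \<partial>H(z)/\<partial>z\<^sub>n]\<close>.\<close>

definition bordered_matrix ::
    "'n::{finite,linorder} diff_op \<Rightarrow> ('n cvec \<Rightarrow> 'n cvec) \<Rightarrow> 'n cvec \<Rightarrow> 'n cmat" where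
  "bordered_matrix P H z =
     (\<chi> i j. if j = first_index then apply_op_system P H z $ i else complex_jacobian H z $ i $ j)"

definition numerical_closed_basis ::
    "('n cvec \<Rightarrow> 'n cvec) \<Rightarrow> 'n cvec \<Rightarrow> nat \<Rightarrow>
     (nat \<Rightarrow> 'n cvec) \<Rightarrow> (nat \<Rightarrow> 'n::{finite,linorder} diff_op) \<Rightarrow> bool" where
  "numerical_closed_basis H z \<mu> a L \<longleftrightarrow>
     L 0 = D_op 0 \<and> L 1 = D_op (axis first_index 1) \<and>
     (\<forall>k\<in>{2..<\<mu>}.
        scaled_min_right_singular_vector (bordered_matrix (P_op a L k) H z) (a k) \<and>
        L k = P_op a L k + (\<Sum>j\<in>UNIV - {first_index}. op_scale (a k $ j) (D_op (axis j 1))))"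

definition refiner_step4 ::
    "('n cvec \<Rightarrow> 'n cvec) \<Rightarrow> 'n cvec \<Rightarrow> nat \<Rightarrow>
     (nat \<Rightarrow> 'n cvec) \<Rightarrow> (nat \<Rightarrow> 'n::{finite,linorder} diff_op) \<Rightarrow> complex \<Rightarrow> bool" where
  "refiner_step4 H z \<mu> a L \<delta> \<longleftrightarrow>
     (\<exists>v. bordered_matrix (P_op a L \<mu>) H z *v v = - apply_op_system (L (\<mu> - 1)) H z \<and>
          \<delta> = v $ first_index / of_nat \<mu>)"

definition refiner_returns ::
    "('n::{finite,linorder} \<Rightarrow> 'n cpoly) \<Rightarrow> nat \<Rightarrow> 'n cvec \<Rightarrow> 'n cvec \<Rightarrow> bool" where
  "refiner_returns F \<mu> x x_new \<longleftrightarrow>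
     (\<exists>y R a L \<delta>.
        refiner_step1 F x y \<and>
        refiner_step2 F (x + y) R \<and>
        (let H = (\<lambda>z. system_map F (R *v z));
             z = matrix_inv R *v (x + y)
         in numerical_closed_basis H z \<mu> a L \<and> refiner_step4 H z \<mu> a L \<delta>) \<and>
        x_new = x + y + \<delta> *s column first_index R)"

end

theory Submission
  imports Defs "HOL-Computational_Algebra.Polynomial"
begin

text \<open>
  Since the Jacobian has corank one, there is a polynomial curve \<open>X\<close> through the root, tangent to the
  kernel, along which \<open>F (X t) = c t\<^sup>\<mu> + O(t\<^bsup>\<mu>+1\<^esup>)\<close> with \<open>c\<close> outside the range of the Jacobian; the
  order of contact is the multiplicity. Step 1 lands within \<open>O(\<epsilon>\<^sup>2)\<close> of the point \<open>X \<tau>\<close> of this curve for some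
  \<open>\<tau> = O(\<epsilon>)\<close>. The recursion for the operators \<open>L\<^sub>k\<close> makes \<open>L\<^sub>k(H)\<close> the coefficient of \<open>s\<^sup>k\<close> of \<open>H\<close> along
  \<open>z + (s, a\<^sub>2 s\<^sup>2 + a\<^sub>3 s\<^sup>3 + \<dots>)\<close>. By induction on \<open>k\<close>, the \<open>a\<^sub>k\<close> given by the singular vectors make this
  curve agree, up to errors \<open>O(\<epsilon>\<^sup>2)\<close> in the coefficients below \<open>\<mu> - 1\<close> and \<open>O(\<epsilon>)\<close> at \<open>\<mu> - 1\<close>, with a
  reparametrisation \<open>X (\<sigma> s)\<close>, \<open>\<sigma> 0 = \<tau>\<close>, of the contact curve. The last two coefficients of
  \<open>c (\<sigma> s)\<^sup>\<mu>\<close> then show that the correction of step 4 moves the point back along the curve by \<open>\<tau>\<close>.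
\<close>

section \<open>Polynomial evaluation and gradients\<close>

text \<open>The accuracy rests on where errors of size \<epsilon> are tolerable. Along the
  reparametrised contact curve the system has coefficients with a factor
  \<open>\<tau> ^ (\<mu> - k)\<close> in order \<open>k < \<mu>\<close>: they are negligible up to
  order \<open>\<mu> - 2\<close>, while the one of order \<open>\<mu> - 1\<close> is linear in
  \<tau> and is the signal that step 4 compares with order \<mu>. The computed curve is known in
  order \<open>\<mu> - 1\<close> only up to an error as large as that signal. This is harmless
  because the error enters through the Jacobian alone, in a direction orthogonal to the first column
  of \<open>R\<close>, and is absorbed by the unknowns of the linear system other than the first.
  Singular vectors are accessible only as minimisers. Each is compared with an explicit test vector
  of small image, and the comparison is uniform because the leading coefficient \<open>c\<close> and
  the range of the Jacobian span the whole space. The same bounds show that the algorithm does not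
  break down near the root: the entries used for scaling are nonzero and the last matrix is
  invertible.\<close>

definition var :: "'n::finite \<Rightarrow> 'n cpoly" where
  "var i = Poly_Mapping.single (axis i 1) 1"

definition power_product :: "('n::finite \<Rightarrow> 'a::comm_ring_1) \<Rightarrow> 'n multi_index \<Rightarrow> 'a" where
  "power_product X \<alpha> = (\<Prod>i\<in>UNIV. X i ^ (\<alpha> $ i))"

text \<open>The coefficient map \<open>h\<close> lets one evaluation serve three purposes: the
  identity gives values, \<open>[:c:]\<close> gives the restriction to a polynomial curve, and
  \<open>const_poly\<close> gives substitution of polynomials for the variables.\<close>

definition peval :: "(complex \<Rightarrow> 'a::comm_ring_1) \<Rightarrow> ('n::finite \<Rightarrow> 'a) \<Rightarrow> 'n cpoly \<Rightarrow> 'a" where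
  "peval h X p = (\<Sum>\<alpha>\<in>Poly_Mapping.keys p. h (Poly_Mapping.lookup p \<alpha>) * power_product X \<alpha>)"

lemma power_product_0 [simp]: "power_product X 0 = 1"
  by (simp add: power_product_def)

lemma power_product_add: "power_product X (\<alpha> + \<beta>) = power_product X \<alpha> * power_product X \<beta>"
  by (simp add: power_product_def power_add prod.distrib)

lemma power_product_axis: "power_product X (axis i k) = X i ^ k"
proof -
  have "(\<Prod>j\<in>UNIV. X j ^ (axis i k $ j)) = (\<Prod>j\<in>UNIV. if j = i then X j ^ k else 1)"
    by (rule prod.cong) (auto simp: axis_def)
  then show ?thesis by (simp add: power_product_def)
qed

lemma single_sum_keys:
  "p = (\<Sum>\<alpha>\<in>Poly_Mapping.keys p. Poly_Mapping.single \<alpha> (Poly_Mapping.lookup p \<alpha>))"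
  by (rule poly_mapping_eqI)
    (auto simp: lookup_sum lookup_single when_def in_keys_iff)

lemma const_poly_add: "const_poly (a + b) = const_poly a + const_poly b"
  by (simp add: const_poly_def single_add)

lemma const_poly_mult: "const_poly (a * b) = const_poly a * const_poly b"
  by (simp add: const_poly_def mult_single)

lemma const_poly_0 [simp]: "const_poly 0 = 0"
  by (simp add: const_poly_def)

lemma const_poly_1 [simp]: "const_poly 1 = 1"
  by (simp add: const_poly_def)

locale coeff_hom =
  fixes h :: "complex \<Rightarrow> 'a::comm_ring_1"
  assumes hom_0: "h 0 = 0" and hom_1: "h 1 = 1"
    and hom_add: "h (a + b) = h a + h b" and hom_mult: "h (a * b) = h a * h b"
begin

lemma peval_superset:
  assumes "finite S" "Poly_Mapping.keys p \<subseteq> S"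
  shows "peval h X p = (\<Sum>\<alpha>\<in>S. h (Poly_Mapping.lookup p \<alpha>) * power_product X \<alpha>)"
  unfolding peval_def
  by (rule sum.mono_neutral_left) (use assms in \<open>auto simp: in_keys_iff hom_0\<close>)

lemma peval_0 [simp]: "peval h X 0 = 0"
  by (simp add: peval_def hom_0)

lemma peval_add: "peval h X (p + q) = peval h X p + peval h X q"
proof -
  let ?S = "Poly_Mapping.keys p \<union> Poly_Mapping.keys q"
  have "Poly_Mapping.keys (p + q) \<subseteq> ?S" by (rule keys_add)
  then show ?thesis
    by (simp add: peval_superset[of ?S] lookup_add hom_add hom_0 distrib_right sum.distrib)
qed

lemma peval_sum: "peval h X (sum f A) = (\<Sum>i\<in>A. peval h X (f i))"
  by (induction A rule: infinite_finite_induct) (auto simp: peval_add)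

lemma peval_single: "peval h X (Poly_Mapping.single \<alpha> c) = h c * power_product X \<alpha>"
  by (simp add: peval_def hom_0)

lemma peval_mult: "peval h X (p * q) = peval h X p * peval h X q"
proof -
  have s: "peval h X (Poly_Mapping.single \<alpha> a * Poly_Mapping.single \<beta> b) =
    peval h X (Poly_Mapping.single \<alpha> a) * peval h X (Poly_Mapping.single \<beta> b)" for \<alpha> \<beta> a b
    by (simp add: mult_single peval_single power_product_add hom_mult mult_ac)
  have "p * q = (\<Sum>\<alpha>\<in>Poly_Mapping.keys p. Poly_Mapping.single \<alpha> (Poly_Mapping.lookup p \<alpha>)) *
    (\<Sum>\<beta>\<in>Poly_Mapping.keys q. Poly_Mapping.single \<beta> (Poly_Mapping.lookup q \<beta>))"
    by (rule arg_cong2[OF single_sum_keys single_sum_keys])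
  then show ?thesis
    by (simp only: sum_product peval_sum s peval_single) (simp add: peval_def sum_product)
qed

lemma peval_const [simp]: "peval h X (const_poly c) = h c"
  by (simp add: const_poly_def peval_single)

lemma peval_1 [simp]: "peval h X 1 = 1"
  using peval_const[of X 1] by (simp add: hom_1)

lemma peval_var [simp]: "peval h X (var i) = X i"
  by (simp add: var_def peval_single power_product_axis hom_1)

lemma peval_uminus: "peval h X (- p) = - peval h X p"
  using peval_add[of X p "- p"] by (simp add: eq_neg_iff_add_eq_0 add.commute)

lemma peval_diff: "peval h X (p - q) = peval h X p - peval h X q"
  using peval_add[of X p "- q"] by (simp add: peval_uminus)

lemma peval_power: "peval h X (p ^ k) = peval h X p ^ k"
  by (induction k) (auto simp: peval_mult)

lemma peval_prod: "peval h X (prod f A) = (\<Prod>i\<in>A. peval h X (f i))"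
  by (induction A rule: infinite_finite_induct) (auto simp: peval_mult)

end

interpretation ev_const: coeff_hom const_poly
  by (rule coeff_hom.intro[OF const_poly_0 const_poly_1 const_poly_add const_poly_mult])

interpretation ev_id: coeff_hom "\<lambda>c. c"
  by (rule coeff_hom.intro) (rule refl)+

interpretation ev_curve: coeff_hom "\<lambda>c. [:c:]"
  by (rule coeff_hom.intro) simp_all

lemma poly_eval_peval: "poly_eval p x = peval (\<lambda>c. c) (\<lambda>i. x $ i) p"
  by (simp add: poly_eval_def peval_def power_product_def)

lemma power_product_var: "power_product var \<alpha> = Poly_Mapping.single \<alpha> 1"
proof -
  have pw: "Poly_Mapping.single \<beta> (1::complex) ^ k = Poly_Mapping.single (of_nat k * \<beta>) 1"
    for \<beta> :: "'a multi_index" and k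
    by (induction k) (auto simp: mult_single algebra_simps)
  have pr: "(\<Prod>i\<in>A. Poly_Mapping.single (f i) (1::complex)) = Poly_Mapping.single (\<Sum>i\<in>A. f i) 1"
    for f :: "'a \<Rightarrow> 'a multi_index" and A
    by (induction A rule: infinite_finite_induct) (auto simp: mult_single)
  have "(\<Sum>i\<in>UNIV. of_nat (\<alpha> $ i) * axis i 1) = \<alpha>"
    by (rule vec_eq_iff[THEN iffD2])
      (simp add: axis_def of_nat_index if_distrib[of "\<lambda>x. _ * x"] cong: if_cong)
  then show ?thesis
    by (simp add: power_product_def var_def pw pr)
qed

lemma peval_const_var [simp]: "peval const_poly var p = p"
proof -
  have "peval const_poly var p =
    (\<Sum>\<alpha>\<in>Poly_Mapping.keys p. Poly_Mapping.single \<alpha> (Poly_Mapping.lookup p \<alpha>))"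
    by (simp add: peval_def power_product_var const_poly_def mult_single)
  also have "\<dots> = p" by (rule single_sum_keys[symmetric])
  finally show ?thesis .
qed

text \<open>Each \<open>p\<close> equals \<open>peval const_poly var p\<close>, a finite sum of
  products of constants and variables. Facts about gradients and asymptotic expansions are reduced
  in this way to sum and product rules.\<close>

lemma cpoly_induct [case_names const var add mult]:
  assumes c: "\<And>c. P (const_poly c)" and v: "\<And>i. P (var i)"
    and a: "\<And>p q. P p \<Longrightarrow> P q \<Longrightarrow> P (p + q)" and m: "\<And>p q. P p \<Longrightarrow> P q \<Longrightarrow> P (p * q)"
  shows "P p"
proof -
  have 0: "P 0" and 1: "P 1" using c[of 0] c[of 1] by auto
  have pw: "P (q ^ k)" if "P q" for q k by (induction k) (auto simp: 1 m that)
  have pr: "P (prod f A)" if "\<And>i. P (f i)" for f and A :: "'a set"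
    by (induction A rule: infinite_finite_induct) (auto simp: 1 m that)
  have su: "P (sum f A)" if "\<And>i. P (f i)" for f and A :: "'a multi_index set"
    by (induction A rule: infinite_finite_induct) (auto simp: 0 a that)
  have "P (peval const_poly var p)"
    unfolding peval_def power_product_def by (intro su m c pr pw v)
  then show ?thesis by simp
qed

text \<open>Evaluation is determined by its effect on constants and variables, so a map respecting
  sums and products commutes with it. The composition laws between values, curves and substitutions
  are instances.\<close>

lemma peval_hom_comp:
  assumes "\<And>a b. f (a + b) = f a + f b" "\<And>a b. f (a * b) = f a * f b"
    "coeff_hom h" "coeff_hom k" "\<And>c. f (h c) = k c"
  shows "f (peval h X p) = peval k (\<lambda>i. f (X i)) p"
proof -
  interpret h: coeff_hom h by fact
  interpret k: coeff_hom k by fact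
  show ?thesis
    by (induction p rule: cpoly_induct) (auto simp: assms(1,2,5) h.peval_add h.peval_mult k.peval_add k.peval_mult)
qed

lemma peval_peval_const:
  assumes "coeff_hom h"
  shows "peval h Y (peval const_poly X p) = peval h (\<lambda>i. peval h Y (X i)) p"
proof -
  interpret coeff_hom h by fact
  show ?thesis
    by (rule peval_hom_comp) (auto simp: peval_add peval_mult assms ev_const.coeff_hom_axioms)
qed

lemma poly_peval_curve:
  "poly (peval (\<lambda>c. [:c:]) X p) t = poly_eval p (\<chi> i. poly (X i) t)"
proof -
  have "poly (peval (\<lambda>c. [:c:]) X p) t = peval (\<lambda>c. c) (\<lambda>i. poly (X i) t) p"
    by (rule peval_hom_comp) (auto simp: ev_id.coeff_hom_axioms ev_curve.coeff_hom_axioms)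
  then show ?thesis by (simp add: poly_eval_peval vec_lambda_inverse)
qed

lemma pcompose_peval_curve:
  "pcompose (peval (\<lambda>c. [:c:]) X p) \<sigma> = peval (\<lambda>c. [:c:]) (\<lambda>i. pcompose (X i) \<sigma>) p"
  by (subst peval_hom_comp[where f = "\<lambda>q. pcompose q \<sigma>" and k = "\<lambda>c. [:c:]"])
    (auto simp: pcompose_add pcompose_mult ev_curve.coeff_hom_axioms)

lemmas poly_eval_simps =
  ev_id.peval_add[of "\<lambda>i. x $ i" for x, folded poly_eval_peval]
  ev_id.peval_mult[of "\<lambda>i. x $ i" for x, folded poly_eval_peval]
  ev_id.peval_diff[of "\<lambda>i. x $ i" for x, folded poly_eval_peval]
  ev_id.peval_const[of "\<lambda>i. x $ i" for x, folded poly_eval_peval]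
  ev_id.peval_var[of "\<lambda>i. x $ i" for x, folded poly_eval_peval]
  ev_id.peval_power[of "\<lambda>i. x $ i" for x, folded poly_eval_peval]
  ev_id.peval_prod[of "\<lambda>i. x $ i" for x, folded poly_eval_peval]
  ev_id.peval_sum[of "\<lambda>i. x $ i" for x, folded poly_eval_peval]
  ev_id.peval_0[of "\<lambda>i. x $ i" for x, folded poly_eval_peval]
  ev_id.peval_1[of "\<lambda>i. x $ i" for x, folded poly_eval_peval]

definition grad :: "'n::finite cpoly \<Rightarrow> 'n cvec \<Rightarrow> 'n cvec" where
  "grad p x = (\<chi> j. partial_deriv j (poly_eval p) x)"

lemma poly_eval_field_differentiable:
  "(\<lambda>t. poly_eval p (x + t *s v)) field_differentiable (at t)"
proof (induction p rule: cpoly_induct)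
  case (var i)
  show ?case unfolding poly_eval_simps vector_add_component vector_smult_component
    by (intro field_differentiable_add field_differentiable_mult field_differentiable_const field_differentiable_ident)
qed (simp_all add: poly_eval_simps field_differentiable_add field_differentiable_mult)

lemma grad_const [simp]: "grad (const_poly c) x = 0"
  by (simp add: grad_def partial_deriv_def poly_eval_simps vec_eq_iff)

lemma grad_var: "grad (var i) x = axis i 1"
proof -
  have "deriv (\<lambda>t. x $ i + t * axis j 1 $ i) 0 = axis i 1 $ j" for j
    by (rule DERIV_imp_deriv) (auto simp: axis_def intro!: derivative_eq_intros)
  then show ?thesis by (simp add: grad_def partial_deriv_def poly_eval_simps vec_eq_iff)
qed

lemma grad_add: "grad (p + q) x = grad p x + grad q x"
  by (simp add: grad_def partial_deriv_def poly_eval_simps vec_eq_iff deriv_add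
      poly_eval_field_differentiable)

lemma grad_mult: "grad (p * q) x = poly_eval q x *s grad p x + poly_eval p x *s grad q x"
  by (simp add: grad_def partial_deriv_def poly_eval_simps vec_eq_iff deriv_mult
      poly_eval_field_differentiable)

text \<open>Directional derivatives are needed because the partial derivatives of the rotated system
  are derivatives of \<open>F\<close> along the columns of \<open>R\<close>.\<close>

lemma poly_eval_has_derivative_line:
  "((\<lambda>t. poly_eval p (x + t *s v)) has_field_derivative (\<Sum>j\<in>UNIV. grad p x $ j * v $ j)) (at 0)"
proof (induction p rule: cpoly_induct)
  case (var i)
  have "((\<lambda>t. x $ i + t * v $ i) has_field_derivative v $ i) (at 0)"
    by (auto intro!: derivative_eq_intros)
  moreover have "(\<Sum>j\<in>UNIV. grad (var i) x $ j * v $ j) = v $ i"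
    by (simp add: grad_var axis_def if_distrib[of "\<lambda>x. x * _"] cong: if_cong)
  ultimately show ?case by (simp add: poly_eval_simps)
next
  case (add p q)
  have "((\<lambda>t. poly_eval p (x + t *s v) + poly_eval q (x + t *s v)) has_field_derivative
    (\<Sum>j\<in>UNIV. grad p x $ j * v $ j) + (\<Sum>j\<in>UNIV. grad q x $ j * v $ j)) (at 0)"
    by (rule DERIV_add[OF add])
  then show ?case by (simp add: poly_eval_simps grad_add distrib_right sum.distrib)
next
  case (mult p q)
  have "((\<lambda>t. poly_eval p (x + t *s v) * poly_eval q (x + t *s v)) has_field_derivative
    (\<Sum>j\<in>UNIV. grad p x $ j * v $ j) * poly_eval q (x + 0 *s v) +
    (\<Sum>j\<in>UNIV. grad q x $ j * v $ j) * poly_eval p (x + 0 *s v)) (at 0)"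
    by (rule DERIV_mult[OF mult])
  moreover have "(\<Sum>j\<in>UNIV. grad (p * q) x $ j * v $ j) =
    (\<Sum>j\<in>UNIV. grad p x $ j * v $ j) * poly_eval q (x + 0 *s v) +
    (\<Sum>j\<in>UNIV. grad q x $ j * v $ j) * poly_eval p (x + 0 *s v)"
    unfolding sum_distrib_right sum.distrib[symmetric]
    by (rule sum.cong) (simp_all add: grad_mult algebra_simps)
  ultimately show ?case
    unfolding poly_eval_simps by (rule DERIV_cong[OF _ sym])
next
  case (const c)
  show ?case unfolding poly_eval_simps by simp
qed

definition jac :: "('n::finite \<Rightarrow> 'n cpoly) \<Rightarrow> 'n cvec \<Rightarrow> 'n cmat" where
  "jac F x = (\<chi> i. grad (F i) x)"

lemma complex_jacobian_system: "complex_jacobian (system_map F) x = jac F x"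
  by (simp add: complex_jacobian_def jac_def grad_def vec_eq_iff system_map_def)

lemma matrix_vector_mult_axis: "A *v axis k (1::complex) = column k A"
proof -
  have "(\<Sum>j\<in>UNIV. A $ i $ j * axis k 1 $ j) = A $ i $ k" for i
    by (simp add: axis_def if_distrib[of "\<lambda>x. _ * x"] cong: if_cong)
  then show ?thesis by (simp add: matrix_vector_mult_def column_def vec_eq_iff)
qed

lemma complex_jacobian_compose:
  "complex_jacobian (\<lambda>z. system_map F (R *v z)) z = jac F (R *v z) ** R"
proof -
  have "partial_deriv j (\<lambda>w. system_map F (R *v w) $ i) z =
    (\<Sum>k\<in>UNIV. grad (F i) (R *v z) $ k * R $ k $ j)" for i j
  proof -
    have e: "R *v (z + t *s axis j 1) = R *v z + t *s column j R" for t
      unfolding matrix_vector_right_distrib vector_scalar_commute matrix_vector_mult_axis ..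
    have "partial_deriv j (\<lambda>w. system_map F (R *v w) $ i) z =
      deriv (\<lambda>t. poly_eval (F i) (R *v z + t *s column j R)) 0"
      unfolding partial_deriv_def system_map_def vec_lambda_beta e ..
    also have "\<dots> = (\<Sum>k\<in>UNIV. grad (F i) (R *v z) $ k * column j R $ k)"
      by (rule DERIV_imp_deriv[OF poly_eval_has_derivative_line])
    finally show ?thesis by (simp add: column_def)
  qed
  then show ?thesis
    unfolding complex_jacobian_def jac_def matrix_matrix_mult_def by simp
qed

section \<open>Uniform asymptotic estimates\<close>

definition bigO :: "'p filter \<Rightarrow> ('p \<Rightarrow> real) \<Rightarrow> ('p \<Rightarrow> 'b::real_normed_vector) \<Rightarrow> bool" where
  "bigO G e u \<longleftrightarrow> (\<exists>C. \<forall>\<^sub>F p in G. norm (u p) \<le> C * \<bar>e p\<bar>)"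

lemma bigOI: "\<forall>\<^sub>F p in G. norm (u p) \<le> C * \<bar>e p\<bar> \<Longrightarrow> bigO G e u"
  by (auto simp: bigO_def)

lemma bigOE:
  assumes "bigO G e u"
  obtains C where "C > 0" "\<forall>\<^sub>F p in G. norm (u p) \<le> C * \<bar>e p\<bar>"
proof -
  from assms obtain C where C: "\<forall>\<^sub>F p in G. norm (u p) \<le> C * \<bar>e p\<bar>" by (auto simp: bigO_def)
  have "\<forall>\<^sub>F p in G. norm (u p) \<le> max C 1 * \<bar>e p\<bar>"
    using C by eventually_elim (meson order_trans mult_right_mono max.cobounded1 abs_ge_zero)
  then show ?thesis using that[of "max C 1"] by auto
qed

lemma bigO_zero [simp]: "bigO G e (\<lambda>p. 0)"
  by (rule bigOI[where C = 0]) simp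

lemma bigO_const [simp]: "bigO G (\<lambda>_. 1) (\<lambda>p. c)"
  by (rule bigOI[where C = "norm c"]) simp

lemma bigO_cong:
  assumes "\<forall>\<^sub>F p in G. u p = v p" "bigO G e u"
  shows "bigO G e v"
proof -
  from assms(2) obtain C where "\<forall>\<^sub>F p in G. norm (u p) \<le> C * \<bar>e p\<bar>" by (auto simp: bigO_def)
  with assms(1) have "\<forall>\<^sub>F p in G. norm (v p) \<le> C * \<bar>e p\<bar>" by eventually_elim simp
  then show ?thesis by (rule bigOI)
qed

lemma bigO_add:
  assumes "bigO G e u" "bigO G e v"
  shows "bigO G e (\<lambda>p. u p + v p)"
proof -
  obtain C D where "\<forall>\<^sub>F p in G. norm (u p) \<le> C * \<bar>e p\<bar>" "\<forall>\<^sub>F p in G. norm (v p) \<le> D * \<bar>e p\<bar>"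
    using assms by (auto simp: bigO_def)
  then have "\<forall>\<^sub>F p in G. norm (u p + v p) \<le> (C + D) * \<bar>e p\<bar>"
    by eventually_elim (metis distrib_right norm_add_rule_thm)
  then show ?thesis by (rule bigOI)
qed

lemma bigO_minus: "bigO G e u \<Longrightarrow> bigO G e (\<lambda>p. - u p)"
  by (simp add: bigO_def)

lemma bigO_diff: "bigO G e u \<Longrightarrow> bigO G e v \<Longrightarrow> bigO G e (\<lambda>p. u p - v p)"
  using bigO_add[OF _ bigO_minus, of G e u v] by simp

lemma bigO_sum:
  assumes "\<And>i. i \<in> A \<Longrightarrow> bigO G e (\<lambda>p. u p i)"
  shows "bigO G e (\<lambda>p. \<Sum>i\<in>A. u p i)"
  using assms by (induction A rule: infinite_finite_induct) (auto intro!: bigO_add)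

lemma bigO_le:
  assumes "bigO G e v" "\<forall>\<^sub>F p in G. norm (u p) \<le> K * norm (v p)"
  shows "bigO G e u"
proof -
  obtain C where C: "\<forall>\<^sub>F p in G. norm (v p) \<le> C * \<bar>e p\<bar>" using assms(1) by (auto simp: bigO_def)
  have "\<forall>\<^sub>F p in G. norm (u p) \<le> (max K 0 * C) * \<bar>e p\<bar>"
    using C assms(2)
  proof eventually_elim
    case (elim p)
    have "norm (u p) \<le> max K 0 * norm (v p)"
      using elim(2) mult_right_mono[of K "max K 0" "norm (v p)"] by simp
    also have "\<dots> \<le> max K 0 * (C * \<bar>e p\<bar>)"
      by (rule mult_left_mono[OF elim(1)]) simp
    finally show ?case by (simp add: mult.assoc)
  qed
  then show ?thesis by (rule bigOI)
qed

lemma bigO_norm: "bigO G e (\<lambda>p. norm (u p)) \<longleftrightarrow> bigO G e u"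
  by (simp add: bigO_def)

lemma bigO_bilinear:
  assumes "bigO G e u" "bigO G f v" "\<And>p. norm (w p) \<le> norm (u p) * norm (v p)"
  shows "bigO G (\<lambda>p. e p * f p) w"
proof -
  obtain C where *: "C > 0" "\<forall>\<^sub>F p in G. norm (u p) \<le> C * \<bar>e p\<bar>"
    by (rule bigOE[OF assms(1)])
  obtain D where "\<forall>\<^sub>F p in G. norm (v p) \<le> D * \<bar>f p\<bar>"
    by (rule bigOE[OF assms(2)])
  with *(2) have "\<forall>\<^sub>F p in G. norm (w p) \<le> (C * D) * \<bar>e p * f p\<bar>"
  proof eventually_elim
    case (elim p)
    have "norm (w p) \<le> (C * \<bar>e p\<bar>) * (D * \<bar>f p\<bar>)"
      by (rule order_trans[OF assms(3)]) (rule mult_mono[OF elim], use \<open>C > 0\<close> in auto)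
    then show ?case by (simp add: abs_mult mult_ac)
  qed
  then show ?thesis by (rule bigOI)
qed

lemma bigO_mult:
  fixes u v :: "'p \<Rightarrow> 'b::real_normed_algebra"
  shows "bigO G e u \<Longrightarrow> bigO G f v \<Longrightarrow> bigO G (\<lambda>p. e p * f p) (\<lambda>p. u p * v p)"
  by (rule bigO_bilinear) (auto simp: norm_mult_ineq)

lemma bigO_mult_1:
  fixes u v :: "'p \<Rightarrow> 'b::real_normed_algebra"
  shows "bigO G e u \<Longrightarrow> bigO G (\<lambda>_. 1) v \<Longrightarrow> bigO G e (\<lambda>p. u p * v p)"
    "bigO G (\<lambda>_. 1) u \<Longrightarrow> bigO G e v \<Longrightarrow> bigO G e (\<lambda>p. u p * v p)"
  using bigO_mult[of G e u "\<lambda>_. 1" v] bigO_mult[of G "\<lambda>_. 1" u e v] by simp_all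

lemma bigO_mono:
  assumes "bigO G e u" "bigO G f e"
  shows "bigO G f u"
proof -
  obtain C where *: "C > 0" "\<forall>\<^sub>F p in G. norm (u p) \<le> C * \<bar>e p\<bar>"
    by (rule bigOE[OF assms(1)])
  obtain D where "\<forall>\<^sub>F p in G. norm (e p) \<le> D * \<bar>f p\<bar>"
    by (rule bigOE[OF assms(2)])
  with *(2) have "\<forall>\<^sub>F p in G. norm (u p) \<le> (C * D) * \<bar>f p\<bar>"
  proof eventually_elim
    case (elim p)
    have "C * \<bar>e p\<bar> \<le> C * (D * \<bar>f p\<bar>)" using elim(2) \<open>C > 0\<close> by (intro mult_left_mono) auto
    with elim(1) show ?case by (simp add: mult.assoc)
  qed
  then show ?thesis by (rule bigOI)
qed

lemma bigO_power_1: "bigO G (\<lambda>_. 1) u \<Longrightarrow> bigO G (\<lambda>_. 1) (\<lambda>p. (u p :: complex) ^ k)"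
  by (induction k) (auto intro!: bigO_mult_1)

lemma bigO_vec_iff:
  fixes u :: "'p \<Rightarrow> ('b::real_normed_vector) ^ 'n"
  shows "bigO G e u \<longleftrightarrow> (\<forall>i. bigO G e (\<lambda>p. u p $ i))"
proof safe
  fix i assume "bigO G e u"
  then show "bigO G e (\<lambda>p. u p $ i)"
    by (rule bigO_le[where K = 1]) (simp add: Finite_Cartesian_Product.norm_nth_le)
next
  assume "\<forall>i. bigO G e (\<lambda>p. u p $ i)"
  then have "bigO G e (\<lambda>p. \<Sum>i\<in>UNIV. norm (u p $ i))"
    by (intro bigO_sum) (simp add: bigO_norm)
  then show "bigO G e u"
    by (rule bigO_le[where K = 1])
      (auto simp: norm_vec_def intro!: always_eventually order_trans[OF L2_set_le_sum] order_trans[OF _ abs_ge_self])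
qed

section \<open>Taylor expansion of coefficients along polynomial curves\<close>

abbreviation "cev \<equiv> peval (\<lambda>c::complex. [:c:])"

lemma coeff_cev_0: "coeff (cev X q) 0 = poly_eval q (\<chi> i. coeff (X i) 0)"
  using poly_peval_curve[of X q 0] by (simp add: poly_0_coeff_0)

lemma bigO_coeff_mult:
  assumes "\<And>i. i \<le> k \<Longrightarrow> bigO G e (\<lambda>p. coeff (P p) i)" "\<And>i. i \<le> k \<Longrightarrow> bigO G (\<lambda>_. 1) (\<lambda>p. coeff (Q p) i)"
  shows "bigO G e (\<lambda>p. coeff (P p * Q p :: complex poly) k)"
  unfolding coeff_mult by (intro bigO_sum bigO_mult_1) (auto intro: assms)

text \<open>Since \<open>k \<ge> 1\<close>, two coefficients of order \<open>k\<close> cannot meet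
  in a coefficient of order \<open>k\<close>. The difference of order \<open>k\<close> therefore
  enters linearly, multiplied by values at the base point, and every other contribution contains a
  difference of lower order, of size \<open>e\<close>. The last three conclusions belong to the same
  induction because the product case consumes them.\<close>

lemma cev_taylor:
  fixes X Y :: "'p \<Rightarrow> 'n::finite \<Rightarrow> complex poly"
  assumes k: "k \<ge> 1" and e1: "bigO G (\<lambda>_. 1) e"
    and X: "\<And>i j. i \<le> k \<Longrightarrow> bigO G (\<lambda>_. 1) (\<lambda>p. coeff (X p j) i)"
    and Dlt: "\<And>i j. i < k \<Longrightarrow> bigO G e (\<lambda>p. coeff (Y p j - X p j) i)"
    and Dk: "\<And>j. bigO G (\<lambda>_. 1) (\<lambda>p. coeff (Y p j - X p j) k)"
  shows "bigO G e (\<lambda>p. coeff (cev (Y p) q - cev (X p) q) k -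
    (\<Sum>j\<in>UNIV. grad q (\<chi> i. coeff (X p i) 0) $ j * coeff (Y p j - X p j) k))"
    and "i \<le> k \<Longrightarrow> bigO G (\<lambda>_. 1) (\<lambda>p. coeff (cev (X p) q) i)"
    and "i < k \<Longrightarrow> bigO G e (\<lambda>p. coeff (cev (Y p) q - cev (X p) q) i)"
    and "bigO G (\<lambda>_. 1) (\<lambda>p. grad q (\<chi> i. coeff (X p i) 0))"
proof -
  let ?x = "\<lambda>p. \<chi> i. coeff (X p i) 0"
  let ?L = "\<lambda>q p. \<Sum>j\<in>UNIV. grad q (?x p) $ j * coeff (Y p j - X p j) k"
  have "(\<forall>i\<le>k. bigO G (\<lambda>_. 1) (\<lambda>p. coeff (cev (X p) q) i)) \<and>
    (\<forall>i<k. bigO G e (\<lambda>p. coeff (cev (Y p) q - cev (X p) q) i)) \<and>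
    bigO G e (\<lambda>p. coeff (cev (Y p) q - cev (X p) q) k - ?L q p) \<and>
    bigO G (\<lambda>_. 1) (\<lambda>p. grad q (?x p))"
  proof (induction q rule: cpoly_induct)
    case (const c)
    then show ?case by simp
  next
    case (var i)
    have "?L (var i) p = coeff (Y p i - X p i) k" for p
      by (simp add: grad_var axis_def if_distrib[of "\<lambda>x. x * _"] cong: if_cong)
    then show ?case using X Dlt by (simp add: grad_var)
  next
    case (add q1 q2)
    have L: "?L (q1 + q2) p = ?L q1 p + ?L q2 p" for p
      by (simp add: grad_add distrib_right sum.distrib)
    have d: "cev (Y p) (q1 + q2) - cev (X p) (q1 + q2) =
      (cev (Y p) q1 - cev (X p) q1) + (cev (Y p) q2 - cev (X p) q2)" for p
      by (simp add: ev_curve.peval_add)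
    have "bigO G e (\<lambda>p. (coeff (cev (Y p) q1 - cev (X p) q1) k - ?L q1 p) +
      (coeff (cev (Y p) q2 - cev (X p) q2) k - ?L q2 p))"
      using add by (intro bigO_add) auto
    then have "bigO G e (\<lambda>p. coeff (cev (Y p) (q1 + q2) - cev (X p) (q1 + q2)) k - ?L (q1 + q2) p)"
      unfolding L d coeff_add by (simp add: algebra_simps)
    moreover have "bigO G (\<lambda>_. 1) (\<lambda>p. grad (q1 + q2) (?x p))"
      unfolding grad_add by (intro bigO_add) (use add in auto)
    moreover have "bigO G e (\<lambda>p. coeff (cev (Y p) (q1 + q2) - cev (X p) (q1 + q2)) i)" if "i < k" for i
      unfolding d coeff_add by (intro bigO_add) (use add that in auto)
    moreover have "bigO G (\<lambda>_. 1) (\<lambda>p. coeff (cev (X p) (q1 + q2)) i)" if "i \<le> k" for i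
      unfolding ev_curve.peval_add coeff_add by (intro bigO_add) (use add that in auto)
    ultimately show ?case by blast
  next
    case (mult q1 q2)
    let ?D1 = "\<lambda>p. cev (Y p) q1 - cev (X p) q1" and ?D2 = "\<lambda>p. cev (Y p) q2 - cev (X p) q2"
    have L: "?L (q1 * q2) p = ?L q1 p * coeff (cev (X p) q2) 0 + coeff (cev (X p) q1) 0 * ?L q2 p" for p
      unfolding coeff_cev_0 sum_distrib_left sum_distrib_right sum.distrib[symmetric]
      by (rule sum.cong) (simp_all add: grad_mult algebra_simps)
    have Lb: "bigO G (\<lambda>_. 1) (\<lambda>p. ?L q p)" if "bigO G (\<lambda>_. 1) (\<lambda>p. grad q (?x p))" for q
      using that Dk by (intro bigO_sum bigO_mult_1) (auto simp: bigO_vec_iff)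
    have D2b: "bigO G (\<lambda>_. 1) (\<lambda>p. coeff (?D2 p) i)" if "i \<le> k" for i
    proof (cases "i = k")
      case True
      have "bigO G (\<lambda>_. 1) (\<lambda>p. (coeff (?D2 p) k - ?L q2 p) + ?L q2 p)"
        by (intro bigO_add Lb) (use mult in \<open>auto intro: bigO_mono[OF _ e1]\<close>)
      then show ?thesis using True by simp
    next
      case False
      then show ?thesis using mult that by (auto intro: bigO_mono[OF _ e1])
    qed
    have D1b: "bigO G (\<lambda>_. 1) (\<lambda>p. coeff (?D1 p) k)"
    proof -
      have "bigO G (\<lambda>_. 1) (\<lambda>p. (coeff (?D1 p) k - ?L q1 p) + ?L q1 p)"
        by (intro bigO_add Lb) (use mult in \<open>auto intro: bigO_mono[OF _ e1]\<close>)
      then show ?thesis by simp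
    qed
    have Y2: "bigO G (\<lambda>_. 1) (\<lambda>p. coeff (cev (Y p) q2) i)" if "i \<le> k" for i
      using bigO_add[OF D2b[OF that], of "\<lambda>p. coeff (cev (X p) q2) i"] mult that by simp
    have d: "cev (Y p) (q1 * q2) - cev (X p) (q1 * q2) = ?D1 p * cev (Y p) q2 + cev (X p) q1 * ?D2 p" for p
      by (simp add: ev_curve.peval_mult algebra_simps)
    have spl: "coeff (A * B) k = coeff A k * coeff B 0 + (\<Sum>i<k. coeff A i * coeff B (k - i))" for A B :: "complex poly"
      by (simp add: coeff_mult lessThan_Suc_atMost[symmetric])
    \<comment> \<open>Replacing the constant coefficient along \<open>Y\<close> by the one along
      \<open>X\<close> costs a multiple of a difference of order zero, which is of size
      \<open>e\<close> because \<open>0 < k\<close>.\<close>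
    have 1: "bigO G e (\<lambda>p. coeff (?D1 p * cev (Y p) q2) k - ?L q1 p * coeff (cev (X p) q2) 0)"
    proof -
      have "coeff (?D1 p * cev (Y p) q2) k - ?L q1 p * coeff (cev (X p) q2) 0 =
        (coeff (?D1 p) k - ?L q1 p) * coeff (cev (X p) q2) 0 + coeff (?D1 p) k * coeff (?D2 p) 0 +
        (\<Sum>i<k. coeff (?D1 p) i * coeff (cev (Y p) q2) (k - i))" for p
        unfolding spl by (simp add: algebra_simps)
      moreover have "bigO G e (\<lambda>p. (coeff (?D1 p) k - ?L q1 p) * coeff (cev (X p) q2) 0 + coeff (?D1 p) k * coeff (?D2 p) 0 +
        (\<Sum>i<k. coeff (?D1 p) i * coeff (cev (Y p) q2) (k - i)))"
        by (intro bigO_add bigO_sum bigO_mult_1(1) bigO_mult_1(2)[OF D1b]) (use mult k Y2 in auto)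
      ultimately show ?thesis by simp
    qed
    have 2: "bigO G e (\<lambda>p. coeff (cev (X p) q1 * ?D2 p) k - coeff (cev (X p) q1) 0 * ?L q2 p)"
    proof -
      have "coeff (cev (X p) q1 * ?D2 p) k - coeff (cev (X p) q1) 0 * ?L q2 p =
        (coeff (?D2 p) k - ?L q2 p) * coeff (cev (X p) q1) 0 +
        (\<Sum>i<k. coeff (?D2 p) i * coeff (cev (X p) q1) (k - i))" for p
        unfolding mult.commute[of "cev (X p) q1"] spl by (simp add: algebra_simps)
      moreover have "bigO G e (\<lambda>p. (coeff (?D2 p) k - ?L q2 p) * coeff (cev (X p) q1) 0 +
        (\<Sum>i<k. coeff (?D2 p) i * coeff (cev (X p) q1) (k - i)))"
        by (intro bigO_add bigO_sum bigO_mult_1(1)) (use mult k in auto)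
      ultimately show ?thesis by simp
    qed
    have "bigO G e (\<lambda>p. coeff (cev (Y p) (q1 * q2) - cev (X p) (q1 * q2)) k - ?L (q1 * q2) p)"
      using bigO_add[OF 1 2] unfolding L d coeff_add by (simp add: algebra_simps)
    moreover have "bigO G (\<lambda>_. 1) (\<lambda>p. grad (q1 * q2) (?x p))"
      unfolding bigO_vec_iff grad_mult vector_add_component vector_smult_component coeff_cev_0[symmetric]
      by (intro allI bigO_add bigO_mult_1) (use mult in \<open>auto simp: bigO_vec_iff\<close>)
    moreover have "bigO G e (\<lambda>p. coeff (cev (Y p) (q1 * q2) - cev (X p) (q1 * q2)) i)" if "i < k" for i
    proof -
      have "bigO G e (\<lambda>p. coeff (?D1 p * cev (Y p) q2) i)"
        by (rule bigO_coeff_mult) (use mult Y2 that in auto)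
      moreover have "bigO G e (\<lambda>p. coeff (?D2 p * cev (X p) q1) i)"
        by (rule bigO_coeff_mult) (use mult that in auto)
      ultimately show ?thesis
        unfolding d coeff_add mult.commute[of "cev (X p) q1" for p] by (rule bigO_add)
    qed
    moreover have "bigO G (\<lambda>_. 1) (\<lambda>p. coeff (cev (X p) (q1 * q2)) i)" if "i \<le> k" for i
      unfolding ev_curve.peval_mult by (rule bigO_coeff_mult) (use mult that in auto)
    ultimately show ?case by blast
  qed
  then show "bigO G e (\<lambda>p. coeff (cev (Y p) q - cev (X p) q) k -
    (\<Sum>j\<in>UNIV. grad q (\<chi> i. coeff (X p i) 0) $ j * coeff (Y p j - X p j) k))"
    and "i \<le> k \<Longrightarrow> bigO G (\<lambda>_. 1) (\<lambda>p. coeff (cev (X p) q) i)"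
    and "i < k \<Longrightarrow> bigO G e (\<lambda>p. coeff (cev (Y p) q - cev (X p) q) i)"
    and "bigO G (\<lambda>_. 1) (\<lambda>p. grad q (\<chi> i. coeff (X p i) 0))" by blast+
qed

text \<open>At a single point and with scale zero an estimate is an equation, so the asymptotic
  expansion specialises to an exact one for fixed curves.\<close>

lemma bigO_exact_iff: "bigO (principal {p0}) (\<lambda>_. 0) u \<longleftrightarrow> u p0 = 0"
  by (auto simp: bigO_def eventually_principal)

lemma bigO_exact_1: "bigO (principal {p0}) (\<lambda>_. 1) u"
  by (rule bigOI[where C = "norm (u p0)"]) (simp add: eventually_principal)

lemma cev_taylor_exact:
  assumes k: "k \<ge> 1" and D: "\<And>i j. i < k \<Longrightarrow> coeff (Y j) i = coeff (X j) i"
  shows "coeff (cev Y q) k = coeff (cev X q) k +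
    (\<Sum>j\<in>UNIV. grad q (\<chi> i. coeff (X i) 0) $ j * (coeff (Y j) k - coeff (X j) k))"
    and "i < k \<Longrightarrow> coeff (cev Y q) i = coeff (cev X q) i"
proof -
  note T = cev_taylor[of k "principal {()}" "\<lambda>_. 0" "\<lambda>_. X" "\<lambda>_. Y" for k, unfolded bigO_exact_iff,
    OF k bigO_exact_1 bigO_exact_1 _ bigO_exact_1]
  show "coeff (cev Y q) k = coeff (cev X q) k +
    (\<Sum>j\<in>UNIV. grad q (\<chi> i. coeff (X i) 0) $ j * (coeff (Y j) k - coeff (X j) k))"
    using T(1)[of q] D by (simp add: diff_eq_eq add.commute)
  show "coeff (cev Y q) i = coeff (cev X q) i" if "i < k"
    using T(3)[of i q] D that by simp
qed

section \<open>Multiplicity as order of contact\<close>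

lemma module_mult: "module ((*) :: 'a::comm_ring_1 \<Rightarrow> 'a \<Rightarrow> 'a)"
  by unfold_locales (auto simp: algebra_simps)

lemma is_ideal_iff:
  "is_ideal I \<longleftrightarrow> 0 \<in> I \<and> (\<forall>x\<in>I. \<forall>y\<in>I. x + y \<in> I) \<and> (\<forall>c. \<forall>x\<in>I. c * x \<in> I)"
  unfolding is_ideal_def module.subspace_def[OF module_mult] by auto

lemma
  assumes "is_ideal I"
  shows ideal_0: "0 \<in> I"
    and ideal_add: "x \<in> I \<Longrightarrow> y \<in> I \<Longrightarrow> x + y \<in> I"
    and ideal_mult: "x \<in> I \<Longrightarrow> c * x \<in> I"
    and ideal_mult_right: "x \<in> I \<Longrightarrow> x * c \<in> I"
    and ideal_uminus: "x \<in> I \<Longrightarrow> - x \<in> I"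
    and ideal_diff: "x \<in> I \<Longrightarrow> y \<in> I \<Longrightarrow> x - y \<in> I"
    and ideal_sum: "(\<And>i. i \<in> A \<Longrightarrow> f i \<in> I) \<Longrightarrow> sum f A \<in> I"
proof -
  have *: "0 \<in> I" "\<And>x y. x \<in> I \<Longrightarrow> y \<in> I \<Longrightarrow> x + y \<in> I" "\<And>c x. x \<in> I \<Longrightarrow> c * x \<in> I"
    using assms by (auto simp: is_ideal_iff)
  show "0 \<in> I" by fact
  show "x \<in> I \<Longrightarrow> y \<in> I \<Longrightarrow> x + y \<in> I" by fact
  show "x \<in> I \<Longrightarrow> c * x \<in> I" by fact
  then show "x \<in> I \<Longrightarrow> x * c \<in> I" by (simp add: mult.commute)
  show m: "- x \<in> I" if "x \<in> I" for x using *(3)[of x "-1"] that by simp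
  show "x \<in> I \<Longrightarrow> y \<in> I \<Longrightarrow> x - y \<in> I" using *(2)[of x "- y"] m[of y] by simp
  show "(\<And>i. i \<in> A \<Longrightarrow> f i \<in> I) \<Longrightarrow> sum f A \<in> I"
    by (induction A rule: infinite_finite_induct) (auto simp: *)
qed

lemma ideal_generated_base: "S \<subseteq> ideal_generated S"
  unfolding ideal_generated_def by (rule module.span_superset[OF module_mult])

lemma ideal_generated_minimal: "is_ideal J \<Longrightarrow> S \<subseteq> J \<Longrightarrow> ideal_generated S \<subseteq> J"
  unfolding ideal_generated_def is_ideal_def by (rule module.span_minimal[OF module_mult])

text \<open>Each component other than \<open>Q\<close> contains an element outside the prime
  \<open>P\<close>: otherwise its radical would lie in \<open>P\<close>, hence equal
  \<open>P\<close> by minimality, against the distinctness of the radicals. The product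
  \<open>g\<close> of such elements avoids \<open>P\<close> and multiplies \<open>Q\<close> into
  every component. Thus \<open>I\<close> and \<open>Q\<close> agree after localisation at
  \<open>P\<close>.\<close>

lemma isolated_primary_componentE:
  fixes I P Q :: "'a::comm_ring_1 set"
  assumes "isolated_primary_component I P Q"
    and P1: "1 \<notin> P" and Pp: "\<And>a b. a * b \<in> P \<Longrightarrow> a \<in> P \<or> b \<in> P"
  obtains g where "I \<subseteq> Q" "primary_ideal Q" "radical Q = P" "g \<notin> P" "\<And>q. q \<in> Q \<Longrightarrow> g * q \<in> I"
proof -
  obtain \<Q> where d: "minimal_primary_decomposition I \<Q>" and Q: "Q \<in> \<Q>" "radical Q = P"
    and iso: "\<And>Q'. Q' \<in> \<Q> \<Longrightarrow> radical Q' \<subseteq> P \<Longrightarrow> radical Q' = P"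
    using assms(1) by (auto simp: isolated_primary_component_def)
  have fin: "finite \<Q>" and prim: "\<And>Q. Q \<in> \<Q> \<Longrightarrow> primary_ideal Q" and int: "\<Inter>\<Q> = I"
    and inj: "inj_on radical \<Q>"
    using d by (auto simp: minimal_primary_decomposition_def)
  have pw: "a ^ k \<notin> P" if "a \<notin> P" for a k
    using that by (induction k) (auto simp: P1 dest: Pp)
  have "\<exists>g. g \<in> Q' \<and> g \<notin> P" if "Q' \<in> \<Q> - {Q}" for Q'
  proof -
    have "\<not> radical Q' \<subseteq> P"
      using iso[of Q'] Q inj_onD[OF inj, of Q' Q] that by auto
    then obtain a k where "a ^ k \<in> Q'" "a \<notin> P" by (auto simp: radical_def)
    then show ?thesis using pw by blast
  qed
  then obtain g where g: "\<And>Q'. Q' \<in> \<Q> - {Q} \<Longrightarrow> g Q' \<in> Q' \<and> g Q' \<notin> P" by metis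
  have "(\<Prod>Q'\<in>A. g Q') \<notin> P" if "A \<subseteq> \<Q> - {Q}" for A
    using that
  proof (induction A rule: infinite_finite_induct)
    case (insert x A)
    then have "g x \<notin> P" "prod g A \<notin> P" using g[of x] by auto
    then show ?case using Pp insert.hyps by auto
  qed (simp_all add: P1)
  then have "(\<Prod>Q'\<in>\<Q> - {Q}. g Q') \<notin> P" by blast
  moreover have "(\<Prod>Q'\<in>\<Q> - {Q}. g Q') * q \<in> I" if q: "q \<in> Q" for q
  proof -
    have "(\<Prod>Q'\<in>\<Q> - {Q}. g Q') * q \<in> Q'" if Q': "Q' \<in> \<Q>" for Q'
    proof (cases "Q' = Q")
      case True
      then show ?thesis using prim[OF Q(1)] q by (auto simp: primary_ideal_def intro: ideal_mult)
    next
      case False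
      then have "(\<Prod>Q'\<in>\<Q> - {Q}. g Q') = (\<Prod>Q'\<in>\<Q> - {Q} - {Q'}. g Q') * g Q'"
        using prod.remove[of "\<Q> - {Q}" Q' g] fin Q' by (simp add: mult.commute)
      moreover have "g Q' \<in> Q'" using g False Q' by blast
      moreover have "is_ideal Q'" using prim[OF Q'] by (simp add: primary_ideal_def)
      ultimately show ?thesis by (simp add: ideal_mult ideal_mult_right)
    qed
    then show ?thesis using int by blast
  qed
  ultimately show ?thesis
    using that[of "\<Prod>Q'\<in>\<Q> - {Q}. g Q'"] Q prim[OF Q(1)] int by blast
qed

interpretation cpoly: vector_space "\<lambda>c p. const_poly c * p"
  by unfold_locales (simp_all add: const_poly_add const_poly_mult algebra_simps)

text \<open>A dimension comparison in the quotient by \<open>Q\<close>, made without forming it: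
  each \<open>f i\<close> is replaced by a combination of the \<open>g j\<close> congruent to it,
  and these combinations are independent in the polynomial ring itself.\<close>

lemma card_le_mod_subspace:
  fixes f :: "'i \<Rightarrow> 'n::finite cpoly" and g :: "'j \<Rightarrow> 'n cpoly"
  assumes Q: "is_ideal Q" and I: "finite I" and J: "finite J"
    and ind: "\<And>c i. (\<Sum>i\<in>I. const_poly (c i) * f i) \<in> Q \<Longrightarrow> i \<in> I \<Longrightarrow> c i = 0"
    and sp: "\<And>i. i \<in> I \<Longrightarrow> \<exists>d. f i - (\<Sum>j\<in>J. const_poly (d j) * g j) \<in> Q"
  shows "card I \<le> card J"
proof -
  obtain d where d: "\<And>i. i \<in> I \<Longrightarrow> f i - (\<Sum>j\<in>J. const_poly (d i j) * g j) \<in> Q"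
    using sp by metis
  define s where "s i = (\<Sum>j\<in>J. const_poly (d i j) * g j)" for i
  have zero: "c i = 0" if "(\<Sum>i\<in>I. const_poly (c i) * s i) = 0" "i \<in> I" for c i
  proof (rule ind[OF _ that(2)])
    have "(\<Sum>i\<in>I. const_poly (c i) * (f i - s i)) \<in> Q"
      by (intro ideal_sum[OF Q] ideal_mult[OF Q]) (use d in \<open>auto simp: s_def\<close>)
    then show "(\<Sum>i\<in>I. const_poly (c i) * f i) \<in> Q"
      using that(1) by (simp add: right_diff_distrib sum_subtractf)
  qed
  have inj: "inj_on s I"
  proof (rule inj_onI, rule ccontr)
    fix a b assume ab: "a \<in> I" "b \<in> I" "s a = s b" "a \<noteq> b"
    let ?c = "\<lambda>i. if i = a then 1 else if i = b then - 1 else (0::complex)"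
    have "(\<Sum>i\<in>I. const_poly (?c i) * s i) = (\<Sum>i\<in>{a, b}. const_poly (?c i) * s i)"
      by (rule sum.mono_neutral_right) (use I ab in auto)
    also have "\<dots> = (const_poly 1 + const_poly (- 1)) * s b"
      using ab by (simp add: distrib_right)
    also have "\<dots> = 0" by (simp only: const_poly_add[symmetric]) simp
    finally show False using zero[of ?c a] ab by simp
  qed
  have "cpoly.independent (s ` I)"
  proof (subst cpoly.dependent_finite)
    show "finite (s ` I)" using I by simp
    show "\<not> (\<exists>u. (\<exists>v\<in>s ` I. u v \<noteq> 0) \<and> (\<Sum>v\<in>s ` I. const_poly (u v) * v) = 0)"
    proof
      assume "\<exists>u. (\<exists>v\<in>s ` I. u v \<noteq> 0) \<and> (\<Sum>v\<in>s ` I. const_poly (u v) * v) = 0"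
      then obtain u i where "i \<in> I" "u (s i) \<noteq> 0" "(\<Sum>v\<in>s ` I. const_poly (u v) * v) = 0"
        by auto
      then show False using zero[of "\<lambda>i. u (s i)" i] by (simp add: sum.reindex[OF inj])
    qed
  qed
  moreover have "s i \<in> cpoly.span (g ` J)" for i
    unfolding s_def by (intro cpoly.span_sum cpoly.span_scale cpoly.span_base imageI)
  then have "s ` I \<subseteq> cpoly.span (g ` J)" by blast
  ultimately have "card (s ` I) \<le> card (g ` J)"
    using cpoly.independent_span_bound[of "g ` J" "s ` I"] J by blast
  then show ?thesis using card_image[OF inj] card_image_le[OF J, of g] by simp
qed

text \<open>A substitute for Nakayama's lemma: the unknowns are eliminated one at a time, dividing by
  \<open>1 - a\<close> with \<open>a \<in> M\<close>, which is a unit modulo \<open>Q\<close>.\<close>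

lemma ideal_elimination:
  fixes Q M :: "'a::comm_ring_1 set"
  assumes Q: "is_ideal Q" and M: "is_ideal M"
    and unit: "\<And>a. a \<in> M \<Longrightarrow> \<exists>u. u * (1 - a) - 1 \<in> Q"
    and S: "finite S"
    and eq: "\<And>j. j \<in> S \<Longrightarrow> \<exists>m. (\<forall>l\<in>S. m l \<in> M) \<and> \<zeta> j - (\<Sum>l\<in>S. m l * \<zeta> l) \<in> Q"
  shows "j \<in> S \<Longrightarrow> \<zeta> j \<in> Q"
  using S eq
proof (induction S arbitrary: j rule: finite_induct)
  case (insert x S)
  obtain m where m: "\<And>l. l \<in> insert x S \<Longrightarrow> m l \<in> M"
    and mx: "\<zeta> x - (m x * \<zeta> x + (\<Sum>l\<in>S. m l * \<zeta> l)) \<in> Q"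
    using insert.prems(2)[of x] insert.hyps by auto
  obtain u where u: "u * (1 - m x) - 1 \<in> Q" using unit m by blast
  have x: "\<zeta> x - (\<Sum>l\<in>S. u * m l * \<zeta> l) \<in> Q"
  proof -
    have "\<zeta> x - (\<Sum>l\<in>S. u * m l * \<zeta> l) =
      u * (\<zeta> x - (m x * \<zeta> x + (\<Sum>l\<in>S. m l * \<zeta> l))) - \<zeta> x * (u * (1 - m x) - 1)"
      by (simp add: sum_distrib_left algebra_simps)
    then show ?thesis using ideal_diff[OF Q ideal_mult[OF Q mx] ideal_mult[OF Q u]] by simp
  qed
  have S: "\<zeta> l \<in> Q" if "l \<in> S" for l
  proof (rule insert.IH[OF that])
    fix j assume j: "j \<in> S"
    obtain n where n: "\<And>l. l \<in> insert x S \<Longrightarrow> n l \<in> M"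
      and nj: "\<zeta> j - (n x * \<zeta> x + (\<Sum>l\<in>S. n l * \<zeta> l)) \<in> Q"
      using insert.prems(2)[of j] insert.hyps j by auto
    have "(\<Sum>l\<in>S. (n l + n x * u * m l) * \<zeta> l) = (\<Sum>l\<in>S. n l * \<zeta> l) + n x * (\<Sum>l\<in>S. u * m l * \<zeta> l)"
      by (simp add: distrib_right sum.distrib sum_distrib_left mult.assoc)
    then have eq: "\<zeta> j - (\<Sum>l\<in>S. (n l + n x * u * m l) * \<zeta> l) =
      (\<zeta> j - (n x * \<zeta> x + (\<Sum>l\<in>S. n l * \<zeta> l))) + n x * (\<zeta> x - (\<Sum>l\<in>S. u * m l * \<zeta> l))"
      by (simp only:) (simp add: algebra_simps)
    have "\<zeta> j - (\<Sum>l\<in>S. (n l + n x * u * m l) * \<zeta> l) \<in> Q"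
      unfolding eq by (rule ideal_add[OF Q nj ideal_mult[OF Q x]])
    moreover have "n l + n x * u * m l \<in> M" if "l \<in> S" for l
      using n m that by (intro ideal_add[OF M] ideal_mult[OF M]) auto
    ultimately show "\<exists>m. (\<forall>l\<in>S. m l \<in> M) \<and> \<zeta> j - (\<Sum>l\<in>S. m l * \<zeta> l) \<in> Q"
      by (intro exI[of _ "\<lambda>l. n l + n x * u * m l"] conjI ballI)
  qed
  have "(\<Sum>l\<in>S. u * m l * \<zeta> l) \<in> Q" by (rule ideal_sum[OF Q], rule ideal_mult[OF Q S])
  from ideal_add[OF Q x this] have "\<zeta> x \<in> Q" by simp
  then show ?case using insert.prems(1) S by blast
qed simp

lemma maximal_ideal_at_ideal: "is_ideal (maximal_ideal_at x)"
  by (auto simp: is_ideal_iff maximal_ideal_at_def poly_eval_simps)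

lemma multiplicityE:
  fixes F :: "'n::finite \<Rightarrow> 'n cpoly"
  assumes "has_multiplicity F x \<mu>"
  obtains Q g B where "is_ideal Q" "range F \<subseteq> Q" "radical Q = maximal_ideal_at x"
    "poly_eval g x \<noteq> 0" "\<And>q. q \<in> Q \<Longrightarrow> g * q \<in> ideal_generated (range F)"
    "finite B" "card B = \<mu>"
    "\<And>p. \<exists>c. p - (\<Sum>b\<in>B. const_poly (c b) * b) \<in> Q"
    "\<And>c b. (\<Sum>b\<in>B. const_poly (c b) * b) \<in> Q \<Longrightarrow> b \<in> B \<Longrightarrow> c b = 0"
proof -
  obtain Q where Q: "isolated_primary_component (ideal_generated (range F)) (maximal_ideal_at x) Q"
    "quotient_has_dim Q \<mu>"
    using assms by (auto simp: has_multiplicity_def)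
  obtain B where B: "quotient_basis Q B" "card B = \<mu>"
    using Q(2) by (auto simp: quotient_has_dim_def)
  have fin: "finite B" and ex1: "\<And>p. \<exists>!c. (\<forall>b. b \<notin> B \<longrightarrow> c b = 0) \<and> p - (\<Sum>b\<in>B. const_poly (c b) * b) \<in> Q"
    using B(1) by (auto simp: quotient_basis_def)
  obtain g where g: "ideal_generated (range F) \<subseteq> Q" "primary_ideal Q" "radical Q = maximal_ideal_at x"
     "g \<notin> maximal_ideal_at x" "\<And>q. q \<in> Q \<Longrightarrow> g * q \<in> ideal_generated (range F)"
    by (rule isolated_primary_componentE[OF Q(1)]) (auto simp: maximal_ideal_at_def poly_eval_simps)
  have id: "is_ideal Q" using g(2) by (simp add: primary_ideal_def)
  have un: "c b = 0" if c: "(\<Sum>b\<in>B. const_poly (c b) * b) \<in> Q" and "b \<in> B" for c b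
  proof -
    \<comment> \<open>Coefficients are unique only among functions that vanish outside
      \<open>B\<close>, so \<open>c\<close> is cut off there before the comparison with
      zero.\<close>
    let ?c = "\<lambda>b. if b \<in> B then c b else 0"
    have "(\<Sum>b\<in>B. const_poly (?c b) * b) = (\<Sum>b\<in>B. const_poly (c b) * b)"
      by (rule sum.cong) auto
    then have c1: "(\<forall>b. b \<notin> B \<longrightarrow> ?c b = 0) \<and> 0 - (\<Sum>b\<in>B. const_poly (?c b) * b) \<in> Q"
      using ideal_uminus[OF id c] by simp
    have c2: "(\<forall>b. b \<notin> B \<longrightarrow> (\<lambda>_. 0) b = (0::complex)) \<and> 0 - (\<Sum>b\<in>B. const_poly ((\<lambda>_. 0) b) * b) \<in> Q"
      using ideal_0[OF id] by simp
    obtain c0 where c0: "\<And>c. (\<forall>b. b \<notin> B \<longrightarrow> c b = 0) \<and> 0 - (\<Sum>b\<in>B. const_poly (c b) * b) \<in> Q \<Longrightarrow> c = c0"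
      by (rule ex1E[OF ex1[of 0]]) (rule that, simp)
    have "?c b = 0" using fun_cong[OF trans[OF c0[OF c1] c0[OF c2, symmetric]], of b] .
    then show ?thesis using \<open>b \<in> B\<close> by simp
  qed
  show ?thesis
  proof (rule that)
    show "range F \<subseteq> Q" using g(1) ideal_generated_base[of "range F"] by simp
    show "poly_eval g x \<noteq> 0" using g(4) by (simp add: maximal_ideal_at_def)
    show "\<exists>c. p - (\<Sum>b\<in>B. const_poly (c b) * b) \<in> Q" for p
      using ex1_implies_ex[OF ex1[of p]] by (elim exE conjE) (rule exI)
  qed (fact id g(3) g(5) fin B(2) un)+
qed

text \<open>Taking the coordinate \<open>i\<^sub>0\<close> as parameter fixes the parametrisation:
  powers of the centred coordinate restrict to powers of the parameter, and the curve equation for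
  \<open>i\<^sub>0\<close> becomes trivial. The number \<open>k\<close> is only a lower bound for
  the order of contact.\<close>

definition contact_curve ::
    "('n::finite \<Rightarrow> 'n cpoly) \<Rightarrow> 'n cvec \<Rightarrow> 'n \<Rightarrow> nat \<Rightarrow> ('n \<Rightarrow> complex poly) \<Rightarrow> bool" where
  "contact_curve F x i\<^sub>0 k X \<longleftrightarrow> (\<forall>j. coeff (X j) 0 = x $ j) \<and> X i\<^sub>0 = [:x $ i\<^sub>0, 1:] \<and>
     (\<forall>i. \<forall>l<k. coeff (cev X (F i)) l = 0)"

lemma X_power_dvd_iff: "monom 1 k dvd (p :: complex poly) \<longleftrightarrow> (\<forall>l<k. coeff p l = 0)"
  by (rule monom_1_dvd_iff')

text \<open>A polynomial with nonzero constant term is a unit among power series; the cancellation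
  is carried out coefficient by coefficient.\<close>

lemma X_power_dvd_cancel:
  fixes a b :: "complex poly"
  assumes a: "coeff a 0 \<noteq> 0" and ab: "monom 1 k dvd a * b"
  shows "monom 1 k dvd b"
proof -
  have "l < k \<longrightarrow> coeff b l = 0" for l
  proof (induction l rule: less_induct)
    case (less l)
    show ?case
    proof
      assume l: "l < k"
      have "coeff (a * b) l = (\<Sum>i\<le>l. if i = 0 then coeff a 0 * coeff b l else 0)"
        unfolding coeff_mult by (rule sum.cong) (use less l in auto)
      then show "coeff b l = 0" using ab a l by (simp add: X_power_dvd_iff)
    qed
  qed
  then show ?thesis by (simp add: X_power_dvd_iff)
qed

text \<open>The polynomials vanishing to order \<open>k\<close> along the curve form an ideal that
  contains the system. It contains \<open>Q\<close> too, because \<open>g\<close> has a nonzero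
  constant term along the curve and cancels. The powers of the centred coordinate below the
  \<open>k\<close>-th restrict to distinct monomials of degree below \<open>k\<close>, so they are
  independent modulo \<open>Q\<close>.\<close>

lemma contact_order_le_multiplicity:
  fixes F :: "'n::finite \<Rightarrow> 'n cpoly"
  assumes m: "has_multiplicity F x \<mu>" and X: "contact_curve F x i\<^sub>0 k X"
  shows "k \<le> \<mu>"
proof -
  obtain Q g B where Q: "is_ideal Q" "poly_eval g x \<noteq> 0"
    "\<And>q. q \<in> Q \<Longrightarrow> g * q \<in> ideal_generated (range F)"
    "finite B" "card B = \<mu>"
    and sp: "\<And>p. \<exists>c. p - (\<Sum>b\<in>B. const_poly (c b) * b) \<in> Q"
    by (rule multiplicityE[OF m]) (rule that)
  have X0: "(\<chi> i. coeff (X i) 0) = x" and X1: "X i\<^sub>0 = [:x $ i\<^sub>0, 1:]"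
    and XF: "\<And>i l. l < k \<Longrightarrow> coeff (cev X (F i)) l = 0"
    using X by (auto simp: contact_curve_def vec_eq_iff)
  define J where "J = {q. monom 1 k dvd cev X q}"
  have "is_ideal J"
    by (auto simp: is_ideal_iff J_def ev_curve.peval_add ev_curve.peval_mult)
  moreover have "range F \<subseteq> J" using XF by (auto simp: J_def X_power_dvd_iff)
  ultimately have IJ: "ideal_generated (range F) \<subseteq> J" by (rule ideal_generated_minimal)
  have g0: "coeff (cev X g) 0 \<noteq> 0" using Q(2) by (simp add: coeff_cev_0 X0)
  have QJ: "Q \<subseteq> J"
  proof
    fix q assume "q \<in> Q"
    then have "g * q \<in> J" using Q(3) IJ by blast
    then have "monom 1 k dvd cev X g * cev X q" by (simp add: J_def ev_curve.peval_mult)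
    then show "q \<in> J" unfolding J_def mem_Collect_eq by (rule X_power_dvd_cancel[OF g0])
  qed
  let ?l = "var i\<^sub>0 - const_poly (x $ i\<^sub>0) :: 'n cpoly"
  have "cev X ?l = [:0, 1:]" by (simp add: ev_curve.peval_diff X1)
  then have l: "cev X (?l ^ j) = monom 1 j" for j
    by (simp only: ev_curve.peval_power) (simp add: monom_altdef)
  have "card {..<k} \<le> card B"
  proof (rule card_le_mod_subspace[OF Q(1) _ Q(4), of "{..<k}" "\<lambda>j. ?l ^ j" "\<lambda>b. b"])
    show "\<exists>d. ?l ^ i - (\<Sum>b\<in>B. const_poly (d b) * b) \<in> Q" for i by (rule sp)
    fix c i assume "(\<Sum>j<k. const_poly (c j) * ?l ^ j) \<in> Q" and i: "i \<in> {..<k}"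
    then have "monom 1 k dvd (\<Sum>j<k. [:c j:] * monom 1 j)"
      using QJ by (auto simp: J_def ev_curve.peval_sum ev_curve.peval_mult l)
    then have "coeff (\<Sum>j<k. [:c j:] * monom 1 j) i = 0"
      using i unfolding X_power_dvd_iff by simp
    moreover have "coeff (\<Sum>j<k. [:c j:] * monom 1 j) i = (\<Sum>j<k. if j = i then c j else 0)"
      unfolding coeff_sum by (rule sum.cong) (auto simp: smult_monom)
    ultimately show "c i = 0" using i by simp
  qed simp
  then show ?thesis using Q(5) by simp
qed

text \<open>Some power of \<open>a\<close> lies in \<open>Q\<close>, so a truncated geometric series
  inverts \<open>1 - a\<close> modulo \<open>Q\<close>.\<close>

lemma maximal_ideal_unit:
  assumes Q: "is_ideal Q" and rad: "radical Q = maximal_ideal_at x" and a: "a \<in> maximal_ideal_at x"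
  shows "\<exists>u. u * (1 - a) - 1 \<in> Q"
proof -
  obtain k where k: "a ^ k \<in> Q" using a rad by (auto simp: radical_def)
  have "(\<Sum>i<k. a ^ i) * (1 - a) - 1 = - (a ^ k)"
    using power_diff_1_eq[of a k] by (simp add: algebra_simps)
  then show ?thesis using ideal_uminus[OF Q k] by metis
qed

text \<open>Hadamard's lemma relative to the substitution \<open>Y\<close>.\<close>

lemma substitution_expansion:
  fixes Y :: "'n::finite \<Rightarrow> 'n cpoly"
  assumes Y: "\<And>j. poly_eval (Y j) x = x $ j"
  shows "\<exists>a. (\<forall>j. poly_eval (a j) x = grad p x $ j) \<and>
    p - peval const_poly Y p = (\<Sum>j\<in>UNIV. a j * (var j - Y j))"
proof (induction p rule: cpoly_induct)
  case (const c)
  show ?case by (rule exI[of _ "\<lambda>_. 0"]) (simp add: poly_eval_simps)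
next
  case (var i)
  have "(\<Sum>j\<in>UNIV. (if j = i then 1 else 0) * (var j - Y j)) = var i - Y i"
    by (simp add: if_distrib[of "\<lambda>x. x * _"] cong: if_cong)
  then show ?case
    by (intro exI[of _ "\<lambda>j. if j = i then 1 else 0"]) (auto simp: grad_var axis_def poly_eval_simps)
next
  case (add p q)
  then obtain a b where "\<forall>j. poly_eval (a j) x = grad p x $ j" "\<forall>j. poly_eval (b j) x = grad q x $ j"
    "p - peval const_poly Y p = (\<Sum>j\<in>UNIV. a j * (var j - Y j))"
    "q - peval const_poly Y q = (\<Sum>j\<in>UNIV. b j * (var j - Y j))" by blast
  note ab = this
  have "p + q - peval const_poly Y (p + q) = (\<Sum>j\<in>UNIV. (a j + b j) * (var j - Y j))"
    unfolding distrib_right sum.distrib ab(3,4)[symmetric] by (simp add: ev_const.peval_add)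
  then show ?case
    by (intro exI[of _ "\<lambda>j. a j + b j"]) (simp add: poly_eval_simps grad_add ab(1,2))
next
  case (mult p q)
  then obtain a b where "\<forall>j. poly_eval (a j) x = grad p x $ j" "\<forall>j. poly_eval (b j) x = grad q x $ j"
    "p - peval const_poly Y p = (\<Sum>j\<in>UNIV. a j * (var j - Y j))"
    "q - peval const_poly Y q = (\<Sum>j\<in>UNIV. b j * (var j - Y j))" by blast
  note ab = this
  have "poly_eval (peval const_poly Y p) x = poly_eval p x"
    unfolding poly_eval_peval peval_peval_const[OF ev_id.coeff_hom_axioms]
    by (simp add: poly_eval_peval[symmetric] Y)
  moreover have "p * q - peval const_poly Y (p * q) =
    (\<Sum>j\<in>UNIV. (q * a j + peval const_poly Y p * b j) * (var j - Y j))"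
  proof -
    have "p * q - peval const_poly Y (p * q) = q * (p - peval const_poly Y p) +
      peval const_poly Y p * (q - peval const_poly Y q)"
      by (simp add: ev_const.peval_mult algebra_simps)
    then show ?thesis
      unfolding ab(3,4) by (simp add: distrib_right sum.distrib sum_distrib_left mult.assoc)
  qed
  ultimately show ?case
    by (intro exI[of _ "\<lambda>j. q * a j + peval const_poly Y p * b j"]) (simp add: poly_eval_simps grad_mult ab(1,2))
qed

text \<open>Substitution of \<open>l\<close> for the parameter. With \<open>l\<close> the centred
  coordinate, it turns a curve into polynomials in a single variable that can be substituted for all
  variables.\<close>

definition lift_poly :: "complex poly \<Rightarrow> 'n::finite cpoly \<Rightarrow> 'n cpoly" where
  "lift_poly p l = (\<Sum>i\<le>degree p. const_poly (coeff p i) * l ^ i)"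

lemma lift_poly_superset:
  "degree p \<le> N \<Longrightarrow> lift_poly p l = (\<Sum>i\<le>N. const_poly (coeff p i) * l ^ i)"
  unfolding lift_poly_def
  by (rule sum.mono_neutral_left) (auto simp: coeff_eq_0)

lemma lift_poly_const: "lift_poly [:c:] l = const_poly c"
  by (simp add: lift_poly_def)

lemma lift_poly_add: "lift_poly (p + q) l = lift_poly p l + lift_poly q l"
proof -
  let ?N = "max (degree p) (degree q)"
  have "degree (p + q) \<le> ?N" by (rule degree_add_le_max)
  then show ?thesis
    by (simp add: lift_poly_superset[of _ ?N] const_poly_add distrib_right sum.distrib)
qed

lemma lift_poly_pCons: "lift_poly (pCons a p) l = const_poly a + l * lift_poly p l"
proof -
  have "lift_poly (pCons a p) l = (\<Sum>i\<le>Suc (degree p). const_poly (coeff (pCons a p) i) * l ^ i)"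
    by (rule lift_poly_superset) (rule degree_pCons_le)
  also have "\<dots> = const_poly a + l * lift_poly p l"
    unfolding sum.atMost_Suc_shift by (simp add: lift_poly_def sum_distrib_left mult_ac)
  finally show ?thesis .
qed

lemma lift_poly_smult: "lift_poly (smult a p) l = const_poly a * lift_poly p l"
  unfolding lift_poly_superset[OF degree_smult_le, of a p l]
  by (simp add: lift_poly_def sum_distrib_left)

lemma lift_poly_mult: "lift_poly (p * q) l = lift_poly p l * lift_poly q l"
proof (induction p)
  case 0
  then show ?case by (simp add: lift_poly_def)
next
  case (pCons a p)
  have "lift_poly (pCons a p * q) l = lift_poly (smult a q) l + lift_poly (pCons 0 (p * q)) l"
    by (simp add: lift_poly_add)
  then show ?case
    by (simp add: lift_poly_smult lift_poly_pCons pCons algebra_simps)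
qed

lemma peval_lift_poly: "peval const_poly (\<lambda>j. lift_poly (X j) l) p = lift_poly (cev X p) l"
  by (rule peval_hom_comp[symmetric])
    (auto simp: lift_poly_add lift_poly_mult lift_poly_const ev_const.coeff_hom_axioms ev_curve.coeff_hom_axioms)

lemma lift_poly_linear: "lift_poly [:c, 1:] l = const_poly c + l"
proof -
  have "lift_poly [:c, 1:] l = const_poly c + l * lift_poly [:1:] l" by (rule lift_poly_pCons)
  then show ?thesis unfolding lift_poly_const by simp
qed

lemma poly_eval_lift_poly: "poly_eval (lift_poly p l) x = poly p (poly_eval l x)"
  by (simp add: lift_poly_def poly_eval_simps poly_altdef)

lemma lift_poly_split:
  assumes "\<forall>i<k. coeff p i = 0"
  obtains q where "lift_poly p l = l ^ k * q" "poly_eval l x = 0 \<Longrightarrow> poly_eval q x = coeff p k"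
proof -
  obtain r where r: "p = monom 1 k * r"
    using assms X_power_dvd_iff[of k p] by (auto elim: dvdE)
  have 1: "lift_poly (monom 1 k) l = l ^ k"
    by (simp add: lift_poly_def degree_monom_eq if_distrib[of const_poly] if_distrib[of "\<lambda>x. x * _"]
       cong: if_cong)
  have "lift_poly p l = l ^ k * lift_poly r l" unfolding r lift_poly_mult 1 ..
  moreover have "poly_eval (lift_poly r l) x = coeff p k" if "poly_eval l x = 0"
    unfolding r by (simp add: poly_eval_lift_poly that poly_0_coeff_0 coeff_monom_mult)
  ultimately show ?thesis by (rule that)
qed

text \<open>The system and \<open>M\<close> express \<open>l ^ k\<close> and every \<open>x\<^sub>j - X\<^sub>j(l)\<close>, where \<open>l\<close> is the \<open>i\<^sub>0\<close>-th coordinate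
  centred at \<open>x\<close>, as combinations of themselves with coefficients in the maximal ideal, modulo \<open>Q\<close>.
  By elimination they lie in \<open>Q\<close>, so the powers of \<open>l\<close> below the \<open>k\<close>-th span the quotient.\<close>

lemma multiplicity_le_contact_order:
  fixes F :: "'n::finite \<Rightarrow> 'n cpoly"
  assumes m: "has_multiplicity F x \<mu>" and X: "contact_curve F x i\<^sub>0 k X"
    and M: "N ** (\<chi> i j. if j = i\<^sub>0 then coeff (cev X (F i)) k else jac F x $ i $ j) = mat 1"
  shows "\<mu> \<le> k"
proof -
  obtain Q g B where Q: "is_ideal Q" "range F \<subseteq> Q" "radical Q = maximal_ideal_at x"
    "finite B" "card B = \<mu>"
    and ind: "\<And>c b. (\<Sum>b\<in>B. const_poly (c b) * b) \<in> Q \<Longrightarrow> b \<in> B \<Longrightarrow> c b = 0"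
    by (rule multiplicityE[OF m]) (rule that)
  let ?m = "maximal_ideal_at x"
  let ?c = "\<lambda>i. coeff (cev X (F i)) k"
  define l where "l = var i\<^sub>0 - const_poly (x $ i\<^sub>0)"
  define Y where "Y j = lift_poly (X j) l" for j
  have l0: "poly_eval l x = 0" by (simp add: l_def poly_eval_simps)
  have Y0: "poly_eval (Y j) x = x $ j" for j
    using X by (simp add: Y_def poly_eval_lift_poly l0 poly_0_coeff_0 contact_curve_def)
  have Yi0: "Y i\<^sub>0 = var i\<^sub>0"
    using X by (simp add: Y_def contact_curve_def lift_poly_linear) (simp add: l_def)
  \<comment> \<open>The difference \<open>var i\<^sub>0 - Y i\<^sub>0\<close> is zero, so this slot
    is free for \<open>l ^ k\<close>. The coefficients of the system with respect to
    \<open>\<zeta>\<close> then have as values at \<open>x\<close> exactly the matrix inverted by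
    \<open>N\<close>.\<close>
  define \<zeta> where "\<zeta> j = (if j = i\<^sub>0 then l ^ k else var j - Y j)" for j
  have "\<exists>b. (\<forall>j. poly_eval (b j) x = (if j = i\<^sub>0 then ?c i else jac F x $ i $ j)) \<and>
    F i = (\<Sum>j\<in>UNIV. b j * \<zeta> j)" for i
  proof -
    obtain a where a: "\<And>j. poly_eval (a j) x = grad (F i) x $ j"
      and Fi: "F i - peval const_poly Y (F i) = (\<Sum>j\<in>UNIV. a j * (var j - Y j))"
      using substitution_expansion[OF Y0, of "F i"] by blast
    have "\<forall>j<k. coeff (cev X (F i)) j = 0" using X by (simp add: contact_curve_def)
    then obtain q where q: "lift_poly (cev X (F i)) l = l ^ k * q" "poly_eval q x = ?c i"
      using l0 by (metis lift_poly_split)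
    have Y': "peval const_poly Y (F i) = l ^ k * q"
      using q(1) peval_lift_poly[of X l "F i"] by (simp add: Y_def[abs_def])
    let ?b = "\<lambda>j. if j = i\<^sub>0 then q else a j"
    have "(\<Sum>j\<in>UNIV. ?b j * \<zeta> j) = q * l ^ k + (\<Sum>j\<in>UNIV - {i\<^sub>0}. a j * (var j - Y j))"
      by (subst sum.remove[of _ i\<^sub>0]) (auto simp: \<zeta>_def intro!: sum.cong)
    also have "(\<Sum>j\<in>UNIV - {i\<^sub>0}. a j * (var j - Y j)) = (\<Sum>j\<in>UNIV. a j * (var j - Y j))"
      by (subst (2) sum.remove[of _ i\<^sub>0]) (auto simp: Yi0)
    also have "q * l ^ k + \<dots> = F i" unfolding Fi[symmetric] Y' by (simp add: mult.commute)
    finally show ?thesis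
      using a q(2) by (intro exI[of _ ?b]) (auto simp: jac_def)
  qed
  then obtain b where b: "\<And>i j. poly_eval (b i j) x = (if j = i\<^sub>0 then ?c i else jac F x $ i $ j)"
    and Fb: "\<And>i. F i = (\<Sum>j\<in>UNIV. b i j * \<zeta> j)" by metis
  have elim: "\<exists>n. (\<forall>s\<in>UNIV. n s \<in> ?m) \<and> \<zeta> r - (\<Sum>s\<in>UNIV. n s * \<zeta> s) \<in> Q" for r
  proof -
    let ?d = "\<lambda>s. \<Sum>i\<in>UNIV. const_poly (N $ r $ i) * b i s"
    have d: "poly_eval (?d s) x = (if r = s then 1 else 0)" for s
    proof -
      have "poly_eval (?d s) x = (N ** (\<chi> i j. if j = i\<^sub>0 then ?c i else jac F x $ i $ j)) $ r $ s"
        by (simp add: poly_eval_simps b matrix_matrix_mult_def)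
      then show ?thesis unfolding M by (simp add: mat_def)
    qed
    have "(\<Sum>i\<in>UNIV. const_poly (N $ r $ i) * F i) = (\<Sum>s\<in>UNIV. ?d s * \<zeta> s)"
      unfolding Fb sum_distrib_left sum_distrib_right
      by (subst sum.swap) (simp add: mult.assoc)
    moreover have "(\<Sum>i\<in>UNIV. const_poly (N $ r $ i) * F i) \<in> Q"
      by (rule ideal_sum[OF Q(1)], rule ideal_mult[OF Q(1)]) (use Q(2) in auto)
    ultimately have inQ: "(\<Sum>s\<in>UNIV. ?d s * \<zeta> s) \<in> Q" by simp
    let ?n = "\<lambda>s. (if r = s then 1 else 0) - ?d s"
    have "\<zeta> r - (\<Sum>s\<in>UNIV. ?n s * \<zeta> s) = (\<Sum>s\<in>UNIV. ?d s * \<zeta> s)"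
      by (simp add: left_diff_distrib sum_subtractf if_distrib[of "\<lambda>x. x * _"] cong: if_cong)
    then have "\<zeta> r - (\<Sum>s\<in>UNIV. ?n s * \<zeta> s) \<in> Q" using inQ by (simp only:)
    moreover have "\<forall>s\<in>UNIV. ?n s \<in> ?m"
      using d by (simp add: maximal_ideal_at_def poly_eval_simps if_distrib[of "\<lambda>p. poly_eval p x"] cong: if_cong)
    ultimately show ?thesis by (intro exI[of _ ?n] conjI)
  qed
  have zeta: "\<zeta> j \<in> Q" for j
    by (rule ideal_elimination[OF Q(1) maximal_ideal_at_ideal maximal_ideal_unit[OF Q(1,3)] finite elim UNIV_I])
  have lk: "l ^ k \<in> Q" using zeta[of i\<^sub>0] by (simp add: \<zeta>_def)
  have eta: "var j - Y j \<in> Q" for j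
    using zeta[of j] by (cases "j = i\<^sub>0") (simp_all add: \<zeta>_def Yi0 ideal_0[OF Q(1)])
  have "\<exists>d. p - (\<Sum>j<k. const_poly (d j) * l ^ j) \<in> Q" for p
  proof -
    obtain a where a: "p - peval const_poly Y p = (\<Sum>j\<in>UNIV. a j * (var j - Y j))"
      using substitution_expansion[OF Y0, of p] by blast
    have 1: "p - peval const_poly Y p \<in> Q"
      unfolding a by (rule ideal_sum[OF Q(1)], rule ideal_mult[OF Q(1)], rule eta)
    let ?q = "cev X p"
    have "peval const_poly Y p = (\<Sum>j\<le>degree ?q + k. const_poly (coeff ?q j) * l ^ j)"
      using peval_lift_poly[of X l p] lift_poly_superset[of ?q "degree ?q + k" l] by (simp add: Y_def[abs_def])
    also have "\<dots> = (\<Sum>j<k. const_poly (coeff ?q j) * l ^ j) +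
      (\<Sum>j\<in>{k..degree ?q + k}. const_poly (coeff ?q j) * l ^ j)"
      by (subst sum.union_disjoint[symmetric]) (auto intro!: sum.cong)
    finally have 2: "peval const_poly Y p - (\<Sum>j<k. const_poly (coeff ?q j) * l ^ j) =
      (\<Sum>j\<in>{k..degree ?q + k}. const_poly (coeff ?q j) * l ^ j)" by simp
    have "l ^ j \<in> Q" if "j \<ge> k" for j
      using ideal_mult[OF Q(1) lk, of "l ^ (j - k)"] that by (simp add: power_add[symmetric])
    then have "peval const_poly Y p - (\<Sum>j<k. const_poly (coeff ?q j) * l ^ j) \<in> Q"
      unfolding 2 by (intro ideal_sum[OF Q(1)] ideal_mult[OF Q(1)]) auto
    from ideal_add[OF Q(1) 1 this] have "p - (\<Sum>j<k. const_poly (coeff ?q j) * l ^ j) \<in> Q" by simp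
    then show ?thesis by blast
  qed
  then have "card B \<le> card {..<k}"
    by (intro card_le_mod_subspace[of Q B "{..<k}" "\<lambda>b. b" "\<lambda>j. l ^ j"]) (use Q(1,4) ind in auto)
  then show ?thesis using Q(5) by simp
qed

lemma cev_const: "cev (\<lambda>j. [:x $ j:]) q = [:poly_eval q x:]"
  unfolding poly_eval_peval
  by (rule peval_hom_comp[symmetric]) (auto simp: ev_id.coeff_hom_axioms ev_curve.coeff_hom_axioms)

text \<open>A curve of greatest order of contact exists because the order is bounded by the
  multiplicity. If its leading coefficient lay in the range of the Jacobian, a correction in degree
  \<open>k\<close> would remove it and raise the order. So it lies outside, the bordered matrix is
  invertible, and the converse bound yields \<open>k = \<mu>\<close>.\<close>

lemma contact_curve_exists:
  fixes F :: "'n::finite \<Rightarrow> 'n cpoly"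
  assumes m: "has_multiplicity F x \<mu>" and F0: "\<And>i. poly_eval (F i) x = 0"
    and r: "jac F x *v r = 0" "r $ i\<^sub>0 = 1" and ker: "\<And>v. jac F x *v v = 0 \<Longrightarrow> \<exists>t. v = t *s r"
  obtains X where "contact_curve F x i\<^sub>0 \<mu> X" "\<And>j. coeff (X j) 1 = r $ j" "\<mu> \<ge> 2"
    "\<And>u. (\<chi> i. coeff (cev X (F i)) \<mu>) \<noteq> jac F x *v u"
proof -
  define P where "P k X \<longleftrightarrow> contact_curve F x i\<^sub>0 k X \<and> (\<forall>j. coeff (X j) 1 = r $ j)" for k X
  have P2: "P 2 (\<lambda>j. [:x $ j, r $ j:])"
  proof -
    have "coeff (cev (\<lambda>j. [:x $ j, r $ j:]) (F i)) 1 = 0" for i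
    proof -
      have "coeff (cev (\<lambda>j. [:x $ j, r $ j:]) (F i)) 1 =
        (\<Sum>j\<in>UNIV. grad (F i) x $ j * r $ j)"
        by (subst cev_taylor_exact(1)[of 1 "\<lambda>j. [:x $ j, r $ j:]" "\<lambda>j. [:x $ j:]"])
          (simp_all add: cev_const)
      also have "\<dots> = (jac F x *v r) $ i" by (simp add: jac_def matrix_vector_mult_def)
      finally show ?thesis using r by simp
    qed
    moreover have "coeff (cev (\<lambda>j. [:x $ j, r $ j:]) (F i)) 0 = 0" for i
      by (simp add: coeff_cev_0 F0)
    ultimately show ?thesis using r(2) by (auto simp: P_def contact_curve_def less_2_cases_iff)
  qed
  have bd: "k \<le> \<mu>" if "\<exists>X. P k X" for k
    using that contact_order_le_multiplicity[OF m] by (auto simp: P_def)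
  define k where "k = (GREATEST k. \<exists>X. P k X)"
  have "\<exists>X. P k X"
    unfolding k_def by (rule GreatestI_nat[of "\<lambda>k. \<exists>X. P k X" 2 \<mu>]) (use P2 bd in blast)+
  then obtain X where X: "P k X" by blast
  have k_max: "l \<le> k" if "P l Y" for l Y
    unfolding k_def by (rule Greatest_le_nat[of "\<lambda>k. \<exists>X. P k X" l \<mu>]) (use that bd in blast)+
  have k2: "k \<ge> 2" by (rule k_max[OF P2])
  have X0: "(\<chi> j. coeff (X j) 0) = x" using X by (simp add: P_def contact_curve_def vec_eq_iff)
  let ?c = "\<chi> i. coeff (cev X (F i)) k"
  have c: "?c \<noteq> jac F x *v u" for u
  proof
    assume cu: "?c = jac F x *v u"
    \<comment> \<open>A multiple of the kernel vector is subtracted so that the correction leaves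
      the coordinate \<open>i\<^sub>0\<close>, which is the parameter, unchanged; the image under
      the Jacobian stays the same.\<close>
    define v where "v = u - (u $ i\<^sub>0) *s r"
    have v: "jac F x *v v = ?c" "v $ i\<^sub>0 = 0"
      by (simp_all add: v_def cu matrix_vector_mult_diff_distrib vector_scalar_commute r)
    define Y where "Y j = X j - monom (v $ j) k" for j
    have Yl: "coeff (Y j) l = coeff (X j) l" if "l < k" for j l
      using that by (simp add: Y_def coeff_diff coeff_monom)
    have "coeff (cev Y (F i)) k = 0" for i
    proof -
      have "coeff (cev Y (F i)) k = coeff (cev X (F i)) k + (\<Sum>j\<in>UNIV. grad (F i) x $ j * (coeff (Y j) k - coeff (X j) k))"
        using cev_taylor_exact(1)[of k Y X "F i"] Yl k2 by (simp add: X0)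
      also have "(\<Sum>j\<in>UNIV. grad (F i) x $ j * (coeff (Y j) k - coeff (X j) k)) = - (jac F x *v v) $ i"
        by (simp add: Y_def jac_def matrix_vector_mult_def sum_negf)
      finally show ?thesis by (simp add: v)
    qed
    moreover have "coeff (cev Y (F i)) l = 0" if "l < k" for l i
      using cev_taylor_exact(2)[of k Y X l "F i"] Yl k2 that X by (simp add: P_def contact_curve_def)
    ultimately have "coeff (cev Y (F i)) l = 0" if "l < Suc k" for l i
      using that by (auto simp: less_Suc_eq)
    moreover have "Y i\<^sub>0 = [:x $ i\<^sub>0, 1:]" using X v by (simp add: Y_def P_def contact_curve_def)
    moreover have "coeff (Y j) 0 = x $ j" "coeff (Y j) 1 = r $ j" for j
      using X Yl k2 by (auto simp: P_def contact_curve_def)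
    ultimately have "P (Suc k) Y" by (simp add: P_def contact_curve_def)
    then show False using k_max by force
  qed
  let ?M = "\<chi> i j. if j = i\<^sub>0 then coeff (cev X (F i)) k else jac F x $ i $ j"
  have "v = 0" if Mv: "?M *v v = 0" for v
  proof -
    define w where "w = v - (v $ i\<^sub>0) *s axis i\<^sub>0 1"
    have w: "w $ j = (if j = i\<^sub>0 then 0 else v $ j)" for j
      by (simp add: w_def axis_def)
    have "(?M *v v) $ i = v $ i\<^sub>0 * ?c $ i + (jac F x *v w) $ i" for i
      unfolding matrix_vector_mult_def
      by (simp add: w if_distrib[of "\<lambda>x. _ * x"] if_distrib[of "\<lambda>x. x * _"] sum.remove[of _ i\<^sub>0] cong: if_cong)
    then have e: "v $ i\<^sub>0 *s ?c + jac F x *v w = 0"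
      using Mv by (simp add: vec_eq_iff)
    have "v $ i\<^sub>0 = 0"
    proof (rule ccontr)
      assume n: "v $ i\<^sub>0 \<noteq> 0"
      have "?c = inverse (v $ i\<^sub>0) *s (v $ i\<^sub>0 *s ?c)" using n by (simp add: vec_eq_iff)
      also have "v $ i\<^sub>0 *s ?c = - (jac F x *v w)" using e by (simp only: eq_neg_iff_add_eq_0)
      also have "inverse (v $ i\<^sub>0) *s \<dots> = jac F x *v (- inverse (v $ i\<^sub>0) *s w)"
        unfolding vector_scalar_commute by (simp add: vec_eq_iff)
      finally show False using c by blast
    qed
    with e have "jac F x *v w = 0" by simp
    then obtain t where t: "w = t *s r" using ker by blast
    then have "t = 0" using w[of i\<^sub>0] r(2) by simp
    then have "v $ j = 0" for j
      using t w[of j] \<open>v $ i\<^sub>0 = 0\<close> by (cases "j = i\<^sub>0") auto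
    then show ?thesis by (simp add: vec_eq_iff)
  qed
  then obtain N where N: "N ** ?M = mat 1"
    using matrix_left_invertible_ker[of ?M] by blast
  have "contact_curve F x i\<^sub>0 k X" using X by (simp add: P_def)
  from multiplicity_le_contact_order[OF m this N] have "\<mu> \<le> k" .
  moreover have "k \<le> \<mu>" using bd X by blast
  ultimately have "k = \<mu>" by simp
  then show ?thesis using that[of X] X k2 c by (simp add: P_def)
qed

section \<open>Singular vectors\<close>

text \<open>The inner product of the type class is only the real part of this one; orthogonality
  over the complex numbers needs both parts.\<close>

definition cdot :: "'n::finite cvec \<Rightarrow> 'n cvec \<Rightarrow> complex" where
  "cdot x y = (\<Sum>i\<in>UNIV. x $ i * cnj (y $ i))"

lemma cdot_simps:
  "cdot (x + y) z = cdot x z + cdot y z" "cdot (x - y) z = cdot x z - cdot y z"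
  "cdot (c *s x) z = c * cdot x z" "cdot (- x) z = - cdot x z" "cdot 0 z = 0"
  by (simp_all add: cdot_def distrib_right left_diff_distrib sum.distrib sum_subtractf
      sum_distrib_left mult.assoc sum_negf)

lemma cdot_cnj: "cdot y x = cnj (cdot x y)"
  by (simp add: cdot_def mult.commute)

lemma cdot_right_simps:
  "cdot z (x + y) = cdot z x + cdot z y" "cdot z (x - y) = cdot z x - cdot z y"
  "cdot z (c *s x) = cnj c * cdot z x" "cdot z 0 = 0"
  by (simp_all add: cdot_def distrib_left right_diff_distrib sum.distrib sum_subtractf
      sum_distrib_left mult_ac)

lemma Re_cdot: "Re (cdot x y) = x \<bullet> y"
  by (simp add: cdot_def inner_vec_def inner_complex_def)

lemma cdot_self: "cdot x x = of_real ((norm x)\<^sup>2)"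
proof -
  have "Im (cdot x x) = 0" by (simp add: cdot_def)
  moreover have "Re (cdot x x) = (norm x)\<^sup>2" by (simp add: Re_cdot power2_norm_eq_inner)
  ultimately show ?thesis by (simp add: complex_eq_iff)
qed

lemma norm_cdot_le: "norm (cdot x y) \<le> norm x * norm y"
proof -
  have "norm (cdot x y) \<le> (\<Sum>i\<in>UNIV. \<bar>norm (x $ i)\<bar> * \<bar>norm (y $ i)\<bar>)"
    unfolding cdot_def by (rule order_trans[OF norm_sum]) (simp add: norm_mult)
  also have "\<dots> \<le> norm x * norm y"
    unfolding norm_vec_def by (rule L2_set_mult_ineq)
  finally show ?thesis .
qed

lemma norm_cmult_vec: "norm (c *s x :: 'n::finite cvec) = norm c * norm x"
  by (simp add: norm_vec_def norm_mult L2_set_right_distrib)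

lemma cdot_matrix: "cdot (A *v x) y = cdot x (conj_transpose A *v y)"
proof -
  have "cdot (A *v x) y = (\<Sum>i\<in>UNIV. \<Sum>j\<in>UNIV. A $ i $ j * x $ j * cnj (y $ i))"
    by (simp add: cdot_def matrix_vector_mult_def sum_distrib_right)
  also have "\<dots> = (\<Sum>j\<in>UNIV. \<Sum>i\<in>UNIV. A $ i $ j * x $ j * cnj (y $ i))"
    by (rule sum.swap)
  also have "\<dots> = cdot x (conj_transpose A *v y)"
    by (simp add: cdot_def conj_transpose_def matrix_vector_mult_def sum_distrib_left mult_ac)
  finally show ?thesis .
qed

lemma conj_transpose_conj_transpose [simp]: "conj_transpose (conj_transpose A) = A"
  by (simp add: conj_transpose_def vec_eq_iff)

lemma conj_transpose_mult: "conj_transpose (A ** B) = conj_transpose B ** conj_transpose A"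
  by (simp add: conj_transpose_def matrix_matrix_mult_def vec_eq_iff mult.commute)

lemma conj_transpose_mat_1 [simp]: "conj_transpose (mat 1) = mat 1"
  by (simp add: conj_transpose_def mat_def vec_eq_iff)

lemma inner_matrix: "(A *v x) \<bullet> y = x \<bullet> (conj_transpose A *v y)"
  unfolding Re_cdot[symmetric] cdot_matrix ..

lemma scaleR_cvec: "t *\<^sub>R x = complex_of_real t *s (x :: 'n::finite cvec)"
  by (simp add: vec_eq_iff complex_eq_iff)

lemma matrix_scaleR:
  fixes A :: "'n::finite cmat"
  shows "A *v (t *\<^sub>R x) = t *\<^sub>R (A *v x)"
  by (simp add: matrix_vector_mult_def vec_eq_iff scaleR_sum_right)

lemma continuous_on_matrix_vector: "continuous_on S (\<lambda>x. A *v x)" for A :: "'n::finite cmat"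
  unfolding matrix_vector_mult_def by (intro continuous_intros continuous_on_vec_lambda)

text \<open>The variational form of being a right singular vector for the smallest singular value;
  the equivalence is \<open>right_singular_vector_min\<close>. It permits comparison with arbitrary
  test vectors.\<close>

definition min_direction :: "'n::finite cmat \<Rightarrow> 'n cvec \<Rightarrow> bool" where
  "min_direction A v \<longleftrightarrow> norm v = 1 \<and> (\<forall>h. norm (A *v v) * norm h \<le> norm (A *v h))"

lemma min_direction_exists: "\<exists>v. min_direction A v"
proof -
  have "sphere 0 1 \<noteq> ({} :: 'a cvec set)" by simp
  then obtain v where v: "v \<in> sphere 0 1" "\<And>h. h \<in> sphere 0 1 \<Longrightarrow> norm (A *v v) \<le> norm (A *v h)"
    using continuous_attains_inf[of "sphere 0 1" "\<lambda>h. norm (A *v h)"]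
    by (metis compact_sphere continuous_on_matrix_vector continuous_on_norm)
  have "norm (A *v v) * norm h \<le> norm (A *v h)" for h
  proof (cases "h = 0")
    case False
    then have "norm (A *v v) \<le> norm (A *v ((1 / norm h) *\<^sub>R h))"
      by (intro v(2)) simp
    then show ?thesis using False unfolding matrix_scaleR by (simp add: field_simps)
  qed simp
  then show ?thesis using v(1) by (auto simp: min_direction_def)
qed

text \<open>First variation of the squared norm of \<open>A *v h\<close> minus
  \<open>\<sigma>^2\<close> times that of \<open>h\<close>, which is nonnegative and zero at
  \<open>v\<close>, in the direction of the residual \<open>b\<close>. The linear term is twice the
  squared norm of \<open>b\<close>, so \<open>b\<close> must vanish.\<close>

lemma min_direction_critical:
  assumes "min_direction A v"
  shows "conj_transpose A *v (A *v v) = complex_of_real ((norm (A *v v))\<^sup>2) *s v"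
proof -
  let ?\<sigma> = "norm (A *v v)"
  define b where "b = conj_transpose A *v (A *v v) - (?\<sigma>\<^sup>2) *\<^sub>R v"
  have v: "v \<bullet> v = 1" using assms by (simp add: min_direction_def power2_norm_eq_inner[symmetric])
  define q where "q = (norm (A *v b))\<^sup>2 - ?\<sigma>\<^sup>2 * (norm b)\<^sup>2"
  have nonneg: "?\<sigma>\<^sup>2 * (norm h)\<^sup>2 \<le> (norm (A *v h))\<^sup>2" for h
    using assms power_mono[of "?\<sigma> * norm h" "norm (A *v h)" 2]
    by (auto simp: min_direction_def power_mult_distrib)
  have q0: "q \<ge> 0" using nonneg[of b] by (simp add: q_def)
  have var: "0 \<le> 2 * t * (norm b)\<^sup>2 + t\<^sup>2 * q" for t
  proof -
    have 1: "(norm (A *v (v + t *\<^sub>R b)))\<^sup>2 = ?\<sigma>\<^sup>2 + 2 * t * ((conj_transpose A *v (A *v v)) \<bullet> b) + t\<^sup>2 * (norm (A *v b))\<^sup>2"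
      unfolding matrix_vector_right_distrib matrix_scaleR power2_norm_eq_inner
      using inner_matrix[of "conj_transpose A" "A *v v" b]
      by (simp add: inner_add_left inner_add_right inner_commute power2_eq_square algebra_simps)
    have 2: "(norm (v + t *\<^sub>R b))\<^sup>2 = 1 + 2 * t * (v \<bullet> b) + t\<^sup>2 * (norm b)\<^sup>2"
      unfolding power2_norm_eq_inner
      using v by (simp add: inner_add_left inner_add_right inner_commute power2_eq_square algebra_simps)
    have 3: "(conj_transpose A *v (A *v v)) \<bullet> b = (norm b)\<^sup>2 + ?\<sigma>\<^sup>2 * (v \<bullet> b)"
      by (subst (2) b_def) (simp add: power2_norm_eq_inner inner_diff_right inner_commute b_def inner_diff_left algebra_simps)
    have "0 \<le> (norm (A *v (v + t *\<^sub>R b)))\<^sup>2 - ?\<sigma>\<^sup>2 * (norm (v + t *\<^sub>R b))\<^sup>2"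
      using nonneg by simp
    also have "\<dots> = 2 * t * (norm b)\<^sup>2 + t\<^sup>2 * q"
      unfolding 1 2 3 q_def by (simp add: algebra_simps)
    finally show ?thesis .
  qed
  have "norm b = 0"
  proof (rule ccontr)
    assume "norm b \<noteq> 0"
    then have p: "(norm b)\<^sup>2 > 0" by simp
    \<comment> \<open>A step small enough for the linear term to dominate; \<open>q + 1\<close>
      keeps the denominator positive when \<open>q\<close> is zero.\<close>
    define t where "t = (norm b)\<^sup>2 / (q + 1)"
    have t: "t > 0" using p q0 by (simp add: t_def)
    have "0 \<le> t * (t * q - 2 * (norm b)\<^sup>2)"
      using var[of "- t"] by (simp add: power2_eq_square algebra_simps)
    then have "2 * (norm b)\<^sup>2 \<le> t * q" using t by (simp add: zero_le_mult_iff)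
    also have "t * q \<le> (norm b)\<^sup>2" using q0 p by (simp add: t_def divide_simps)
    finally show False using p by simp
  qed
  then have "conj_transpose A *v (A *v v) = (?\<sigma>\<^sup>2) *\<^sub>R v" by (simp add: b_def)
  then show ?thesis unfolding scaleR_cvec .
qed

lemma min_direction_singular_pair:
  fixes A :: "'n::finite cmat"
  assumes v: "min_direction A v"
  shows "\<exists>u. singular_pair A (norm (A *v v)) u v"
proof (cases "A *v v = 0")
  case True
  \<comment> \<open>As \<open>A *v v\<close> vanishes, a left vector cannot be obtained by
    normalising it. It is taken from the kernel of the adjoint, which is nontrivial because a left
    inverse of the adjoint would yield one of \<open>A\<close>.\<close>
  have "\<exists>u. u \<noteq> 0 \<and> conj_transpose A *v u = 0"
  proof (rule ccontr)
    assume "\<not> ?thesis"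
    then obtain B where "B ** conj_transpose A = mat 1"
      using matrix_left_invertible_ker[of "conj_transpose A"] by blast
    then have "conj_transpose A ** B = mat 1" using matrix_left_right_inverse by blast
    then have "conj_transpose B ** A = mat 1"
      using conj_transpose_mult[of "conj_transpose A" B] by simp
    then have "v = conj_transpose B *v (A *v v)" by (simp add: matrix_vector_mul_assoc)
    then show False using True v by (simp add: min_direction_def)
  qed
  then obtain u where u: "u \<noteq> 0" "conj_transpose A *v u = 0" by blast
  have "singular_pair A (norm (A *v v)) ((1 / norm u) *\<^sub>R u) v"
    using v True u by (simp add: singular_pair_def min_direction_def matrix_scaleR)
  then show ?thesis by blast
next
  case False
  let ?\<sigma> = "norm (A *v v)"
  have "conj_transpose A *v ((1 / ?\<sigma>) *\<^sub>R (A *v v)) = complex_of_real ?\<sigma> *s v"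
    unfolding matrix_scaleR min_direction_critical[OF v] unfolding scaleR_cvec vector_smult_assoc
    using False by (simp add: power2_eq_square)
  then have "singular_pair A ?\<sigma> ((1 / ?\<sigma>) *\<^sub>R (A *v v)) v"
    using v False unfolding scaleR_cvec
    by (simp add: singular_pair_def min_direction_def vector_smult_assoc norm_cmult_vec norm_divide)
  then show ?thesis by blast
qed

lemma singular_pair_norm: "singular_pair A \<sigma> u v \<Longrightarrow> norm (A *v v) = \<sigma>"
  by (simp add: singular_pair_def norm_cmult_vec)

lemma smallest_singular_value_eq:
  assumes "min_direction A v"
  shows "smallest_singular_value A = norm (A *v v)"
  unfolding smallest_singular_value_def
proof (rule Least_equality)
  show "singular_value A (norm (A *v v))"
    using min_direction_singular_pair[OF assms] by (auto simp: singular_value_def)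
  fix \<sigma> assume "singular_value A \<sigma>"
  then obtain u w where w: "singular_pair A \<sigma> u w" by (auto simp: singular_value_def)
  then have "norm w = 1" by (simp add: singular_pair_def)
  moreover have "norm (A *v v) * norm w \<le> norm (A *v w)" using assms by (simp add: min_direction_def)
  ultimately show "norm (A *v v) \<le> \<sigma>" using singular_pair_norm[OF w] by simp
qed

lemma right_singular_vector_min:
  "right_singular_vector A (smallest_singular_value A) v \<longleftrightarrow> min_direction A v"
proof
  assume v: "min_direction A v"
  show "right_singular_vector A (smallest_singular_value A) v"
    unfolding right_singular_vector_def smallest_singular_value_eq[OF v]
    by (rule min_direction_singular_pair[OF v])
next
  assume "right_singular_vector A (smallest_singular_value A) v"
  then obtain u where u: "singular_pair A (smallest_singular_value A) u v"
    by (auto simp: right_singular_vector_def)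
  obtain w where w: "min_direction A w" using min_direction_exists[of A] by blast
  have "norm (A *v v) = norm (A *v w)"
    using singular_pair_norm[OF u] smallest_singular_value_eq[OF w] by simp
  then show "min_direction A v" using u w by (simp add: min_direction_def singular_pair_def)
qed

text \<open>A Householder reflection carrying the first basis vector \<open>e\<close> to
  \<open>s\<close>. Over the complex numbers such a reflection requires the product of
  \<open>e\<close> and \<open>s\<close> to be real, so the phase \<open>\<omega>\<close> of the
  first entry is split off \<open>r\<close> and restored at the end.\<close>

lemma unitary_completion:
  fixes r :: "'n::{finite,linorder} cvec"
  assumes r: "norm r = 1"
  obtains R where "unitary_matrix R" "column first_index R = r"
proof -
  let ?f = "first_index :: 'n"
  obtain \<omega> where \<omega>: "norm \<omega> = 1" "r $ ?f = \<omega> * of_real (norm (r $ ?f))"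
  proof (cases "r $ ?f = 0")
    case True
    then show ?thesis using that[of 1] by simp
  next
    case False
    then show ?thesis using that[of "r $ ?f / of_real (norm (r $ ?f))"] by (simp add: norm_divide)
  qed
  have \<omega>2: "\<omega> * cnj \<omega> = 1" using \<omega>(1) by (simp add: complex_norm_square[symmetric])
  define \<rho> where "\<rho> = norm (r $ ?f)"
  define s where "s = cnj \<omega> *s r"
  define e where "e = (axis ?f 1 :: 'n cvec)"
  define u where "u = e - s"
  have sf: "s $ ?f = of_real \<rho>"
  proof -
    have "s $ ?f = cnj \<omega> * (r $ ?f)" by (simp add: s_def)
    also have "\<dots> = cnj \<omega> * (\<omega> * of_real (norm (r $ ?f)))" by (rule arg_cong[OF \<omega>(2)])
    also have "\<dots> = (\<omega> * cnj \<omega>) * of_real \<rho>" by (simp add: \<rho>_def mult_ac)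
    finally show ?thesis unfolding \<omega>2 by simp
  qed
  have ns: "norm s = 1" using r \<omega>(1) by (simp add: s_def norm_cmult_vec)
  have ce: "cdot e y = cnj (y $ ?f)" for y
    by (simp add: cdot_def e_def axis_def if_distrib[of "\<lambda>x. x * _"] cong: if_cong)
  have "of_real ((norm e)\<^sup>2) = (1 :: complex)"
    unfolding cdot_self[symmetric] ce by (simp add: e_def axis_def)
  then have "(norm e)\<^sup>2 = 1" by (simp only: of_real_eq_1_iff)
  then have ne: "norm e = 1" using norm_ge_zero[of e] unfolding power2_eq_1_iff by linarith
  define n where "n = (norm u)\<^sup>2"
  have "cdot u u = cdot e e - cdot e s - cdot s e + cdot s s"
    by (simp add: u_def cdot_simps cdot_right_simps)
  also have "\<dots> = of_real (2 - 2 * \<rho>)"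
    using ce[of s] cdot_cnj[of s e] sf by (simp add: cdot_self ns ne)
  finally have n: "n = 2 - 2 * \<rho>" unfolding cdot_self n_def by (simp only: of_real_eq_iff)
  \<comment> \<open>If \<open>s = e\<close> this is \<open>2 / 0 = 0\<close> and the reflection
    becomes the identity; the relation \<open>c * c * n = 2 * c\<close> holds in that case
    too.\<close>
  define c where "c = 2 / n"
  have uf: "u $ ?f = of_real (1 - \<rho>)" by (simp add: u_def e_def axis_def sf)
  have c: "c * c * n = 2 * c" by (simp add: c_def)
  define H where "H = (\<chi> i j. (if i = j then 1 else 0) - of_real c * (u $ i * cnj (u $ j)))"
  have Hsym: "conj_transpose H = H"
    by (simp add: H_def conj_transpose_def vec_eq_iff mult.commute)
  have uu: "(\<Sum>k\<in>UNIV. cnj (u $ k) * u $ k) = of_real n"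
    using cdot_self[of u] by (simp add: cdot_def n_def mult.commute)
  have HH: "H ** H = mat 1"
  proof -
    have "(H ** H) $ i $ j = mat 1 $ i $ j" for i j
    proof -
      have "(H ** H) $ i $ j = (\<Sum>k\<in>UNIV. ((if i = k then 1 else 0) - of_real c * (u $ i * cnj (u $ k))) *
        ((if k = j then 1 else 0) - of_real c * (u $ k * cnj (u $ j))))"
        by (simp add: matrix_matrix_mult_def H_def)
      also have "\<dots> = (\<Sum>k\<in>UNIV. (if i = k then if k = j then 1 else 0 else 0) -
        (if i = k then of_real c * (u $ k * cnj (u $ j)) else 0) -
        (if k = j then of_real c * (u $ i * cnj (u $ k)) else 0) +
        of_real c * of_real c * u $ i * cnj (u $ j) * (cnj (u $ k) * u $ k))"
        by (rule sum.cong) (auto simp: algebra_simps)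
      also have "\<dots> = (if i = j then 1 else 0) - of_real c * (u $ i * cnj (u $ j)) -
        of_real c * (u $ i * cnj (u $ j)) + of_real c * of_real c * u $ i * cnj (u $ j) * of_real n"
        unfolding sum.distrib sum_subtractf sum_distrib_left[symmetric] uu by simp
      also have "of_real c * of_real c * u $ i * cnj (u $ j) * of_real n =
        of_real (c * c * n) * (u $ i * cnj (u $ j))" by simp
      finally show ?thesis unfolding c by (simp add: mat_def)
    qed
    then show ?thesis by (simp add: vec_eq_iff)
  qed
  have Hf: "H $ i $ ?f = s $ i" for i
  proof (cases "n = 0")
    case True
    then have "u = 0" by (simp add: n_def)
    then show ?thesis by (simp add: H_def u_def e_def axis_def vec_eq_iff)
  next
    case False
    then have "c * (1 - \<rho>) = 1" unfolding c_def n by (simp add: divide_simps)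
    moreover have "of_real c * (u $ i * cnj (u $ ?f)) = of_real (c * (1 - \<rho>)) * u $ i"
      unfolding uf by simp
    ultimately have eq: "of_real c * (u $ i * cnj (u $ ?f)) = u $ i" by simp
    have "H $ i $ ?f = e $ i - of_real c * (u $ i * cnj (u $ ?f))" by (simp add: H_def e_def axis_def)
    then show ?thesis unfolding eq by (simp add: u_def)
  qed
  define R where "R = (\<chi> i j. \<omega> * H $ i $ j)"
  have "conj_transpose R ** R = conj_transpose H ** H"
  proof -
    have e: "cnj (\<omega> * a) * (\<omega> * b) = cnj a * b" for a b
    proof -
      have "cnj (\<omega> * a) * (\<omega> * b) = (\<omega> * cnj \<omega>) * (cnj a * b)" by simp
      then show ?thesis by (simp only: \<omega>2) simp
    qed
    show ?thesis unfolding R_def conj_transpose_def matrix_matrix_mult_def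
      by (simp only: vec_lambda_beta e)
  qed
  then have "conj_transpose R ** R = mat 1" using Hsym HH by simp
  then have "unitary_matrix R"
    using matrix_left_right_inverse by (auto simp: unitary_matrix_def)
  moreover have "column first_index R = r"
  proof -
    have "\<omega> * s $ i = r $ i" for i
    proof -
      have "\<omega> * s $ i = (\<omega> * cnj \<omega>) * r $ i" by (simp add: s_def)
      then show ?thesis by (simp only: \<omega>2) simp
    qed
    then show ?thesis by (simp add: R_def column_def Hf vec_eq_iff)
  qed
  ultimately show ?thesis by (rule that)
qed

section \<open>Differential operators as curve coefficients\<close>

text \<open>The falling factorial as a complex number; truncated subtraction contributes a factor
  zero as soon as \<open>m\<close> exceeds \<open>n\<close>.\<close>

definition ffact :: "nat \<Rightarrow> nat \<Rightarrow> complex" where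
  "ffact n m = (\<Prod>i<m. of_nat (n - i))"

lemma ffact_Suc: "ffact n (Suc m) = ffact n m * of_nat (n - m)"
  by (simp add: ffact_def)

lemma ffact_eq_0: "n < m \<Longrightarrow> ffact n m = 0"
  unfolding ffact_def by (rule prod_zero) auto

lemma ffact_self: "ffact n n = fact n"
proof -
  have "m \<le> n \<Longrightarrow> ffact n m * fact (n - m) = fact n" for m
  proof (induction m)
    case (Suc m)
    then have "(fact (n - m) :: complex) = of_nat (n - m) * fact (n - Suc m)"
      by (metis Suc_diff_Suc Suc_le_lessD fact_Suc of_nat_mult of_nat_fact)
    with Suc show ?case by (simp add: ffact_Suc mult.assoc)
  qed (simp add: ffact_def)
  from this[of n] show ?thesis by simp
qed

text \<open>The derivative of order \<open>\<gamma>\<close> of the polynomial function with Taylor coefficients \<open>c\<close> at \<open>z\<close>.\<close>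

definition taylor_deriv ::
    "('n::finite multi_index \<Rightarrow> complex) \<Rightarrow> 'n multi_index set \<Rightarrow> 'n cvec \<Rightarrow> ('n \<Rightarrow> nat) \<Rightarrow> 'n cvec \<Rightarrow> complex" where
  "taylor_deriv c S z \<gamma> w =
     (\<Sum>\<alpha>\<in>S. c \<alpha> * (\<Prod>i\<in>UNIV. ffact (\<alpha> $ i) (\<gamma> i) * (w $ i - z $ i) ^ (\<alpha> $ i - \<gamma> i)))"

lemma partial_deriv_taylor_deriv:
  "partial_deriv j (taylor_deriv c S z \<gamma>) = taylor_deriv c S z (\<gamma>(j := Suc (\<gamma> j)))"
proof
  fix w
  let ?t = "\<lambda>\<gamma> \<alpha> i w. ffact (\<alpha> $ i) (\<gamma> i) * (w $ i - z $ i) ^ (\<alpha> $ i - \<gamma> i)"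
  have D: "((\<lambda>t. \<Prod>i\<in>UNIV. ?t \<gamma> \<alpha> i (w + t *s axis j 1)) has_field_derivative
    (\<Prod>i\<in>UNIV. ?t (\<gamma>(j := Suc (\<gamma> j))) \<alpha> i w)) (at 0)" for \<alpha>
  proof -
    let ?r = "\<Prod>i\<in>UNIV - {j}. ?t \<gamma> \<alpha> i w"
    have r: "(\<Prod>i\<in>UNIV - {j}. ?t \<gamma> \<alpha> i (w + t *s axis j 1)) = ?r" for t
      by (rule prod.cong) (auto simp: axis_def)
    have "((\<lambda>t. ffact (\<alpha> $ j) (\<gamma> j) * (w $ j + t - z $ j) ^ (\<alpha> $ j - \<gamma> j) * ?r) has_field_derivative
      ffact (\<alpha> $ j) (Suc (\<gamma> j)) * (w $ j - z $ j) ^ (\<alpha> $ j - Suc (\<gamma> j)) * ?r) (at 0)"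
      by (rule derivative_eq_intros refl)+ (simp add: ffact_Suc)
    moreover have "(\<Prod>i\<in>UNIV. ?t \<gamma> \<alpha> i (w + t *s axis j 1)) =
      ffact (\<alpha> $ j) (\<gamma> j) * (w $ j + t - z $ j) ^ (\<alpha> $ j - \<gamma> j) * ?r" for t
      unfolding r[of t, symmetric] by (subst prod.remove[of _ j]) simp_all
    moreover have "(\<Prod>i\<in>UNIV. ?t (\<gamma>(j := Suc (\<gamma> j))) \<alpha> i w) =
      ffact (\<alpha> $ j) (Suc (\<gamma> j)) * (w $ j - z $ j) ^ (\<alpha> $ j - Suc (\<gamma> j)) * ?r"
      by (subst prod.remove[of _ j]) simp_all
    ultimately show ?thesis by simp
  qed
  have "((\<lambda>t. taylor_deriv c S z \<gamma> (w + t *s axis j 1)) has_field_derivative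
    taylor_deriv c S z (\<gamma>(j := Suc (\<gamma> j))) w) (at 0)"
    unfolding taylor_deriv_def by (rule DERIV_sum, rule DERIV_cmult, rule D)
  then show "partial_deriv j (taylor_deriv c S z \<gamma>) w = taylor_deriv c S z (\<gamma>(j := Suc (\<gamma> j))) w"
    unfolding partial_deriv_def by (rule DERIV_imp_deriv)
qed

lemma partial_deriv_power_taylor_deriv:
  "(partial_deriv j ^^ m) (taylor_deriv c S z \<gamma>) = taylor_deriv c S z (\<gamma>(j := \<gamma> j + m))"
proof (induction m)
  case (Suc m)
  have u: "(\<gamma>(j := \<gamma> j + m))(j := Suc ((\<gamma>(j := \<gamma> j + m)) j)) = \<gamma>(j := \<gamma> j + Suc m)"
    by (simp add: fun_eq_iff)
  show ?case unfolding funpow.simps o_apply Suc.IH partial_deriv_taylor_deriv u ..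
qed simp

lemma foldr_partial_deriv_taylor_deriv:
  "distinct xs \<Longrightarrow> foldr (\<lambda>i. partial_deriv i ^^ (\<beta> i)) xs (taylor_deriv c S z (\<lambda>_. 0)) =
    taylor_deriv c S z (\<lambda>i. if i \<in> set xs then \<beta> i else 0)"
proof (induction xs)
  case (Cons x xs)
  let ?g = "\<lambda>i. if i \<in> set xs then \<beta> i else 0"
  have u: "?g(x := ?g x + \<beta> x) = (\<lambda>i. if i \<in> set (x # xs) then \<beta> i else 0)"
    using Cons.prems by (auto simp: fun_eq_iff)
  have "foldr (\<lambda>i. partial_deriv i ^^ (\<beta> i)) xs (taylor_deriv c S z (\<lambda>_. 0)) = taylor_deriv c S z ?g"
    using Cons by simp
  then show ?case
    unfolding foldr.simps o_apply by (simp only: partial_deriv_power_taylor_deriv u)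
qed simp

lemma taylor_deriv_center:
  assumes "finite S" "\<And>\<alpha>. \<alpha> \<notin> S \<Longrightarrow> c \<alpha> = 0"
  shows "taylor_deriv c S z (\<lambda>i. \<beta> $ i) z = c \<beta> * (\<Prod>i\<in>UNIV. fact (\<beta> $ i))"
proof -
  have z: "(\<Prod>i\<in>UNIV. ffact (\<alpha> $ i) (\<beta> $ i) * (z $ i - z $ i) ^ (\<alpha> $ i - \<beta> $ i)) =
    (if \<alpha> = \<beta> then \<Prod>i\<in>UNIV. fact (\<beta> $ i) else 0)" for \<alpha>
  proof (cases "\<alpha> = \<beta>")
    case False
    then obtain i where "\<alpha> $ i \<noteq> \<beta> $ i" by (auto simp: vec_eq_iff)
    then have "ffact (\<alpha> $ i) (\<beta> $ i) * (z $ i - z $ i) ^ (\<alpha> $ i - \<beta> $ i) = 0"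
      by (cases "\<alpha> $ i" "\<beta> $ i" rule: linorder_cases) (auto simp: ffact_eq_0 zero_power)
    then show ?thesis using False by (auto intro!: prod_zero)
  qed (simp add: ffact_self)
  have "taylor_deriv c S z (\<lambda>i. \<beta> $ i) z = (\<Sum>\<alpha>\<in>S. if \<alpha> = \<beta> then c \<beta> * (\<Prod>i\<in>UNIV. fact (\<beta> $ i)) else 0)"
    unfolding taylor_deriv_def z by (rule sum.cong) auto
  then show ?thesis using assms by auto
qed

text \<open>The factorials in the normalisation of the operator cancel those produced by repeated
  differentiation, so it reads off a Taylor coefficient at \<open>z\<close>.\<close>

lemma apply_D_translated:
  fixes q :: "'n::{finite,linorder} cpoly"
  assumes g: "\<And>w. g w = poly_eval q (w - z)"
  shows "apply_D \<alpha> g z = Poly_Mapping.lookup q \<alpha>"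
proof -
  have "g = taylor_deriv (Poly_Mapping.lookup q) (Poly_Mapping.keys q) z (\<lambda>_. 0)"
    by (simp add: fun_eq_iff g poly_eval_def taylor_deriv_def ffact_def)
  then have "foldr (\<lambda>i. partial_deriv i ^^ (\<alpha> $ i)) (sorted_list_of_set UNIV) g z =
    taylor_deriv (Poly_Mapping.lookup q) (Poly_Mapping.keys q) z (\<lambda>i. \<alpha> $ i) z"
    by (simp add: foldr_partial_deriv_taylor_deriv)
  also have "\<dots> = Poly_Mapping.lookup q \<alpha> * (\<Prod>i\<in>UNIV. fact (\<alpha> $ i))"
    by (rule taylor_deriv_center) (simp_all add: in_keys_iff)
  finally show ?thesis by (simp add: apply_D_def)
qed

lemma coeff_const_mult: "coeff ([:c:] * p) k = c * coeff p k"
  by simp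

text \<open>Both sides pair the coefficients of \<open>L\<close> with the Taylor coefficients of
  \<open>g\<close>: along the curve, the monomial of index \<alpha> contributes its coefficient of
  order \<open>k\<close>.\<close>

lemma apply_op_curve:
  fixes q :: "'n::{finite,linorder} cpoly"
  assumes g: "\<And>w. g w = poly_eval q (w - z)"
    and L: "\<And>\<alpha>. Poly_Mapping.lookup L \<alpha> = coeff (power_product \<gamma> \<alpha>) k"
  shows "apply_op L g z = coeff (cev \<gamma> q) k"
proof -
  let ?f = "\<lambda>\<alpha>. Poly_Mapping.lookup L \<alpha> * Poly_Mapping.lookup q \<alpha>"
  let ?S = "Poly_Mapping.keys L \<union> Poly_Mapping.keys q"
  have "apply_op L g z = sum ?f (Poly_Mapping.keys L)"
    by (simp add: apply_op_def apply_D_translated[OF g])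
  also have "\<dots> = sum ?f ?S"
    by (rule sum.mono_neutral_left) (auto simp: in_keys_iff)
  also have "\<dots> = sum ?f (Poly_Mapping.keys q)"
    by (rule sum.mono_neutral_right) (auto simp: in_keys_iff)
  also have "\<dots> = coeff (cev \<gamma> q) k"
    unfolding peval_def coeff_sum coeff_const_mult L by (simp add: mult.commute)
  finally show ?thesis .
qed

text \<open>The displacement from \<open>z\<close> in rotated coordinates. It stops below order
  \<open>m\<close> because at stage \<open>m\<close> only the vectors before \<open>a m\<close> are
  known; the coefficient of order \<open>m\<close> of the system along it is what
  \<open>P_op\<close> computes before \<open>a m\<close> is chosen.\<close>

definition zcurve :: "(nat \<Rightarrow> 'n cvec) \<Rightarrow> nat \<Rightarrow> 'n::{finite,linorder} \<Rightarrow> complex poly" where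
  "zcurve a m j = (if j = first_index then [:0, 1:] else \<Sum>i\<in>{2..<m}. monom (a i $ j) i)"

definition xcurve ::
    "'n cmat \<Rightarrow> 'n cvec \<Rightarrow> (nat \<Rightarrow> 'n cvec) \<Rightarrow> nat \<Rightarrow> 'n::{finite,linorder} \<Rightarrow> complex poly" where
  "xcurve R z a m i = (\<Sum>j\<in>UNIV. [:R $ i $ j:] * ([:z $ j:] + zcurve a m j))"

lemma apply_op_system_xcurve:
  assumes L: "\<And>\<alpha>. Poly_Mapping.lookup L \<alpha> = coeff (power_product (zcurve a m) \<alpha>) k"
  shows "apply_op_system L (\<lambda>w. system_map F (R *v w)) z = (\<chi> i. coeff (cev (xcurve R z a m) (F i)) k)"
proof -
  let ?X = "\<lambda>i. \<Sum>j\<in>UNIV. const_poly (R $ i $ j) * (const_poly (z $ j) + var j)"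
  have "apply_op L (\<lambda>w. system_map F (R *v w) $ i) z = coeff (cev (zcurve a m) (peval const_poly ?X (F i))) k" for i
  proof (rule apply_op_curve[OF _ L])
    fix w
    have "poly_eval (peval const_poly ?X (F i)) (w - z) = peval (\<lambda>c. c) (\<lambda>i. (R *v w) $ i) (F i)"
      unfolding poly_eval_peval peval_peval_const[OF ev_id.coeff_hom_axioms]
      by (simp add: ev_id.peval_sum ev_id.peval_mult ev_id.peval_add matrix_vector_mult_def)
    then show "system_map F (R *v w) $ i = poly_eval (peval const_poly ?X (F i)) (w - z)"
      by (simp add: system_map_def poly_eval_peval)
  qed
  moreover have "cev (zcurve a m) (peval const_poly ?X (F i)) = cev (xcurve R z a m) (F i)" for i
    unfolding peval_peval_const[OF ev_curve.coeff_hom_axioms]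
    by (simp only: ev_curve.peval_sum ev_curve.peval_mult ev_curve.peval_add ev_curve.peval_const
        ev_curve.peval_var xcurve_def[abs_def])
  ultimately show ?thesis by (simp add: apply_op_system_def)
qed

lemma first_index_le [simp]: "first_index \<le> (i :: 'n::{finite,linorder})"
  by (simp add: first_index_def)

lemma axis_split: "\<alpha> $ j > 0 \<Longrightarrow> (\<alpha> - axis j 1) + axis j 1 = (\<alpha> :: 'n::finite multi_index)"
  by (auto simp: vec_eq_iff axis_def)

lemma axis_diff_eq_0: "\<alpha> $ j > 0 \<Longrightarrow> \<alpha> - axis j 1 = 0 \<longleftrightarrow> axis j 1 = (\<alpha> :: 'n::finite multi_index)"
proof
  assume "\<alpha> $ j > 0" "\<alpha> - axis j 1 = 0"
  then show "axis j 1 = \<alpha>" using axis_split[of \<alpha> j] by (simp only: add_0)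
qed (auto simp: vec_eq_iff)

lemma coeff_power_product_zcurve_0: "coeff (power_product (zcurve a m) \<alpha>) 0 = (if \<alpha> = 0 then 1 else 0)"
proof -
  have "poly (zcurve a m j) 0 = 0" for j
    by (auto simp: zcurve_def poly_0_coeff_0 coeff_sum)
  then have "poly (power_product (zcurve a m) \<alpha>) 0 = (\<Prod>i\<in>UNIV. 0 ^ (\<alpha> $ i))"
    by (simp add: power_product_def poly_prod)
  also have "\<dots> = (if \<alpha> = 0 then 1 else 0)"
  proof (cases "\<alpha> = 0")
    case False
    then obtain i where "\<alpha> $ i \<noteq> 0" by (auto simp: vec_eq_iff)
    then have "(0::complex) ^ (\<alpha> $ i) = 0" by simp
    then show ?thesis using False by (auto intro!: prod_zero simp del: power_eq_0_iff)
  qed simp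
  finally show ?thesis by (simp add: poly_0_coeff_0)
qed

lemma coeff_power_product_zcurve_rec:
  assumes j: "\<alpha> $ j > 0" and k: "k \<ge> 1"
  shows "coeff (power_product (zcurve a m) \<alpha>) k = (if j = first_index
    then coeff (power_product (zcurve a m) (\<alpha> - axis j 1)) (k - 1)
    else \<Sum>i\<in>{2..<m}. if i \<le> k then a i $ j * coeff (power_product (zcurve a m) (\<alpha> - axis j 1)) (k - i) else 0)"
proof -
  have "power_product (zcurve a m) \<alpha> = zcurve a m j * power_product (zcurve a m) (\<alpha> - axis j 1)"
    using power_product_add[of "zcurve a m" "\<alpha> - axis j 1" "axis j 1"] axis_split[of \<alpha> j] j
    by (simp add: power_product_axis mult.commute)
  moreover have "coeff ([:0, 1:] * p) k = coeff p (k - 1)" for p :: "complex poly"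
    using k by (cases k) simp_all
  ultimately show ?thesis
    unfolding zcurve_def[of a m j]
    by (cases "j = first_index") (auto simp: sum_distrib_right coeff_sum coeff_monom_mult intro!: sum.cong)
qed

lemma lookup_Psi:
  "Poly_Mapping.lookup (Psi j L) \<alpha> = (if \<alpha> $ j > 0 then Poly_Mapping.lookup L (\<alpha> - axis j 1) else 0)"
proof -
  have "Poly_Mapping.lookup (Psi j L) \<alpha> =
    (\<Sum>\<beta>\<in>Poly_Mapping.keys L. if \<beta> + axis j 1 = \<alpha> then Poly_Mapping.lookup L \<beta> else 0)"
    by (simp add: Psi_def lookup_sum lookup_single when_def)
  also have "\<dots> = (if \<alpha> $ j > 0 then Poly_Mapping.lookup L (\<alpha> - axis j 1) else 0)"
  proof (cases "\<alpha> $ j > 0")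
    case True
    then have "\<beta> + axis j 1 = \<alpha> \<longleftrightarrow> \<beta> = \<alpha> - axis j 1" for \<beta>
      using axis_split[OF True] by (metis add_right_cancel)
    then show ?thesis using True by (simp add: in_keys_iff)
  next
    case False
    then have "\<beta> + axis j 1 \<noteq> \<alpha>" for \<beta> by (auto simp: vec_eq_iff axis_def)
    then show ?thesis using False by simp
  qed
  finally show ?thesis .
qed

lemma lookup_part_vanishing_below:
  "Poly_Mapping.lookup (part_vanishing_below j L) \<alpha> = (if \<forall>i<j. \<alpha> $ i = 0 then Poly_Mapping.lookup L \<alpha> else 0)"
proof -
  have "Poly_Mapping.lookup (part_vanishing_below j L) \<alpha> =
    (\<Sum>\<beta>\<in>{\<beta> \<in> Poly_Mapping.keys L. \<forall>i<j. \<beta> $ i = 0}. if \<beta> = \<alpha> then Poly_Mapping.lookup L \<alpha> else 0)"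
    unfolding part_vanishing_below_def lookup_sum by (rule sum.cong) (auto simp: lookup_single when_def)
  then show ?thesis by (auto simp: in_keys_iff)
qed

lemma lookup_op_scale: "Poly_Mapping.lookup (op_scale c L) \<alpha> = c * Poly_Mapping.lookup L \<alpha>"
  by (simp add: op_scale_def Poly_Mapping.map.rep_eq when_def)

lemma lookup_P_op_0: "Poly_Mapping.lookup (P_op a L k) 0 = 0"
  by (simp add: P_op_def lookup_add lookup_sum lookup_Psi)

lemma lookup_P_op:
  fixes \<alpha> :: "'n::{finite,linorder} multi_index"
  assumes j: "\<alpha> $ j > 0" "\<forall>i<j. \<alpha> $ i = 0"
  shows "Poly_Mapping.lookup (P_op a L k) \<alpha> = (if j = first_index
    then Poly_Mapping.lookup (L (k - 1)) (\<alpha> - axis j 1)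
    else \<Sum>i\<in>{2..<k}. a i $ j * Poly_Mapping.lookup (L (k - i)) (\<alpha> - axis j 1))"
proof -
  let ?t = "\<lambda>j'. Poly_Mapping.lookup (Psi j' (part_vanishing_below j' (Q_op a L k j'))) \<alpha>"
  have t: "?t j' = (if j' = j then \<Sum>i\<in>{2..<k}. a i $ j * Poly_Mapping.lookup (L (k - i)) (\<alpha> - axis j 1) else 0)" for j'
  proof (cases j' j rule: linorder_cases)
    case less
    then show ?thesis using j by (simp add: lookup_Psi)
  next
    case equal
    then show ?thesis using j
      by (auto simp: lookup_Psi lookup_part_vanishing_below Q_op_def lookup_sum lookup_op_scale)
  next
    case greater
    \<comment> \<open>Lowering the entry at \<open>j'\<close> leaves the positive entry at the
      smaller index \<open>j\<close>, so the restriction to indices vanishing below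
      \<open>j'\<close> discards the term.\<close>
    then have nz: "(\<alpha> - axis j' 1) $ j \<noteq> 0" using j by (simp add: axis_def)
    have n: "\<not> (\<forall>i<j'. (\<alpha> - axis j' 1) $ i = 0)"
    proof
      assume "\<forall>i<j'. (\<alpha> - axis j' 1) $ i = 0"
      then have "j < j' \<longrightarrow> (\<alpha> - axis j' 1) $ j = 0" by (rule spec)
      from nz mp[OF this greater] show False by (rule notE)
    qed
    show ?thesis
      unfolding lookup_Psi lookup_part_vanishing_below if_not_P[OF n] using greater by simp
  qed
  have "Poly_Mapping.lookup (P_op a L k) \<alpha> = Poly_Mapping.lookup (Psi first_index (L (k - 1))) \<alpha> +
    (\<Sum>j'\<in>UNIV - {first_index}. ?t j')"
    by (simp add: P_op_def lookup_add lookup_sum)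
  moreover have "first_index < j" if "j \<noteq> first_index"
    by (rule order_le_neq_trans[OF first_index_le that[symmetric]])
  ultimately show ?thesis
    unfolding t using j by (auto simp: lookup_Psi)
qed

lemma exists_first_nonzero:
  fixes \<alpha> :: "'n::{finite,linorder} multi_index"
  assumes "\<alpha> \<noteq> 0"
  shows "\<exists>j. \<alpha> $ j > 0 \<and> (\<forall>i<j. \<alpha> $ i = 0)"
proof -
  have ne: "{j. \<alpha> $ j > 0} \<noteq> {}" using assms by (auto simp: vec_eq_iff)
  let ?j = "Min {j. \<alpha> $ j > 0}"
  have "?j \<in> {j. \<alpha> $ j > 0}" by (rule Min_in) (use ne in auto)
  moreover have "\<alpha> $ i = 0" if "i < ?j" for i
  proof (rule ccontr)
    assume "\<alpha> $ i \<noteq> 0"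
    then have "?j \<le> i" by (intro Min_le) auto
    with that show False by simp
  qed
  ultimately show ?thesis by blast
qed

text \<open>If \<open>j\<close> is the first index with \<open>\<alpha> $ j > 0\<close>, only the \<open>j\<close>-th summand of \<open>P_op\<close> contributes to
  the coefficient of \<open>D(\<alpha>)\<close>: splitting off one factor of the \<open>j\<close>-th coordinate from the monomial of
  the curve is the recursion that defines \<open>P_op\<close>.\<close>

lemma lookup_P_op_curve:
  assumes IH: "\<And>l \<alpha>. l < k \<Longrightarrow> Poly_Mapping.lookup (L l) \<alpha> = coeff (power_product (zcurve a k) \<alpha>) l" and k: "k \<ge> 2"
  shows "Poly_Mapping.lookup (P_op a L k) \<alpha> = coeff (power_product (zcurve a k) \<alpha>) k"
proof (cases "\<alpha> = 0")
  case True
  then show ?thesis using k by (simp add: lookup_P_op_0)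
next
  case False
  then obtain j where j: "\<alpha> $ j > 0" "\<forall>i<j. \<alpha> $ i = 0" using exists_first_nonzero by blast
  show ?thesis
    using k unfolding lookup_P_op[OF j] coeff_power_product_zcurve_rec[OF j(1) order_trans[OF one_le_numeral k]]
    by (auto simp: IH intro!: sum.cong)
qed

text \<open>The terms that \<open>L k\<close> adds to \<open>P_op\<close> are the linear
  contribution of \<open>a k\<close> in order \<open>k\<close>, visible only in first-order
  operators; the rest is the recursion for the monomials of the curve. The truncation
  \<open>m\<close> is free above \<open>k\<close> because later terms of the curve have higher
  order.\<close>

lemma closed_basis_lookup:
  fixes L :: "nat \<Rightarrow> 'n::{finite,linorder} diff_op"
  assumes B: "numerical_closed_basis H z n a L" and n: "n \<ge> 2"
  shows "k < n \<Longrightarrow> k < m \<Longrightarrow> Poly_Mapping.lookup (L k) \<alpha> = coeff (power_product (zcurve a m) \<alpha>) k"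
proof (induction k arbitrary: m \<alpha> rule: less_induct)
  case (less k)
  consider "k = 0" | "k = 1" | "k \<ge> 2" by linarith
  then show ?case
  proof cases
    case 1
    then show ?thesis
      using B by (auto simp: numerical_closed_basis_def D_op_def coeff_power_product_zcurve_0 lookup_one when_def)
  next
    case 2
    have L1: "Poly_Mapping.lookup (L k) \<alpha> = (if axis first_index 1 = \<alpha> then 1 else 0)"
      using B 2 by (simp add: numerical_closed_basis_def D_op_def lookup_single when_def)
    show ?thesis
    proof (cases "\<alpha> = 0")
      case True
      moreover have "axis first_index 1 \<noteq> (0 :: 'n multi_index)" by (auto simp: vec_eq_iff axis_def)
      ultimately show ?thesis using L1 2 by simp
    next
      case False
      then obtain j where j: "\<alpha> $ j > 0" "\<forall>i<j. \<alpha> $ i = 0" using exists_first_nonzero by blast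
      note axis_diff_eq_0[OF j(1)]
      moreover have "axis first_index 1 = \<alpha> \<Longrightarrow> j = first_index" using j by (auto simp: axis_def split: if_splits)
      ultimately show ?thesis
        unfolding L1 using coeff_power_product_zcurve_rec[of \<alpha> j 1 a m] j 2
        by (auto simp: coeff_power_product_zcurve_0 intro!: sum.neutral)
    qed
  next
    case 3
    have Lk: "L k = P_op a L k + (\<Sum>j\<in>UNIV - {first_index}. op_scale (a k $ j) (D_op (axis j 1)))"
      using B 3 less.prems by (simp add: numerical_closed_basis_def)
    have Lk': "Poly_Mapping.lookup (L k) \<alpha> = Poly_Mapping.lookup (P_op a L k) \<alpha> +
      (\<Sum>j\<in>UNIV - {first_index}. if axis j 1 = \<alpha> then a k $ j else 0)"
      unfolding Lk by (simp add: lookup_add lookup_sum lookup_op_scale D_op_def lookup_single when_def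
         if_distrib[of "\<lambda>x. _ * x"] cong: if_cong)
    show ?thesis
    proof (cases "\<alpha> = 0")
      case True
      then have "axis j (1::nat) \<noteq> \<alpha>" for j by (auto simp: vec_eq_iff axis_def)
      then show ?thesis using True 3 unfolding Lk' by (simp add: lookup_P_op_0)
    next
      case False
      then obtain j where j: "\<alpha> $ j > 0" "\<forall>i<j. \<alpha> $ i = 0" using exists_first_nonzero by blast
      note ax = axis_diff_eq_0[OF j(1), unfolded One_nat_def]
      have ax': "axis j' 1 = \<alpha> \<longleftrightarrow> j' = j \<and> axis j 1 = \<alpha>" for j'
        using j(1) by (auto simp: axis_def split: if_splits)
      have s: "(\<Sum>j'\<in>UNIV - {first_index}. if axis j' 1 = \<alpha> then a k $ j' else 0) =
        (if j \<noteq> first_index \<and> axis j 1 = \<alpha> then a k $ j else 0)"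
        by (subst ax') (auto simp: if_distrib intro!: sum.neutral)
      have k1: "k \<ge> 1" using 3 by simp
      show ?thesis
      proof (cases "j = first_index")
        case True
        then show ?thesis
          unfolding Lk' s lookup_P_op[OF j] coeff_power_product_zcurve_rec[OF j(1) k1]
          using less.IH[of "k - 1" m] less.prems 3 by simp
      next
        case False
        \<comment> \<open>In the recursion for the curve the indices above \<open>k\<close> drop
          out, and \<open>i = k\<close> survives only if no factor is left in the monomial. What
          remains is the sum that occurs in \<open>P_op\<close>.\<close>
        have "(\<Sum>i\<in>{2..<m}. if i \<le> k then a i $ j * coeff (power_product (zcurve a m) (\<alpha> - axis j 1)) (k - i) else 0) =
          (\<Sum>i\<in>{2..<Suc k}. a i $ j * coeff (power_product (zcurve a m) (\<alpha> - axis j 1)) (k - i))"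
          using less.prems by (intro sum.mono_neutral_cong_right) auto
        also have "\<dots> = (\<Sum>i\<in>{2..<k}. a i $ j * coeff (power_product (zcurve a m) (\<alpha> - axis j 1)) (k - i)) +
          a k $ j * (if axis j 1 = \<alpha> then 1 else 0)"
          using 3 by (simp add: coeff_power_product_zcurve_0 ax)
        also have "(\<Sum>i\<in>{2..<k}. a i $ j * coeff (power_product (zcurve a m) (\<alpha> - axis j 1)) (k - i)) =
          (\<Sum>i\<in>{2..<k}. a i $ j * Poly_Mapping.lookup (L (k - i)) (\<alpha> - axis j 1))"
        proof (rule sum.cong)
          fix i assume "i \<in> {2..<k}"
          then show "a i $ j * coeff (power_product (zcurve a m) (\<alpha> - axis j 1)) (k - i) =
            a i $ j * Poly_Mapping.lookup (L (k - i)) (\<alpha> - axis j 1)"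
            using less.IH[of "k - i" m] less.prems by simp
        qed simp
        finally show ?thesis
          unfolding Lk' s lookup_P_op[OF j] coeff_power_product_zcurve_rec[OF j(1) k1] using False by simp
      qed
    qed
  qed
qed

lemma closed_basis_P_lookup:
  assumes "numerical_closed_basis H z n a L" "2 \<le> k" "k \<le> n"
  shows "Poly_Mapping.lookup (P_op a L k) \<alpha> = coeff (power_product (zcurve a k) \<alpha>) k"
  using assms by (intro lookup_P_op_curve closed_basis_lookup[OF assms(1)]) auto

section \<open>Estimates for families of vectors, matrices and polynomial values\<close>

lemma bigO_matrix_vector:
  fixes A :: "'p \<Rightarrow> 'n::finite cmat"
  assumes "bigO G e A" "bigO G f u"
  shows "bigO G (\<lambda>p. e p * f p) (\<lambda>p. A p *v u p)"
  unfolding bigO_vec_iff matrix_vector_mult_def vec_lambda_beta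
  by (intro allI bigO_sum bigO_mult) (use assms in \<open>simp_all add: bigO_vec_iff\<close>)

lemma bigO_cmult:
  fixes u :: "'p \<Rightarrow> 'n::finite cvec"
  assumes "bigO G e c" "bigO G f u"
  shows "bigO G (\<lambda>p. e p * f p) (\<lambda>p. c p *s u p)"
  by (rule bigO_bilinear[OF assms]) (simp add: norm_cmult_vec)

lemma bigO_cdot:
  assumes "bigO G e u" "bigO G f v"
  shows "bigO G (\<lambda>p. e p * f p) (\<lambda>p. cdot (u p) (v p))"
  by (rule bigO_bilinear[OF assms norm_cdot_le])

lemmas bigO_matrix_vector_1 =
  bigO_matrix_vector[where f = "\<lambda>_. 1", simplified] bigO_matrix_vector[where e = "\<lambda>_. 1", simplified]
lemmas bigO_cmult_1 = bigO_cmult[where f = "\<lambda>_. 1", simplified] bigO_cmult[where e = "\<lambda>_. 1", simplified]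
lemmas bigO_cdot_1 = bigO_cdot[where f = "\<lambda>_. 1", simplified] bigO_cdot[where e = "\<lambda>_. 1", simplified]

lemma bigO_of_norm_le: "\<forall>\<^sub>F p in G. norm (u p) \<le> C \<Longrightarrow> bigO G (\<lambda>_. 1) u"
  by (rule bigOI[where C = C]) simp

lemma bigO_eventually_small:
  assumes "bigO G e u" "(e \<longlongrightarrow> 0) G" "b > 0"
  shows "\<forall>\<^sub>F p in G. norm (u p) \<le> b"
proof -
  obtain C where C: "C > 0" "\<forall>\<^sub>F p in G. norm (u p) \<le> C * \<bar>e p\<bar>" by (rule bigOE[OF assms(1)])
  have "\<forall>\<^sub>F p in G. \<bar>e p\<bar> < b / C"
    using tendstoD[OF assms(2), of "b / C"] C assms(3) by (simp add: dist_norm)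
  with C(2) show ?thesis
    by eventually_elim (use C(1) in \<open>simp add: field_simps\<close>)
qed

lemma bigO_inverse:
  fixes u :: "'p \<Rightarrow> complex"
  assumes "b > 0" "\<forall>\<^sub>F p in G. b \<le> norm (u p)"
  shows "bigO G (\<lambda>_. 1) (\<lambda>p. inverse (u p))"
  by (rule bigO_of_norm_le[where C = "inverse b"], rule eventually_mono[OF assms(2)])
    (use assms(1) in \<open>simp add: norm_inverse le_imp_inverse_le\<close>)

text \<open>The quadratic remainder is expanded around the moving point \<open>w\<close>, as a
  Newton step requires: its Jacobian is taken at the approximation, not at the root. The five bounds
  share one induction because the product rule mixes them.\<close>

lemma poly_eval_perturbation:
  fixes u w :: "'p \<Rightarrow> 'n::finite cvec"
  assumes u: "bigO G (\<lambda>_. 1) u" and e: "bigO G (\<lambda>_. 1) e" and w: "bigO G e (\<lambda>p. w p - u p)"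
  shows "bigO G (\<lambda>_. 1) (\<lambda>p. poly_eval q (u p))" "bigO G (\<lambda>_. 1) (\<lambda>p. grad q (u p))"
    "bigO G e (\<lambda>p. poly_eval q (w p) - poly_eval q (u p))"
    "bigO G e (\<lambda>p. grad q (w p) - grad q (u p))"
    "bigO G (\<lambda>p. e p * e p) (\<lambda>p. poly_eval q (u p) - poly_eval q (w p) - (\<Sum>j\<in>UNIV. grad q (w p) $ j * (u p - w p) $ j))"
proof -
  define L where "L q p = (\<Sum>j\<in>UNIV. grad q (w p) $ j * (u p - w p) $ j)" for q p
  let ?P = "\<lambda>q. bigO G (\<lambda>_. 1) (\<lambda>p. poly_eval q (u p)) \<and> bigO G (\<lambda>_. 1) (\<lambda>p. grad q (u p)) \<and>
    bigO G e (\<lambda>p. poly_eval q (w p) - poly_eval q (u p)) \<and>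
    bigO G e (\<lambda>p. grad q (w p) - grad q (u p)) \<and>
    bigO G (\<lambda>p. e p * e p) (\<lambda>p. poly_eval q (u p) - poly_eval q (w p) - L q p)"
  have "?P q"
  proof (induction q rule: cpoly_induct)
    case (const c)
    show ?case by (simp add: poly_eval_simps L_def)
  next
    case (var i)
    have "L (var i) p = u p $ i - w p $ i" for p
      by (simp add: L_def grad_var axis_def if_distrib[of "\<lambda>x. x * _"] cong: if_cong)
    then show ?case using u w by (simp add: poly_eval_simps grad_var bigO_vec_iff)
  next
    case (add a b)
    have La: "L (a + b) p = L a p + L b p" for p
      by (simp add: L_def grad_add distrib_right sum.distrib)
    note a = add(1)[THEN conjunct1] add(1)[THEN conjunct2, THEN conjunct1]
      add(1)[THEN conjunct2, THEN conjunct2, THEN conjunct1]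
      add(1)[THEN conjunct2, THEN conjunct2, THEN conjunct2, THEN conjunct1]
      add(1)[THEN conjunct2, THEN conjunct2, THEN conjunct2, THEN conjunct2]
    note b = add(2)[THEN conjunct1] add(2)[THEN conjunct2, THEN conjunct1]
      add(2)[THEN conjunct2, THEN conjunct2, THEN conjunct1]
      add(2)[THEN conjunct2, THEN conjunct2, THEN conjunct2, THEN conjunct1]
      add(2)[THEN conjunct2, THEN conjunct2, THEN conjunct2, THEN conjunct2]
    note bigO_add[OF a(1) b(1)] bigO_add[OF a(2) b(2)] bigO_add[OF a(3) b(3)]
      bigO_add[OF a(4) b(4)] bigO_add[OF a(5) b(5)]
    then show ?case
      unfolding poly_eval_simps grad_add La by (simp add: algebra_simps)
  next
    case (mult a b)
    note a = mult(1)[THEN conjunct1] mult(1)[THEN conjunct2, THEN conjunct1]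
      mult(1)[THEN conjunct2, THEN conjunct2, THEN conjunct1]
      mult(1)[THEN conjunct2, THEN conjunct2, THEN conjunct2, THEN conjunct1]
      mult(1)[THEN conjunct2, THEN conjunct2, THEN conjunct2, THEN conjunct2]
    note b = mult(2)[THEN conjunct1] mult(2)[THEN conjunct2, THEN conjunct1]
      mult(2)[THEN conjunct2, THEN conjunct2, THEN conjunct1]
      mult(2)[THEN conjunct2, THEN conjunct2, THEN conjunct2, THEN conjunct1]
      mult(2)[THEN conjunct2, THEN conjunct2, THEN conjunct2, THEN conjunct2]
    have W: "bigO G (\<lambda>_. 1) (\<lambda>p. poly_eval q (w p))" "bigO G (\<lambda>_. 1) (\<lambda>p. grad q (w p))" if P: "?P q" for q
    proof -
      note q = P[THEN conjunct1] P[THEN conjunct2, THEN conjunct1]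
      P[THEN conjunct2, THEN conjunct2, THEN conjunct1]
      P[THEN conjunct2, THEN conjunct2, THEN conjunct2, THEN conjunct1]
      P[THEN conjunct2, THEN conjunct2, THEN conjunct2, THEN conjunct2]
      have "bigO G (\<lambda>_. 1) (\<lambda>p. (poly_eval q (w p) - poly_eval q (u p)) + poly_eval q (u p))"
        by (rule bigO_add[OF bigO_mono[OF q(3) e] q(1)])
      moreover have "bigO G (\<lambda>_. 1) (\<lambda>p. (grad q (w p) - grad q (u p)) + grad q (u p))"
        by (rule bigO_add[OF bigO_mono[OF q(4) e] q(2)])
      ultimately show "bigO G (\<lambda>_. 1) (\<lambda>p. poly_eval q (w p))" "bigO G (\<lambda>_. 1) (\<lambda>p. grad q (w p))" by simp_all
    qed
    have La: "L (a * b) p = poly_eval b (w p) * L a p + poly_eval a (w p) * L b p" for p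
      unfolding L_def sum_distrib_left sum.distrib[symmetric]
      by (rule sum.cong) (simp_all add: grad_mult algebra_simps)
    have 1: "bigO G e (\<lambda>p. poly_eval (a * b) (w p) - poly_eval (a * b) (u p))"
    proof -
      have "bigO G e (\<lambda>p. (poly_eval a (w p) - poly_eval a (u p)) * poly_eval b (w p) +
         poly_eval a (u p) * (poly_eval b (w p) - poly_eval b (u p)))"
        by (intro bigO_add bigO_mult_1(1)[OF a(3) W(1)[OF mult(2)]] bigO_mult_1(2)[OF a(1) b(3)])
      then show ?thesis by (simp add: poly_eval_simps algebra_simps)
    qed
    have 2: "bigO G (\<lambda>p. e p * e p) (\<lambda>p. poly_eval (a * b) (u p) - poly_eval (a * b) (w p) - L (a * b) p)"
    proof -
      have "bigO G (\<lambda>p. e p * e p) (\<lambda>p. (poly_eval a (u p) - poly_eval a (w p) - L a p) * poly_eval b (w p) +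
        poly_eval a (w p) * (poly_eval b (u p) - poly_eval b (w p) - L b p) +
        (poly_eval a (w p) - poly_eval a (u p)) * (poly_eval b (w p) - poly_eval b (u p)))"
        by (intro bigO_add bigO_mult_1(1)[OF a(5) W(1)[OF mult(2)]] bigO_mult_1(2)[OF W(1)[OF mult(1)] b(5)]
          bigO_mult[OF a(3) b(3)])
      then show ?thesis unfolding La by (simp add: poly_eval_simps algebra_simps)
    qed
    have 3: "bigO G e (\<lambda>p. grad (a * b) (w p) - grad (a * b) (u p))"
    proof -
      have "grad (a * b) (w p) - grad (a * b) (u p) =
        ((poly_eval b (w p) - poly_eval b (u p)) *s grad a (w p) + poly_eval b (u p) *s (grad a (w p) - grad a (u p))) +
        ((poly_eval a (w p) - poly_eval a (u p)) *s grad b (w p) + poly_eval a (u p) *s (grad b (w p) - grad b (u p)))" for p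
        by (simp add: grad_mult vec_eq_iff algebra_simps)
      moreover have "bigO G e (\<lambda>p. ((poly_eval b (w p) - poly_eval b (u p)) *s grad a (w p) + poly_eval b (u p) *s (grad a (w p) - grad a (u p))) +
        ((poly_eval a (w p) - poly_eval a (u p)) *s grad b (w p) + poly_eval a (u p) *s (grad b (w p) - grad b (u p))))"
        by (intro bigO_add bigO_cmult_1(1)[OF b(3) W(2)[OF mult(1)]] bigO_cmult_1(2)[OF b(1) a(4)]
          bigO_cmult_1(1)[OF a(3) W(2)[OF mult(2)]] bigO_cmult_1(2)[OF a(1) b(4)])
      ultimately show ?thesis by simp
    qed
    have 4: "bigO G (\<lambda>_. 1) (\<lambda>p. poly_eval (a * b) (u p))" "bigO G (\<lambda>_. 1) (\<lambda>p. grad (a * b) (u p))"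
      unfolding poly_eval_simps grad_mult
      by (intro bigO_mult_1(1)[OF a(1) b(1)] bigO_add bigO_cmult_1(1)[OF b(1) a(2)] bigO_cmult_1(1)[OF a(1) b(2)])+
    show ?case by (intro conjI 1 2 3 4)
  qed
  then show "bigO G (\<lambda>_. 1) (\<lambda>p. poly_eval q (u p))" "bigO G (\<lambda>_. 1) (\<lambda>p. grad q (u p))"
    "bigO G e (\<lambda>p. poly_eval q (w p) - poly_eval q (u p))"
    "bigO G e (\<lambda>p. grad q (w p) - grad q (u p))"
    "bigO G (\<lambda>p. e p * e p) (\<lambda>p. poly_eval q (u p) - poly_eval q (w p) - (\<Sum>j\<in>UNIV. grad q (w p) $ j * (u p - w p) $ j))"
    unfolding L_def by blast+
qed

text \<open>The functional \<open>f\<close> controls what \<open>A\<close> does not. A test vector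
  \<open>g\<close> of small image forces the minimiser \<open>v\<close> to have small image too,
  hence \<open>f\<close> is bounded away from zero on \<open>v\<close>. The combination of
  \<open>g\<close> and \<open>v\<close> annihilated by \<open>f\<close> is then controlled by its
  image alone. Applied with \<open>f\<close> the product with the kernel vector and with
  \<open>f\<close> the first entry.\<close>

lemma min_direction_alignment:
  fixes A :: "'p \<Rightarrow> 'n::finite cmat"
  assumes nd: "\<forall>\<^sub>F p in G. \<forall>h. norm h \<le> K * (norm (A p *v h) + norm (f p h :: complex))"
    and lin: "\<And>p u v c. f p (u - c *s v) = f p u - c * f p v"
    and v: "\<forall>\<^sub>F p in G. min_direction (A p) (v p)"
    and Ag: "bigO G \<eta> (\<lambda>p. A p *v g p)" and eta: "(\<eta> \<longlongrightarrow> 0) G"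
    and g: "b > 0" "\<forall>\<^sub>F p in G. b \<le> norm (g p)" and fg: "bigO G (\<lambda>_. 1) (\<lambda>p. f p (g p))"
  shows "bigO G \<eta> (\<lambda>p. A p *v v p)"
    and "\<exists>b>0. \<forall>\<^sub>F p in G. b \<le> norm (f p (v p))"
    and "bigO G \<eta> (\<lambda>p. g p - (f p (g p) / f p (v p)) *s v p)"
proof -
  show Av: "bigO G \<eta> (\<lambda>p. A p *v v p)"
  proof (rule bigO_le[OF Ag, where K = "1 / b"])
    show "\<forall>\<^sub>F p in G. norm (A p *v v p) \<le> 1 / b * norm (A p *v g p)"
      using v g(2)
    proof eventually_elim
      case (elim p)
      have "norm (A p *v v p) * b \<le> norm (A p *v v p) * norm (g p)" using elim(2) by (intro mult_left_mono) auto
      also have "\<dots> \<le> norm (A p *v g p)" using elim(1) by (simp add: min_direction_def)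
      finally show ?case using g(1) by (simp add: field_simps)
    qed
  qed
  define K' where "K' = max K 1"
  have K': "K' > 0" by (simp add: K'_def)
  have nd': "\<forall>\<^sub>F p in G. \<forall>h. norm h \<le> K' * (norm (A p *v h) + norm (f p h))"
    using nd
  proof eventually_elim
    case (elim p)
    show ?case
    proof
      fix h
      have "norm h \<le> K * (norm (A p *v h) + norm (f p h))" using elim by blast
      also have "\<dots> \<le> K' * (norm (A p *v h) + norm (f p h))"
        by (intro mult_right_mono) (auto simp: K'_def)
      finally show "norm h \<le> K' * (norm (A p *v h) + norm (f p h))" .
    qed
  qed
  have "\<forall>\<^sub>F p in G. norm (A p *v v p) \<le> 1 / (2 * K')"
    using K' by (intro bigO_eventually_small[OF Av eta]) simp
  with nd' v have fv: "\<forall>\<^sub>F p in G. 1 / (2 * K') \<le> norm (f p (v p))"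
  proof eventually_elim
    case (elim p)
    have "1 \<le> K' * (norm (A p *v v p) + norm (f p (v p)))"
      using elim(1)[rule_format, of "v p"] elim(2) by (simp add: min_direction_def)
    moreover have "K' * norm (A p *v v p) \<le> 1 / 2"
      using elim(3) K' by (simp add: field_simps)
    ultimately have "1 / 2 \<le> K' * norm (f p (v p))" by (simp add: distrib_left)
    then show ?case using K' by (simp add: field_simps)
  qed
  then show "\<exists>b>0. \<forall>\<^sub>F p in G. b \<le> norm (f p (v p))"
    using K' by (intro exI[of _ "1 / (2 * K')"]) simp
  let ?l = "\<lambda>p. f p (g p) / f p (v p)"
  have l: "bigO G (\<lambda>_. 1) ?l"
    unfolding divide_inverse using K' by (intro bigO_mult_1 fg bigO_inverse[OF _ fv]) simp
  have "bigO G \<eta> (\<lambda>p. A p *v g p - ?l p *s (A p *v v p))"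
    by (intro bigO_diff Ag bigO_cmult_1 l Av)
  then show "bigO G \<eta> (\<lambda>p. g p - ?l p *s v p)"
  proof (rule bigO_le[where K = K'])
    show "\<forall>\<^sub>F p in G. norm (g p - ?l p *s v p) \<le> K' * norm (A p *v g p - ?l p *s (A p *v v p))"
      using nd' fv
    proof eventually_elim
      case (elim p)
      have "f p (v p) \<noteq> 0" using elim(2) K' by (auto simp: field_simps)
      then have "f p (g p - ?l p *s v p) = 0" by (simp add: lin)
      then show ?case
        using elim(1)[rule_format, of "g p - ?l p *s v p"]
        by (simp add: matrix_vector_mult_diff_distrib vector_scalar_commute)
    qed
  qed
qed

text \<open>As \<open>c\<close> is outside the range and the kernel of \<open>A\<close> is spanned
  by \<open>r\<close>, the pair \<open>\<alpha> *s c + A *v u\<close> and \<open>cdot u r\<close>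
  determines \<alpha> and \<open>u\<close>; an injective linear map in finite dimension is bounded
  below.\<close>

lemma bordered_full_rank_bound:
  fixes A :: "'n::finite cmat"
  assumes ker: "\<And>u. A *v u = 0 \<Longrightarrow> \<exists>t. u = t *s r" and r: "r \<noteq> 0" and c: "\<And>u. c \<noteq> A *v u"
  obtains K where "K > 0" "\<And>\<alpha> u. norm \<alpha> + norm u \<le> K * (norm (\<alpha> *s c + A *v u) + norm (cdot u r))"
proof -
  define f where "f = (\<lambda>y :: complex \<times> 'n cvec. (fst y *s c + A *v snd y, cdot (snd y) r))"
  have "linear f"
    unfolding f_def
    by (rule linearI)
      (simp_all add: matrix_vector_right_distrib cdot_simps vector_sadd_rdistrib scaleR_cvec
        scaleR_conv_of_real[where 'a = complex] vector_add_ldistrib vector_smult_assoc vector_scalar_commute)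
  moreover have "inj f"
  proof (subst linear_injective_0[OF \<open>linear f\<close>], safe)
    fix \<alpha> u assume "f (\<alpha>, u) = 0"
    then have 1: "\<alpha> *s c + A *v u = 0" and 2: "cdot u r = 0" by (simp_all add: f_def zero_prod_def)
    have "\<alpha> = 0"
    proof (rule ccontr)
      assume n: "\<alpha> \<noteq> 0"
      have "c = inverse \<alpha> *s (\<alpha> *s c)" using n by (simp add: vector_smult_assoc)
      also have "\<alpha> *s c = - (A *v u)" using 1 by (simp only: eq_neg_iff_add_eq_0)
      also have "inverse \<alpha> *s \<dots> = A *v (- inverse \<alpha> *s u)"
        unfolding vector_scalar_commute by (simp add: vec_eq_iff)
      finally show False using c by blast
    qed
    then have "A *v u = 0" using 1 by simp
    then obtain t where t: "u = t *s r" using ker by blast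
    then have "t * of_real ((norm r)\<^sup>2) = 0" using 2 by (simp add: cdot_simps cdot_self)
    then have "u = 0" using r t by simp
    then show "(\<alpha>, u) = 0" using \<open>\<alpha> = 0\<close> by (simp add: zero_prod_def)
  qed
  ultimately obtain B where B: "B > 0" "\<And>y. B * norm y \<le> norm (f y)"
    by (rule linear_inj_bounded_below_pos) blast
  have "norm \<alpha> + norm u \<le> (2 / B) * (norm (\<alpha> *s c + A *v u) + norm (cdot u r))" for \<alpha> u
  proof -
    have "norm \<alpha> + norm u \<le> 2 * norm (\<alpha>, u)"
      using norm_fst_le[of \<alpha> u] norm_snd_le[of u \<alpha>] by simp
    also have "norm (\<alpha>, u) \<le> norm (f (\<alpha>, u)) / B" using B by (simp add: field_simps)
    also have "norm (f (\<alpha>, u)) \<le> norm (\<alpha> *s c + A *v u) + norm (cdot u r)"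
      unfolding f_def by (simp add: norm_Pair_le)
    finally show ?thesis using B(1) by (simp add: divide_right_mono)
  qed
  then show ?thesis using that[of "2 / B"] B(1) by simp
qed

section \<open>The regularised Newton step\<close>

lemma norm_matrix_vector_le:
  fixes A :: "'n::finite cmat"
  shows "norm (A *v u) \<le> real CARD('n) * norm A * norm u"
proof -
  have "norm ((A *v u) $ i) \<le> norm A * norm u" for i
  proof -
    have "(A *v u) $ i = cdot u (\<chi> j. cnj (A $ i $ j))"
      by (simp add: matrix_vector_mult_def cdot_def mult.commute)
    then have "norm ((A *v u) $ i) \<le> norm u * norm (\<chi> j. cnj (A $ i $ j))"
      using norm_cdot_le[of u "\<chi> j. cnj (A $ i $ j)"] by simp
    also have "norm (\<chi> j. cnj (A $ i $ j)) = norm (A $ i)" by (simp add: norm_vec_def)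
    also have "norm u * norm (A $ i) \<le> norm u * norm A"
      by (intro mult_left_mono Finite_Cartesian_Product.norm_nth_le) simp
    finally show ?thesis by (simp add: mult.commute)
  qed
  then have "(\<Sum>i\<in>UNIV. norm ((A *v u) $ i)) \<le> (\<Sum>i\<in>(UNIV::'n set). norm A * norm u)"
    by (intro sum_mono) simp
  moreover have "norm (A *v u) \<le> (\<Sum>i\<in>UNIV. norm ((A *v u) $ i))"
    unfolding norm_vec_def[of "A *v u"] by (rule L2_set_le_sum) simp
  ultimately show ?thesis by (simp add: mult.assoc)
qed

lemma matrix_vector_sub_rdistrib: "(A - B) *v u = A *v u - B *v (u :: 'n::finite cvec)"
  by (simp add: matrix_vector_mult_def vec_eq_iff left_diff_distrib sum_subtractf)

lemma mat_scalar_mult: "mat c *v y = c *s (y :: 'n::finite cvec)"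
  by (simp add: matrix_vector_mult_def mat_def vec_eq_iff if_distrib[of "\<lambda>x. x * _"] cong: if_cong)

text \<open>Data depending on a parameter \<open>p\<close>, with error scale \<open>eps\<close>
  tending to zero along \<open>G\<close>, near one fixed root. Of \<open>c\<close> only its position
  outside the range is recorded; it will be the leading coefficient along the contact curve.\<close>

locale root_family =
  fixes G :: "'p filter" and eps :: "'p \<Rightarrow> real" and F :: "'n::{finite,linorder} \<Rightarrow> 'n cpoly"
    and x_e r c :: "'n cvec"
  assumes eps_lim: "(eps \<longlongrightarrow> 0) G"
    and root: "system_map F x_e = 0" and kernel: "jac F x_e *v r = 0" "r \<noteq> 0"
    and kernel_one: "\<And>u. jac F x_e *v u = 0 \<Longrightarrow> \<exists>t. u = t *s r"
    and not_range: "\<And>u. c \<noteq> jac F x_e *v u"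
begin

abbreviation "eps2 \<equiv> \<lambda>p. eps p * eps p"

lemma eps_1: "bigO G (\<lambda>_. 1) eps"
proof (rule bigO_of_norm_le[where C = 1])
  have "\<forall>\<^sub>F p in G. dist (eps p) 0 < 1" by (rule tendstoD[OF eps_lim]) simp
  then show "\<forall>\<^sub>F p in G. norm (eps p) \<le> 1" by eventually_elim simp
qed

lemma eps_self: "bigO G eps eps"
  by (rule bigOI[where C = 1]) simp

lemma eps2_eps: "bigO G eps eps2"
  using bigO_mult_1(1)[OF eps_self eps_1] .

lemma eps2_1: "bigO G (\<lambda>_. 1) eps2"
  using bigO_mono[OF eps2_eps eps_1] .

lemma eps2_lim: "(eps2 \<longlongrightarrow> 0) G"
  using tendsto_mult[OF eps_lim eps_lim] by simp

lemma uniform_full_rank: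
  assumes A: "bigO G eps (\<lambda>p. A p - jac F x_e)"
  obtains K where "K > 0" "\<forall>\<^sub>F p in G. \<forall>\<alpha> u. norm \<alpha> + norm u \<le> K * (norm (\<alpha> *s c + A p *v u) + norm (cdot u r))"
proof -
  obtain K where K: "K > 0" "\<And>\<alpha> u. norm \<alpha> + norm u \<le> K * (norm (\<alpha> *s c + jac F x_e *v u) + norm (cdot u r))"
    using bordered_full_rank_bound[OF kernel_one kernel(2) not_range] by blast
  let ?N = "real CARD('n)"
  \<comment> \<open>With this bound the perturbation, multiplied by \<open>K\<close>, is at most
    half of \<open>norm u\<close> and is absorbed by the left-hand side at the price of doubling
    \<open>K\<close>.\<close>
  have "\<forall>\<^sub>F p in G. norm (A p - jac F x_e) \<le> 1 / (2 * K * ?N)"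
    by (rule bigO_eventually_small[OF A eps_lim]) (use K in simp)
  then have "\<forall>\<^sub>F p in G. \<forall>\<alpha> u. norm \<alpha> + norm u \<le> (2 * K) * (norm (\<alpha> *s c + A p *v u) + norm (cdot u r))"
  proof eventually_elim
    case (elim p)
    show ?case
    proof (intro allI)
      fix \<alpha> u
      have "norm ((A p - jac F x_e) *v u) \<le> ?N * (1 / (2 * K * ?N)) * norm u"
        by (rule order_trans[OF norm_matrix_vector_le]) (intro mult_right_mono mult_left_mono elim; simp)
      also have "\<dots> = norm u / (2 * K)" using K by simp
      finally have d: "norm ((A p - jac F x_e) *v u) \<le> norm u / (2 * K)" .
      have eq: "\<alpha> *s c + jac F x_e *v u = (\<alpha> *s c + A p *v u) - (A p - jac F x_e) *v u"
        by (simp add: matrix_vector_sub_rdistrib)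
      have "norm (\<alpha> *s c + jac F x_e *v u) \<le> norm (\<alpha> *s c + A p *v u) + norm ((A p - jac F x_e) *v u)"
        unfolding eq by (rule norm_triangle_ineq4)
      with d have "norm (\<alpha> *s c + jac F x_e *v u) \<le> norm (\<alpha> *s c + A p *v u) + norm u / (2 * K)"
        by linarith
      then have "K * norm (\<alpha> *s c + jac F x_e *v u) \<le> K * (norm (\<alpha> *s c + A p *v u) + norm u / (2 * K))"
        using K by (intro mult_left_mono) auto
      then have "K * norm (\<alpha> *s c + jac F x_e *v u) \<le> K * norm (\<alpha> *s c + A p *v u) + norm u / 2"
        using K by (simp add: distrib_left)
      moreover have "norm \<alpha> + norm u \<le> K * norm (\<alpha> *s c + jac F x_e *v u) + K * norm (cdot u r)"
        using K(2)[of \<alpha> u] by (simp add: distrib_left)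
      ultimately show "norm \<alpha> + norm u \<le> (2 * K) * (norm (\<alpha> *s c + A p *v u) + norm (cdot u r))"
        unfolding distrib_left using norm_ge_zero[of \<alpha>] by linarith
    qed
  qed
  then show ?thesis using that[of "2 * K"] K by simp
qed

context
  fixes A v
  assumes A: "bigO G eps (\<lambda>p. A p - jac F x_e)" and v: "\<forall>\<^sub>F p in G. min_direction (A p) (v p)"
begin

lemma v_1: "bigO G (\<lambda>_. 1) v"
  by (rule bigO_of_norm_le[where C = 1], rule eventually_mono[OF v]) (simp add: min_direction_def)

text \<open>The general lemma makes \<open>g\<close> minus some multiple of \<open>v\<close> small.
  Its component orthogonal to \<open>v\<close> is small as well, and that is the orthogonal
  component of \<open>g\<close> itself.\<close>

lemma alignment:
  assumes Ag: "bigO G \<eta> (\<lambda>p. A p *v g p)" and eta: "(\<eta> \<longlongrightarrow> 0) G"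
    and g: "b > 0" "\<forall>\<^sub>F p in G. b \<le> norm (g p)" "bigO G (\<lambda>_. 1) g"
  shows "bigO G \<eta> (\<lambda>p. A p *v v p)" "bigO G \<eta> (\<lambda>p. g p - cdot (g p) (v p) *s v p)"
proof -
  obtain K where K: "\<forall>\<^sub>F p in G. \<forall>\<alpha> u. norm \<alpha> + norm u \<le> K * (norm (\<alpha> *s c + A p *v u) + norm (cdot u r))"
    by (rule uniform_full_rank[OF A])
  have nd: "\<forall>\<^sub>F p in G. \<forall>h. norm h \<le> K * (norm (A p *v h) + norm (cdot h r))"
    using K
  proof eventually_elim
    case (elim p)
    show ?case using elim[rule_format, of 0] by simp
  qed
  have fg: "bigO G (\<lambda>_. 1) (\<lambda>p. cdot (g p) r)" by (intro bigO_cdot_1 g bigO_const)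
  note al = min_direction_alignment[OF nd _ v Ag eta g(1,2) fg, unfolded cdot_simps]
  show "bigO G \<eta> (\<lambda>p. A p *v v p)" by (rule al(1)) simp
  let ?l = "\<lambda>p. cdot (g p) r / cdot (v p) r"
  have d: "bigO G \<eta> (\<lambda>p. g p - ?l p *s v p)" by (rule al(3)) simp
  then have "bigO G \<eta> (\<lambda>p. cdot (g p - ?l p *s v p) (v p))" by (intro bigO_cdot_1 v_1)
  then have "bigO G \<eta> (\<lambda>p. cdot (g p - ?l p *s v p) (v p) *s v p)" by (intro bigO_cmult_1 v_1)
  then have "bigO G \<eta> (\<lambda>p. (g p - ?l p *s v p) - cdot (g p - ?l p *s v p) (v p) *s v p)"
    by (intro bigO_diff d)
  moreover have "\<forall>\<^sub>F p in G. (g p - ?l p *s v p) - cdot (g p - ?l p *s v p) (v p) *s v p = g p - cdot (g p) (v p) *s v p"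
    using v
  proof eventually_elim
    case (elim p)
    then have "cdot (v p) (v p) = 1" by (simp add: cdot_self min_direction_def)
    then show ?case by (simp add: cdot_simps vec_eq_iff algebra_simps)
  qed
  ultimately show "bigO G \<eta> (\<lambda>p. g p - cdot (g p) (v p) *s v p)" by (rule bigO_cong[rotated])
qed

lemma A_r: "bigO G eps (\<lambda>p. A p *v r)"
proof -
  have "bigO G eps (\<lambda>p. (A p - jac F x_e) *v r)" by (intro bigO_matrix_vector_1 A bigO_const)
  then show ?thesis by (simp add: matrix_vector_sub_rdistrib kernel)
qed

text \<open>The kernel vector \<open>r\<close> at the root is the test vector: its image under
  \<open>A\<close> comes from the perturbation alone.\<close>

lemma A_v: "bigO G eps (\<lambda>p. A p *v v p)"
  and r_v: "bigO G eps (\<lambda>p. r - cdot r (v p) *s v p)"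
  using alignment[OF A_r eps_lim, of "norm r"] kernel by simp_all

lemma cdot_r_v: "\<forall>\<^sub>F p in G. norm r / 2 \<le> norm (cdot r (v p))"
proof -
  have "\<forall>\<^sub>F p in G. norm (r - cdot r (v p) *s v p) \<le> norm r / 2"
    by (rule bigO_eventually_small[OF r_v eps_lim]) (use kernel in simp)
  then show ?thesis using v
  proof eventually_elim
    case (elim p)
    have "norm r \<le> norm (r - cdot r (v p) *s v p) + norm (cdot r (v p) *s v p)"
      using norm_triangle_ineq[of "r - cdot r (v p) *s v p" "cdot r (v p) *s v p"] by simp
    then show ?case using elim by (simp add: norm_cmult_vec min_direction_def)
  qed
qed

lemma cdot_r_orth:
  obtains C where "C > 0" "\<forall>\<^sub>F p in G. \<forall>u. cdot u (v p) = 0 \<longrightarrow> norm (cdot u r) \<le> C * \<bar>eps p\<bar> * norm u"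
proof -
  obtain C where C: "C > 0" "\<forall>\<^sub>F p in G. norm (r - cdot r (v p) *s v p) \<le> C * \<bar>eps p\<bar>"
    by (rule bigOE[OF r_v])
  have "\<forall>\<^sub>F p in G. \<forall>u. cdot u (v p) = 0 \<longrightarrow> norm (cdot u r) \<le> C * \<bar>eps p\<bar> * norm u"
    using C(2)
  proof eventually_elim
    case (elim p)
    show ?case
    proof (intro allI impI)
      fix u assume "cdot u (v p) = 0"
      then have "norm (cdot u r) = norm (cdot u (r - cdot r (v p) *s v p))" by (simp add: cdot_right_simps)
      also have "\<dots> \<le> norm u * norm (r - cdot r (v p) *s v p)" by (rule norm_cdot_le)
      also have "\<dots> \<le> norm u * (C * \<bar>eps p\<bar>)" by (intro mult_left_mono elim) simp
      finally show "norm (cdot u r) \<le> C * \<bar>eps p\<bar> * norm u" by (simp add: mult_ac)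
    qed
  qed
  with C(1) show ?thesis by (rule that)
qed

text \<open>On the complement of \<open>v\<close> the product with \<open>r\<close> is of order
  \<open>eps\<close>, since \<open>r\<close> is nearly a multiple of \<open>v\<close>. It can
  therefore be absorbed, and the full-rank bound holds there without this term.\<close>

lemma orth_full_rank:
  obtains K where "K > 0"
    "\<forall>\<^sub>F p in G. \<forall>\<alpha> u. cdot u (v p) = 0 \<longrightarrow> norm \<alpha> + norm u \<le> K * norm (\<alpha> *s c + A p *v u)"
proof -
  obtain K where K: "K > 0" "\<forall>\<^sub>F p in G. \<forall>\<alpha> u. norm \<alpha> + norm u \<le> K * (norm (\<alpha> *s c + A p *v u) + norm (cdot u r))"
    by (rule uniform_full_rank[OF A])
  obtain C where C: "C > 0" "\<forall>\<^sub>F p in G. \<forall>u. cdot u (v p) = 0 \<longrightarrow> norm (cdot u r) \<le> C * \<bar>eps p\<bar> * norm u"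
    by (rule cdot_r_orth)
  have "\<forall>\<^sub>F p in G. norm (eps p) \<le> 1 / (2 * K * C)"
    by (rule bigO_eventually_small[OF eps_self eps_lim]) (use K C in simp)
  with K(2) C(2) have "\<forall>\<^sub>F p in G. \<forall>\<alpha> u. cdot u (v p) = 0 \<longrightarrow> norm \<alpha> + norm u \<le> (2 * K) * norm (\<alpha> *s c + A p *v u)"
  proof eventually_elim
    case (elim p)
    show ?case
    proof (intro allI impI)
      fix \<alpha> u assume "cdot u (v p) = 0"
      then have 1: "norm (cdot u r) \<le> C * \<bar>eps p\<bar> * norm u" using elim(2) by blast
      have "K * (C * \<bar>eps p\<bar> * norm u) \<le> K * (C * (1 / (2 * K * C)) * norm u)"
        using elim(3) K(1) C(1) by (intro mult_left_mono mult_right_mono) auto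
      also have "\<dots> = norm u / 2" using K C by simp
      finally have "K * (C * \<bar>eps p\<bar> * norm u) \<le> norm u / 2" .
      moreover have "K * norm (cdot u r) \<le> K * (C * \<bar>eps p\<bar> * norm u)"
        using K(1) by (intro mult_left_mono[OF 1]) simp
      moreover have "norm \<alpha> + norm u \<le> K * norm (\<alpha> *s c + A p *v u) + K * norm (cdot u r)"
        using elim(1)[rule_format, of \<alpha> u] by (simp add: distrib_left)
      ultimately show "norm \<alpha> + norm u \<le> (2 * K) * norm (\<alpha> *s c + A p *v u)"
        using norm_ge_zero[of \<alpha>] by linarith
    qed
  qed
  then show ?thesis using that[of "2 * K"] K by simp
qed

end

lemma jacobian_perturbation:
  assumes "bigO G e (\<lambda>p. w p - x_e)" "bigO G (\<lambda>_. 1) e"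
  shows "bigO G e (\<lambda>p. jac F (w p) - jac F x_e)"
  using poly_eval_perturbation(4)[of G "\<lambda>_. x_e" e w, OF bigO_const assms(2,1)]
  by (simp add: jac_def bigO_vec_iff)

text \<open>In terms of the new error \<open>h\<close> the regularised equation has the right-hand
  side \<open>\<sigma> e\<close> plus the adjoint applied to the quadratic Newton remainder
  \<open>q\<close>. Along the smallest singular vector \<open>v\<close> a factor \<sigma> divides
  out and leaves a coefficient of order \<open>eps\<close>. On the complement, where
  \<open>A\<close> is bounded below, the solution is quadratic because \<sigma> itself is of order
  \<open>eps\<close>.\<close>

lemma step1_error:
  assumes x: "bigO G eps (\<lambda>p. x p - x_e)"
    and y: "\<forall>\<^sub>F p in G. refiner_step1 F (x p) (y p)"
    and pos: "\<forall>\<^sub>F p in G. smallest_singular_value (complex_jacobian (system_map F) (x p)) > 0"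
  obtains \<tau> where "bigO G eps \<tau>" "bigO G eps2 (\<lambda>p. x p + y p - x_e - \<tau> p *s r)"
proof -
  define A where "A p = jac F (x p)" for p
  define v where "v p = (SOME v. min_direction (A p) v)" for p
  define h where "h p = x p + y p - x_e" for p
  define e where "e p = x p - x_e" for p
  define q where "q p = A p *v e p - system_map F (x p)" for p
  define \<alpha> where "\<alpha> p = cdot (h p) (v p)" for p
  define h' where "h' p = h p - \<alpha> p *s v p" for p
  define \<sigma> where "\<sigma> p = norm (A p *v v p)" for p
  have vmin: "min_direction (A p) (v p)" for p
    unfolding v_def by (rule someI_ex[OF min_direction_exists])
  have Aeps: "bigO G eps (\<lambda>p. A p - jac F x_e)"
    unfolding A_def by (rule jacobian_perturbation[OF x eps_1])
  note al = Aeps always_eventually[OF allI[OF vmin]]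
  have q2: "bigO G eps2 q"
    unfolding bigO_vec_iff
  proof
    fix i
    have "poly_eval (F i) x_e = 0" using root by (simp add: system_map_def vec_eq_iff)
    moreover have "(\<Sum>j\<in>UNIV. grad (F i) (x p) $ j * (x_e - x p) $ j) = - (A p *v e p) $ i" for p
      by (simp add: A_def jac_def e_def matrix_vector_mult_def sum_negf[symmetric] algebra_simps)
    ultimately show "bigO G eps2 (\<lambda>p. q p $ i)"
      using poly_eval_perturbation(5)[of G "\<lambda>_. x_e" eps x "F i", OF bigO_const eps_1 x]
      by (simp add: q_def system_map_def)
  qed
  have main: "\<forall>\<^sub>F p in G. norm (\<alpha> p) \<le> norm (e p) + norm (q p) \<and>
      (norm (A p *v h' p))\<^sup>2 \<le> \<sigma> p * norm (e p) * norm (h' p) + norm (q p) * norm (A p *v h' p) \<and>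
      cdot (h' p) (v p) = 0"
    using y pos
  proof eventually_elim
    case (elim p)
    obtain u where u: "singular_pair (A p) (\<sigma> p) u (v p)"
      using min_direction_singular_pair[OF vmin] unfolding \<sigma>_def by blast
    have \<sigma>: "smallest_singular_value (A p) = \<sigma> p"
      unfolding \<sigma>_def by (rule smallest_singular_value_eq[OF vmin])
    have \<sigma>0: "\<sigma> p > 0" using elim(2) \<sigma> by (simp add: complex_jacobian_system A_def)
    have uv: "norm u = 1" "norm (v p) = 1" "A p *v v p = of_real (\<sigma> p) *s u"
      "conj_transpose (A p) *v u = of_real (\<sigma> p) *s v p"
      using u by (auto simp: singular_pair_def)
    let ?B = "conj_transpose (A p)"
    have "?B *v (A p *v y p) + of_real (\<sigma> p) *s y p = ?B *v (- system_map F (x p))"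
      using elim(1) unfolding refiner_step1_def Let_def complex_jacobian_system A_def[symmetric] \<sigma>
      by (simp add: matrix_vector_mult_add_rdistrib matrix_vector_mul_assoc mat_scalar_mult)
    then have eq: "?B *v (A p *v h p) + of_real (\<sigma> p) *s h p = of_real (\<sigma> p) *s e p + ?B *v q p"
    proof -
      assume a: "?B *v (A p *v y p) + of_real (\<sigma> p) *s y p = ?B *v (- system_map F (x p))"
      have hy: "h p = y p + e p" by (simp add: h_def e_def)
      have "?B *v q p = ?B *v (A p *v e p) + ?B *v (- system_map F (x p))"
        unfolding q_def by (simp add: matrix_vector_right_distrib[symmetric])
      then show ?thesis
        unfolding hy matrix_vector_right_distrib vector_add_ldistrib a[symmetric] by simp
    qed
    have mid: "cdot (?B *v w) z = cdot w (A p *v z)" for w z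
      by (simp add: cdot_matrix)
    have "cdot (?B *v (A p *v h p) + of_real (\<sigma> p) *s h p) (v p) = of_real (\<sigma> p) * ((1 + of_real (\<sigma> p)) * \<alpha> p)"
      by (simp add: cdot_simps mid uv cdot_right_simps cdot_matrix \<alpha>_def algebra_simps)
    moreover have "cdot (of_real (\<sigma> p) *s e p + ?B *v q p) (v p) = of_real (\<sigma> p) * (cdot (e p) (v p) + cdot (q p) u)"
      by (simp add: cdot_simps mid uv cdot_right_simps algebra_simps)
    \<comment> \<open>The factor \<sigma> common to both products cancels; here the positivity of
      the smallest singular value is used.\<close>
    ultimately have \<alpha>: "(1 + of_real (\<sigma> p)) * \<alpha> p = cdot (e p) (v p) + cdot (q p) u"
      using eq \<sigma>0 by simp
    have "norm (\<alpha> p) \<le> (1 + \<sigma> p) * norm (\<alpha> p)" using \<sigma>0 by (simp add: distrib_right)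
    also have "\<dots> = norm ((1 + of_real (\<sigma> p)) * \<alpha> p)"
      using \<sigma>0 norm_of_real[of "1 + \<sigma> p", where 'a = complex] by (simp add: norm_mult)
    also have "\<dots> \<le> norm (cdot (e p) (v p)) + norm (cdot (q p) u)"
      unfolding \<alpha> by (rule norm_triangle_ineq)
    also have "\<dots> \<le> norm (e p) + norm (q p)"
      using norm_cdot_le[of "e p" "v p"] norm_cdot_le[of "q p" u] uv by simp
    finally have 1: "norm (\<alpha> p) \<le> norm (e p) + norm (q p)" .
    have orth: "cdot (h' p) (v p) = 0"
      using uv by (simp add: h'_def cdot_simps \<alpha>_def[symmetric] cdot_self)
    then have orth': "cdot (v p) (h' p) = 0" using cdot_cnj[of "v p" "h' p"] by simp
    \<comment> \<open>The equation for the part orthogonal to \<open>v\<close>. It will be tested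
      with \<open>h'\<close>, in whose product the multiples of \<open>v\<close> vanish.\<close>
    have "?B *v (A p *v h' p) + of_real (\<sigma> p) *s h' p = of_real (\<sigma> p) *s e p + ?B *v q p -
      (\<alpha> p * of_real (\<sigma> p) * of_real (\<sigma> p) + \<alpha> p * of_real (\<sigma> p)) *s v p"
      unfolding h'_def eq[symmetric]
      by (simp add: matrix_vector_mult_diff_distrib vector_scalar_commute uv vec_eq_iff algebra_simps)
    then have "cdot (?B *v (A p *v h' p) + of_real (\<sigma> p) *s h' p) (h' p) = cdot (of_real (\<sigma> p) *s e p + ?B *v q p -
      (\<alpha> p * of_real (\<sigma> p) * of_real (\<sigma> p) + \<alpha> p * of_real (\<sigma> p)) *s v p) (h' p)" by simp
    then have 2: "of_real ((norm (A p *v h' p))\<^sup>2 + \<sigma> p * (norm (h' p))\<^sup>2) =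
      of_real (\<sigma> p) * cdot (e p) (h' p) + cdot (q p) (A p *v h' p)"
      by (simp add: cdot_simps mid orth' cdot_self)
    have "(norm (A p *v h' p))\<^sup>2 \<le> (norm (A p *v h' p))\<^sup>2 + \<sigma> p * (norm (h' p))\<^sup>2" using \<sigma>0 by simp
    also have "\<dots> \<le> norm (of_real ((norm (A p *v h' p))\<^sup>2 + \<sigma> p * (norm (h' p))\<^sup>2) :: complex)"
      unfolding norm_of_real by (rule abs_ge_self)
    also have "\<dots> \<le> norm (of_real (\<sigma> p) * cdot (e p) (h' p)) + norm (cdot (q p) (A p *v h' p))"
      unfolding 2 by (rule norm_triangle_ineq)
    also have "\<dots> \<le> \<sigma> p * (norm (e p) * norm (h' p)) + norm (q p) * norm (A p *v h' p)"
      using \<sigma>0 by (auto simp: norm_mult intro!: add_mono norm_cdot_le)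
    finally show ?case using 1 orth by (simp add: mult.assoc)
  qed
  have e1: "bigO G eps e" using x by (simp add: e_def[abs_def])
  have \<alpha>1: "bigO G eps \<alpha>"
  proof (rule bigO_le[where K = 1])
    show "bigO G eps (\<lambda>p. norm (e p) + norm (q p))"
      using e1 bigO_mono[OF q2 eps2_eps] by (intro bigO_add) (simp_all add: bigO_norm)
    show "\<forall>\<^sub>F p in G. norm (\<alpha> p) \<le> 1 * norm (norm (e p) + norm (q p))"
      using main by eventually_elim simp
  qed
  have \<sigma>1: "bigO G eps \<sigma>"
    unfolding \<sigma>_def[abs_def] bigO_norm by (rule A_v[OF al])
  obtain K where K: "K > 0" "\<forall>\<^sub>F p in G. \<forall>\<beta> u. cdot u (v p) = 0 \<longrightarrow> norm \<beta> + norm u \<le> K * norm (\<beta> *s c + A p *v u)"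
    by (rule orth_full_rank[OF al])
  have h'2: "bigO G eps2 h'"
  proof (rule bigO_le[where K = K])
    have "bigO G eps2 (\<lambda>p. \<sigma> p * norm (e p))" by (intro bigO_mult \<sigma>1) (simp add: bigO_norm e1)
    then have "bigO G eps2 (\<lambda>p. K * (\<sigma> p * norm (e p)))" by (rule bigO_mult_1(2)[OF bigO_const])
    moreover have "bigO G eps2 (\<lambda>p. norm (q p))" by (simp add: bigO_norm q2)
    ultimately show "bigO G eps2 (\<lambda>p. K * (\<sigma> p * norm (e p)) + norm (q p))" by (rule bigO_add)
    show "\<forall>\<^sub>F p in G. norm (h' p) \<le> K * norm (K * (\<sigma> p * norm (e p)) + norm (q p))"
      using main K(2)
    proof eventually_elim
      case (elim p)
      let ?a = "norm (A p *v h' p)"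
      have h: "norm (h' p) \<le> K * ?a" using elim(1) elim(2)[rule_format, of "h' p" 0] by simp
      have s0: "0 \<le> \<sigma> p * norm (e p)" by (simp add: \<sigma>_def)
      have "?a\<^sup>2 \<le> \<sigma> p * norm (e p) * norm (h' p) + norm (q p) * ?a" using elim(1) by simp
      also have "\<dots> \<le> \<sigma> p * norm (e p) * (K * ?a) + norm (q p) * ?a"
        using mult_left_mono[OF h s0] by simp
      finally have "?a * ?a \<le> (K * (\<sigma> p * norm (e p)) + norm (q p)) * ?a"
        by (simp add: power2_eq_square algebra_simps)
      then have "?a \<le> K * (\<sigma> p * norm (e p)) + norm (q p)"
        using s0 K(1) by (cases "?a = 0") (auto simp: mult_le_cancel_right)
      then have "K * ?a \<le> K * (K * (\<sigma> p * norm (e p)) + norm (q p))" using K(1) by simp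
      with h have "norm (h' p) \<le> K * (K * (\<sigma> p * norm (e p)) + norm (q p))" by linarith
      then show ?case using s0 K(1) by simp
    qed
  qed
  let ?l = "\<lambda>p. cdot r (v p)"
  \<comment> \<open>Passing from \<open>v\<close> to \<open>r\<close> divides by
    \<open>cdot r (v p)\<close>, which is bounded below. The error is \<tau> times the misalignment
    of the two vectors, a product of two quantities of order \<open>eps\<close>.\<close>
  define \<tau> where "\<tau> p = \<alpha> p * inverse (?l p)" for p
  have \<tau>1: "bigO G eps \<tau>"
    unfolding \<tau>_def[abs_def]
    by (intro bigO_mult_1(1) \<alpha>1 bigO_inverse[OF _ cdot_r_v[OF al]]) (use kernel in simp)
  have "bigO G eps2 (\<lambda>p. h' p - \<tau> p *s (r - ?l p *s v p))"
    by (intro bigO_diff h'2 bigO_cmult[OF \<tau>1 r_v[OF al]])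
  moreover have "\<forall>\<^sub>F p in G. h' p - \<tau> p *s (r - ?l p *s v p) = h p - \<tau> p *s r"
    using cdot_r_v[OF al]
  proof eventually_elim
    case (elim p)
    then have "?l p \<noteq> 0" using kernel(2) by auto
    then show ?case by (simp add: h'_def \<tau>_def vec_eq_iff field_simps)
  qed
  ultimately have "bigO G eps2 (\<lambda>p. h p - \<tau> p *s r)" by (rule bigO_cong[rotated])
  then show ?thesis using that[OF \<tau>1] by (simp add: h_def)
qed

end

section \<open>Rotated coordinates and compositions of univariate polynomials\<close>

lemma unitary_facts:
  fixes R :: "'n::{finite,linorder} cmat"
  assumes "unitary_matrix R"
  shows "conj_transpose R *v (R *v h) = h" "R *v (conj_transpose R *v h) = h"
    "norm (R *v h) = norm h" "norm (conj_transpose R *v h) = norm h"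
    "cdot (R *v h) (column first_index R) = h $ first_index"
    "(conj_transpose R *v h) $ first_index = cdot h (column first_index R)"
    "R *v (matrix_inv R *v h) = h"
proof -
  have RR: "conj_transpose R ** R = mat 1" "R ** conj_transpose R = mat 1"
    using assms by (auto simp: unitary_matrix_def)
  show 1: "conj_transpose R *v (R *v h) = h" and 2: "R *v (conj_transpose R *v h) = h" for h
    by (simp_all add: matrix_vector_mul_assoc RR)
  have "of_real ((norm (R *v h))\<^sup>2) = (of_real ((norm h)\<^sup>2) :: complex)" for h
    unfolding cdot_self[symmetric] by (simp add: cdot_matrix 1)
  then have "(norm (R *v h))\<^sup>2 = (norm h)\<^sup>2" for h by (simp only: of_real_eq_iff)
  then show n: "norm (R *v h) = norm h" for h by (simp add: power2_eq_iff_nonneg)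
  show "norm (conj_transpose R *v h) = norm h" using n[of "conj_transpose R *v h"] by (simp add: 2)
  have f: "cdot h (axis first_index 1) = h $ first_index" for h :: "'n cvec"
    by (simp add: cdot_def axis_def if_distrib[of cnj] if_distrib[of "\<lambda>x. _ * x"] cong: if_cong)
  have col: "column first_index R = R *v axis first_index 1" by (simp add: matrix_vector_mult_axis)
  show 3: "cdot (R *v h) (column first_index R) = h $ first_index" for h
    unfolding col by (simp add: cdot_matrix 1 f)
  show "(conj_transpose R *v h) $ first_index = cdot h (column first_index R)"
    using 3[of "conj_transpose R *v h"] by (simp add: 2)
  have "invertible R" using RR by (auto simp: invertible_def)
  then show "R *v (matrix_inv R *v h) = h"
    unfolding matrix_inv_def invertible_def matrix_vector_mul_assoc by (metis (mono_tags, lifting) matrix_vector_mul_lid someI_ex)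
qed

text \<open>Once the first entry is split off, the rest of \<open>h\<close> is rotated into the
  complement of the first column of \<open>R\<close>, which is where the Jacobian is bounded
  below.\<close>

lemma bordered_matrix_mult:
  fixes h :: "'n::{finite,linorder} cvec"
  shows "bordered_matrix P (\<lambda>z. system_map F (R *v z)) z *v h =
    h $ first_index *s apply_op_system P (\<lambda>z. system_map F (R *v z)) z +
    jac F (R *v z) *v (R *v (h - h $ first_index *s axis first_index 1))"
proof -
  let ?f = "first_index :: 'n" and ?h = "h - h $ first_index *s axis first_index 1"
  define w where "w = R *v z"
  define J where "J = jac F w ** R"
  define Q where "Q = apply_op_system P (\<lambda>z. system_map F (R *v z)) z"
  define B where "B = bordered_matrix P (\<lambda>z. system_map F (R *v z)) z"
  have B: "B $ i $ j = (if j = ?f then Q $ i else J $ i $ j)" for i j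
    unfolding B_def bordered_matrix_def complex_jacobian_compose Q_def J_def w_def by simp
  have h: "?h $ j = (if j = ?f then 0 else h $ j)" for j by (simp add: axis_def)
  have "(B *v h) $ i = Q $ i * h $ ?f + (\<Sum>j\<in>UNIV - {?f}. J $ i $ j * h $ j)" for i
    unfolding matrix_vector_mult_def vec_lambda_beta
    by (subst sum.remove[of _ ?f]) (simp_all add: B)
  moreover have "(J *v ?h) $ i = (\<Sum>j\<in>UNIV - {?f}. J $ i $ j * h $ j)" for i
    unfolding matrix_vector_mult_def vec_lambda_beta
    by (subst sum.remove[of _ ?f]) (simp_all add: axis_def)
  ultimately have "B *v h = h $ ?f *s Q + J *v ?h"
    by (simp add: vec_eq_iff mult.commute)
  then show ?thesis unfolding B_def Q_def J_def w_def matrix_vector_mul_assoc[symmetric] .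
qed

lemma coeff_xcurve:
  fixes R :: "'n::{finite,linorder} cmat"
  shows "(\<chi> i. coeff (xcurve R z a m i) k) = (if k = 0 then R *v z else if k = 1 then column first_index R
    else if k < m then R *v (a k - a k $ first_index *s axis first_index 1) else 0)"
proof -
  let ?f = "first_index :: 'n"
  have zc: "coeff (zcurve a m j) k = (if j = ?f then (if k = 1 then 1 else 0)
    else if 2 \<le> k \<and> k < m then a k $ j else 0)" for j
    by (auto simp: zcurve_def coeff_sum coeff_pCons split: nat.split)
  have "coeff (xcurve R z a m i) k = (\<Sum>j\<in>UNIV. R $ i $ j * ((if k = 0 then z $ j else 0) + coeff (zcurve a m j) k))" for i
    by (cases k) (simp_all add: xcurve_def coeff_sum)
  then show ?thesis
    by (auto simp: vec_eq_iff zc matrix_vector_mult_def column_def axis_def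
      if_distrib[of "\<lambda>x. _ * x"] cong: if_cong intro!: sum.cong)
qed

lemma bigO_coeff_pcompose:
  assumes "\<And>k. bigO G (\<lambda>_. 1) (\<lambda>p. coeff (\<sigma> p) k)"
  shows "bigO G (\<lambda>_. 1) (\<lambda>p. coeff (pcompose q (\<sigma> p) :: complex poly) k)"
proof (induction q arbitrary: k)
  case (pCons a q)
  show ?case
    unfolding pcompose_pCons coeff_add
    by (intro bigO_add bigO_const bigO_coeff_mult assms pCons)
qed simp

lemma bigO_poly_taylor:
  assumes t: "bigO G e \<tau>" and e: "bigO G (\<lambda>_. 1) e"
  shows "bigO G (\<lambda>_. 1) (\<lambda>p. poly q (\<tau> p :: complex))"
    and "bigO G e (\<lambda>p. poly q (\<tau> p) - coeff q 0)"
    and "bigO G (\<lambda>p. e p * e p) (\<lambda>p. poly q (\<tau> p) - coeff q 0 - \<tau> p * coeff q 1)"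
proof -
  have 1: "bigO G (\<lambda>_. 1) (\<lambda>p. poly q (\<tau> p))" for q
    by (induction q) (auto intro!: bigO_add bigO_mult_1 bigO_mono[OF t e])
  then show "bigO G (\<lambda>_. 1) (\<lambda>p. poly q (\<tau> p))" .
  obtain a q' where q: "q = pCons a q'" by (cases q)
  have "bigO G e (\<lambda>p. \<tau> p * poly q' (\<tau> p))" by (rule bigO_mult_1(1)[OF t 1])
  then show "bigO G e (\<lambda>p. poly q (\<tau> p) - coeff q 0)" by (simp add: q)
  obtain b q'' where q': "q' = pCons b q''" by (cases q')
  have "bigO G (\<lambda>p. e p * e p) (\<lambda>p. \<tau> p * \<tau> p * poly q'' (\<tau> p))"
    by (intro bigO_mult_1(1)[OF _ 1] bigO_mult t)
  then show "bigO G (\<lambda>p. e p * e p) (\<lambda>p. poly q (\<tau> p) - coeff q 0 - \<tau> p * coeff q 1)"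
    by (simp add: q q' algebra_simps)
qed

lemma coeff_mult_split:
  fixes s q :: "complex poly"
  shows "coeff (s * q) k = coeff s 0 * coeff q k + (if k \<ge> 1 then coeff s 1 * coeff q (k - 1) else 0) +
    (\<Sum>i\<in>{2..k}. coeff s i * coeff q (k - i))"
proof -
  have "{..k} = {0} \<union> ({1} \<inter> {..k}) \<union> {2..k}" by auto
  then have "coeff (s * q) k = (\<Sum>i\<in>{0} \<union> ({1} \<inter> {..k}) \<union> {2..k}. coeff s i * coeff q (k - i))"
    by (simp add: coeff_mult)
  also have "\<dots> = coeff s 0 * coeff q k + (\<Sum>i\<in>{1} \<inter> {..k}. coeff s i * coeff q (k - i)) +
    (\<Sum>i\<in>{2..k}. coeff s i * coeff q (k - i))"
    by (subst sum.union_disjoint, auto)+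
  also have "(\<Sum>i\<in>{1} \<inter> {..k}. coeff s i * coeff q (k - i)) = (if k \<ge> 1 then coeff s 1 * coeff q (k - 1) else 0)"
    by (cases "k \<ge> 1") auto
  finally show ?thesis .
qed

text \<open>In a coefficient of order \<open>k\<close> of the \<open>n\<close>-th power at least
  \<open>n - k\<close> factors contribute their constant term, of size \<open>e\<close>. Below order
  \<open>n - 1\<close> there are two of them. At order \<open>n - 1\<close> the main part has one
  constant and \<open>n - 1\<close> linear terms, arranged in \<open>n\<close> ways; at order
  \<open>n\<close> it has linear terms only.\<close>

lemma bigO_power_coeffs:
  assumes \<sigma>: "\<And>k. bigO G (\<lambda>_. 1) (\<lambda>p. coeff (\<sigma> p) k)" and t: "bigO G e (\<lambda>p. coeff (\<sigma> p :: complex poly) 0)"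
    and e: "bigO G (\<lambda>_. 1) e"
  shows "k + 2 \<le> n \<Longrightarrow> bigO G (\<lambda>p. e p * e p) (\<lambda>p. coeff (\<sigma> p ^ n) k)"
    and "Suc k = n \<Longrightarrow> bigO G (\<lambda>p. e p * e p) (\<lambda>p. coeff (\<sigma> p ^ n) k - of_nat n * coeff (\<sigma> p) 0 * coeff (\<sigma> p) 1 ^ k)"
    and "bigO G e (\<lambda>p. coeff (\<sigma> p ^ n) n - coeff (\<sigma> p) 1 ^ n)"
    and "bigO G (\<lambda>_. 1) (\<lambda>p. coeff (\<sigma> p ^ n) k)"
    and "k < n \<Longrightarrow> bigO G e (\<lambda>p. coeff (\<sigma> p ^ n) k)"
proof -
  let ?e2 = "\<lambda>p. e p * e p"
  let ?t = "\<lambda>p. coeff (\<sigma> p) 0" and ?s = "\<lambda>p. coeff (\<sigma> p) 1"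
  have ee: "bigO G e e" by (rule bigOI[where C = 1]) simp
  have e2: "bigO G e ?e2" using bigO_mult_1(1)[OF ee e] .
  have O1: "bigO G (\<lambda>_. 1) (\<lambda>p. coeff (\<sigma> p ^ n) k)" for n k
    by (induction n arbitrary: k) (auto intro!: bigO_coeff_mult \<sigma>)
  have s1: "bigO G (\<lambda>_. 1) (\<lambda>p. ?s p ^ k)" for k by (rule bigO_power_1[OF \<sigma>])
  have *: "(\<forall>k. k + 2 \<le> n \<longrightarrow> bigO G ?e2 (\<lambda>p. coeff (\<sigma> p ^ n) k)) \<and>
    (\<forall>k. Suc k = n \<longrightarrow> bigO G ?e2 (\<lambda>p. coeff (\<sigma> p ^ n) k - of_nat n * ?t p * ?s p ^ k)) \<and>
    bigO G e (\<lambda>p. coeff (\<sigma> p ^ n) n - ?s p ^ n)" for n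
  proof (induction n)
    case (Suc n)
    have IH1: "bigO G ?e2 (\<lambda>p. coeff (\<sigma> p ^ n) k)" if "k + 2 \<le> n" for k using Suc that by blast
    have IH2: "bigO G ?e2 (\<lambda>p. coeff (\<sigma> p ^ n) k - of_nat n * ?t p * ?s p ^ k)" if "Suc k = n" for k
      using Suc that by blast
    have IH3: "bigO G e (\<lambda>p. coeff (\<sigma> p ^ n) n - ?s p ^ n)" using Suc by blast
    have IH4: "bigO G e (\<lambda>p. coeff (\<sigma> p ^ n) k)" if "Suc k \<le> n" for k
    proof (cases "Suc k = n")
      case True
      have "bigO G e (\<lambda>p. of_nat n * ?t p * ?s p ^ k)"
        by (intro bigO_mult_1(1)[OF _ s1] bigO_mult_1(2)[OF bigO_const t])
      from bigO_add[OF bigO_mono[OF IH2[OF True] e2] this] show ?thesis by simp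
    next
      case False
      then show ?thesis using bigO_mono[OF IH1 e2] that by simp
    qed
    have 1: "bigO G ?e2 (\<lambda>p. coeff (\<sigma> p ^ Suc n) k)" if k: "k + 2 \<le> Suc n" for k
      unfolding power_Suc coeff_mult_split
    proof (intro bigO_add)
      show "bigO G ?e2 (\<lambda>p. ?t p * coeff (\<sigma> p ^ n) k)" by (rule bigO_mult[OF t IH4]) (use k in simp)
      show "bigO G ?e2 (\<lambda>p. if k \<ge> 1 then ?s p * coeff (\<sigma> p ^ n) (k - 1) else 0)"
        using k by (cases "k \<ge> 1") (auto intro!: bigO_mult_1(2)[OF \<sigma>] IH1)
      show "bigO G ?e2 (\<lambda>p. \<Sum>i\<in>{2..k}. coeff (\<sigma> p) i * coeff (\<sigma> p ^ n) (k - i))"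
        by (intro bigO_sum bigO_mult_1(2)[OF \<sigma>] IH1) (use k in auto)
    qed
    have 2: "bigO G ?e2 (\<lambda>p. coeff (\<sigma> p ^ Suc n) n - of_nat (Suc n) * ?t p * ?s p ^ n)"
    proof -
      have a: "bigO G ?e2 (\<lambda>p. ?t p * (coeff (\<sigma> p ^ n) n - ?s p ^ n))" by (rule bigO_mult[OF t IH3])
      have b: "bigO G ?e2 (\<lambda>p. (if n \<ge> 1 then ?s p * coeff (\<sigma> p ^ n) (n - 1) else 0) - of_nat n * ?t p * ?s p ^ n)"
      proof (cases n)
        case (Suc m)
        have "bigO G ?e2 (\<lambda>p. ?s p * (coeff (\<sigma> p ^ n) m - of_nat n * ?t p * ?s p ^ m))"
          by (rule bigO_mult_1(2)[OF \<sigma> IH2]) (use Suc in simp)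
        then show ?thesis using Suc by (simp add: algebra_simps)
      qed simp
      have d: "bigO G ?e2 (\<lambda>p. \<Sum>i\<in>{2..n}. coeff (\<sigma> p) i * coeff (\<sigma> p ^ n) (n - i))"
        by (intro bigO_sum bigO_mult_1(2)[OF \<sigma>] IH1) auto
      have "coeff (\<sigma> p ^ Suc n) n - of_nat (Suc n) * ?t p * ?s p ^ n =
        ?t p * (coeff (\<sigma> p ^ n) n - ?s p ^ n) +
        ((if n \<ge> 1 then ?s p * coeff (\<sigma> p ^ n) (n - 1) else 0) - of_nat n * ?t p * ?s p ^ n) +
        (\<Sum>i\<in>{2..n}. coeff (\<sigma> p) i * coeff (\<sigma> p ^ n) (n - i))" for p
        unfolding power_Suc coeff_mult_split by (simp add: algebra_simps)
      then show ?thesis using bigO_add[OF bigO_add[OF a b] d] by (simp only:)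
    qed
    have 3: "bigO G e (\<lambda>p. coeff (\<sigma> p ^ Suc n) (Suc n) - ?s p ^ Suc n)"
    proof -
      have a: "bigO G e (\<lambda>p. ?t p * coeff (\<sigma> p ^ n) (Suc n))" by (rule bigO_mult_1(1)[OF t O1])
      have b: "bigO G e (\<lambda>p. ?s p * (coeff (\<sigma> p ^ n) n - ?s p ^ n))" by (rule bigO_mult_1(2)[OF \<sigma> IH3])
      have d: "bigO G e (\<lambda>p. \<Sum>i\<in>{2..Suc n}. coeff (\<sigma> p) i * coeff (\<sigma> p ^ n) (Suc n - i))"
        by (intro bigO_sum bigO_mult_1(2)[OF \<sigma>] IH4) auto
      have "coeff (\<sigma> p ^ Suc n) (Suc n) - ?s p ^ Suc n = ?t p * coeff (\<sigma> p ^ n) (Suc n) +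
        ?s p * (coeff (\<sigma> p ^ n) n - ?s p ^ n) + (\<Sum>i\<in>{2..Suc n}. coeff (\<sigma> p) i * coeff (\<sigma> p ^ n) (Suc n - i))" for p
        unfolding power_Suc[of "\<sigma> p"] coeff_mult_split by (simp add: algebra_simps)
      then show ?thesis using bigO_add[OF bigO_add[OF a b] d] by (simp only:)
    qed
    show ?case using 1 2 3 by blast
  qed simp
  show I: "k + 2 \<le> n \<Longrightarrow> bigO G ?e2 (\<lambda>p. coeff (\<sigma> p ^ n) k)"
    and II: "Suc k = n \<Longrightarrow> bigO G ?e2 (\<lambda>p. coeff (\<sigma> p ^ n) k - of_nat n * ?t p * ?s p ^ k)"
    and "bigO G e (\<lambda>p. coeff (\<sigma> p ^ n) n - ?s p ^ n)"
    using * by blast+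
  show "bigO G (\<lambda>_. 1) (\<lambda>p. coeff (\<sigma> p ^ n) k)" by (rule O1)
  show "bigO G e (\<lambda>p. coeff (\<sigma> p ^ n) k)" if "k < n"
  proof (cases "Suc k = n")
    case True
    have "bigO G e (\<lambda>p. of_nat n * ?t p * ?s p ^ k)"
      by (intro bigO_mult_1(1)[OF _ s1] bigO_mult_1(2)[OF bigO_const t])
    from bigO_add[OF bigO_mono[OF II[OF True] e2] this] show ?thesis by simp
  next
    case False
    then show ?thesis using bigO_mono[OF I e2] that by simp
  qed
qed

text \<open>A zero of order \<open>n\<close> splits off as \<open>monom 1 n * q\<close>, so the
  composition is \<open>\<sigma> ^ n\<close> times \<open>q\<close> composed with \<sigma>, whose
  constant term is the leading coefficient of \<open>f\<close> up to O(\<open>e\<close>).\<close>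

lemma bigO_pcompose_contact:
  fixes f :: "complex poly"
  assumes \<sigma>: "\<And>k. bigO G (\<lambda>_. 1) (\<lambda>p. coeff (\<sigma> p) k)" and t: "bigO G e (\<lambda>p. coeff (\<sigma> p) 0)"
    and e: "bigO G (\<lambda>_. 1) e" and f: "\<forall>l<n. coeff f l = 0"
  shows "k + 2 \<le> n \<Longrightarrow> bigO G (\<lambda>p. e p * e p) (\<lambda>p. coeff (pcompose f (\<sigma> p)) k)"
    and "Suc k = n \<Longrightarrow> bigO G (\<lambda>p. e p * e p)
      (\<lambda>p. coeff (pcompose f (\<sigma> p)) k - of_nat n * coeff (\<sigma> p) 0 * coeff (\<sigma> p) 1 ^ k * coeff f n)"
    and "bigO G e (\<lambda>p. coeff (pcompose f (\<sigma> p)) n - coeff (\<sigma> p) 1 ^ n * coeff f n)"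
    and "k < n \<Longrightarrow> bigO G e (\<lambda>p. coeff (pcompose f (\<sigma> p)) k)"
proof -
  let ?t = "\<lambda>p. coeff (\<sigma> p) 0" and ?s = "\<lambda>p. coeff (\<sigma> p) 1"
  let ?e2 = "\<lambda>p. e p * e p"
  obtain q where q: "f = monom 1 n * q" using f X_power_dvd_iff[of n f] by (auto elim: dvdE)
  have fn: "coeff f n = coeff q 0" by (simp add: q coeff_monom_mult)
  have mon: "pcompose (monom 1 n) s = s ^ n" for s :: "complex poly"
    by (induction n) (simp_all add: monom_Suc pcompose_pCons pcompose_1)
  define Q where "Q p = pcompose q (\<sigma> p)" for p
  have fs: "pcompose f (\<sigma> p) = \<sigma> p ^ n * Q p" for p
    by (simp add: q pcompose_mult mon Q_def)
  have Q1: "bigO G (\<lambda>_. 1) (\<lambda>p. coeff (Q p) k)" for k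
    unfolding Q_def by (rule bigO_coeff_pcompose[OF \<sigma>])
  have "coeff (Q p) 0 = poly q (?t p)" for p
    by (simp add: Q_def poly_0_coeff_0[symmetric] poly_pcompose)
  then have Q0: "bigO G e (\<lambda>p. coeff (Q p) 0 - coeff q 0)"
    using bigO_poly_taylor(2)[OF t e] by simp
  note pw = bigO_power_coeffs[OF \<sigma> t e]
  show "bigO G ?e2 (\<lambda>p. coeff (pcompose f (\<sigma> p)) k)" if "k + 2 \<le> n"
    unfolding fs by (rule bigO_coeff_mult) (use pw(1) Q1 that in auto)
  show "bigO G e (\<lambda>p. coeff (pcompose f (\<sigma> p)) k)" if "k < n"
    unfolding fs by (rule bigO_coeff_mult) (use pw(5) Q1 that in auto)
  have spl: "coeff (a * b) k = coeff a k * coeff b 0 + (\<Sum>i<k. coeff a i * coeff b (k - i))" for a b :: "complex poly" and k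
    by (simp add: coeff_mult lessThan_Suc_atMost[symmetric])
  have s1: "bigO G (\<lambda>_. 1) (\<lambda>p. ?s p ^ k)" for k by (rule bigO_power_1[OF \<sigma>])
  show "bigO G ?e2 (\<lambda>p. coeff (pcompose f (\<sigma> p)) k - of_nat n * ?t p * ?s p ^ k * coeff f n)" if k: "Suc k = n"
  proof -
    have a: "bigO G ?e2 (\<lambda>p. (coeff (\<sigma> p ^ n) k - of_nat n * ?t p * ?s p ^ k) * coeff (Q p) 0)"
      by (rule bigO_mult_1(1)[OF pw(2)[OF k] Q1])
    have b: "bigO G ?e2 (\<lambda>p. (of_nat n * ?t p * ?s p ^ k) * (coeff (Q p) 0 - coeff q 0))"
      by (intro bigO_mult Q0 bigO_mult_1(1)[OF _ s1] bigO_mult_1(2)[OF bigO_const t])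
    have d: "bigO G ?e2 (\<lambda>p. \<Sum>i<k. coeff (\<sigma> p ^ n) i * coeff (Q p) (k - i))"
      by (intro bigO_sum bigO_mult_1(1)[OF pw(1) Q1]) (use k in auto)
    have "coeff (pcompose f (\<sigma> p)) k - of_nat n * ?t p * ?s p ^ k * coeff f n =
      (coeff (\<sigma> p ^ n) k - of_nat n * ?t p * ?s p ^ k) * coeff (Q p) 0 +
      (of_nat n * ?t p * ?s p ^ k) * (coeff (Q p) 0 - coeff q 0) +
      (\<Sum>i<k. coeff (\<sigma> p ^ n) i * coeff (Q p) (k - i))" for p
      unfolding fs fn spl[of "\<sigma> p ^ n"] by (simp add: algebra_simps)
    then show ?thesis using bigO_add[OF bigO_add[OF a b] d] by (simp only:)
  qed
  show "bigO G e (\<lambda>p. coeff (pcompose f (\<sigma> p)) n - ?s p ^ n * coeff f n)"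
  proof -
    have a: "bigO G e (\<lambda>p. (coeff (\<sigma> p ^ n) n - ?s p ^ n) * coeff (Q p) 0)"
      by (rule bigO_mult_1(1)[OF pw(3) Q1])
    have b: "bigO G e (\<lambda>p. ?s p ^ n * (coeff (Q p) 0 - coeff q 0))"
      by (rule bigO_mult_1(2)[OF s1 Q0])
    have d: "bigO G e (\<lambda>p. \<Sum>i<n. coeff (\<sigma> p ^ n) i * coeff (Q p) (n - i))"
      by (intro bigO_sum bigO_mult_1(1)[OF pw(5) Q1]) auto
    have "coeff (pcompose f (\<sigma> p)) n - ?s p ^ n * coeff f n =
      (coeff (\<sigma> p ^ n) n - ?s p ^ n) * coeff (Q p) 0 + ?s p ^ n * (coeff (Q p) 0 - coeff q 0) +
      (\<Sum>i<n. coeff (\<sigma> p ^ n) i * coeff (Q p) (n - i))" for p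
      unfolding fs fn spl[of "\<sigma> p ^ n"] by (simp add: algebra_simps)
    then show ?thesis using bigO_add[OF bigO_add[OF a b] d] by (simp only:)
  qed
qed

text \<open>Changing the parametrisation in order \<open>k\<close> moves the composed curve in that
  order along its tangent and leaves lower orders alone. This freedom normalises the comparison
  curve.\<close>

lemma coeff_pcompose_add_monom:
  fixes g s :: "complex poly"
  assumes k: "k \<ge> 1"
  shows "l < k \<Longrightarrow> coeff (pcompose g (s + monom t k)) l = coeff (pcompose g s) l"
    and "coeff (pcompose g (s + monom t k)) k = coeff (pcompose g s) k + t * poly (pderiv g) (coeff s 0)"
proof -
  have "(\<forall>l<k. coeff (pcompose g (s + monom t k)) l = coeff (pcompose g s) l) \<and>
    coeff (pcompose g (s + monom t k)) k = coeff (pcompose g s) k + t * poly (pderiv g) (coeff s 0)"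
  proof (induction g)
    case (pCons a g)
    let ?A = "pcompose g (s + monom t k)" and ?B = "pcompose g s"
    have l: "coeff (s * ?A) l = coeff (s * ?B) l" if "l < k" for l
      unfolding coeff_mult by (rule sum.cong) (use pCons that in auto)
    have spl: "coeff (b * a) k = coeff b 0 * coeff a k + (\<Sum>i<k. coeff a i * coeff b (k - i))" for a b :: "complex poly"
      by (subst mult.commute) (simp add: coeff_mult lessThan_Suc_atMost[symmetric] mult.commute)
    have kk: "coeff (s * ?A) k = coeff (s * ?B) k + coeff s 0 * (t * poly (pderiv g) (coeff s 0))"
      unfolding spl using pCons by (simp add: distrib_left)
    have m: "coeff (monom t k * ?A) l = (if l = k then t * poly g (coeff s 0) else 0)" if "l \<le> k" for l
    proof -
      have "coeff ?A 0 = poly g (coeff s 0)"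
        using k by (simp add: poly_0_coeff_0[symmetric] poly_pcompose poly_monom zero_power)
      then show ?thesis using that by (simp add: coeff_monom_mult)
    qed
    show ?case
      using m l kk by (simp add: pcompose_pCons distrib_right pderiv_pCons algebra_simps)
  qed simp
  then show "l < k \<Longrightarrow> coeff (pcompose g (s + monom t k)) l = coeff (pcompose g s) l"
    and "coeff (pcompose g (s + monom t k)) k = coeff (pcompose g s) k + t * poly (pderiv g) (coeff s 0)"
    by blast+
qed

section \<open>The closed basis near a breadth-one root\<close>

lemma bigO_linear_coeff:
  fixes a b :: "'p \<Rightarrow> complex"
  assumes "bigO G e a" "bigO G e b"
  shows "bigO G e (\<lambda>p. coeff [:a p, b p:] k)"
proof -
  consider "k = 0" | "k = Suc 0" | l where "k = Suc (Suc l)" by (metis old.nat.exhaust)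
  then show ?thesis by cases (simp_all add: assms)
qed

lemma coeff_linear_eq_0: "2 \<le> k \<Longrightarrow> coeff [:a, b:] k = 0"
  by (cases k; cases "k - 1") auto

lemma closed_basis_mono:
  "numerical_closed_basis H z (Suc n) a L \<Longrightarrow> numerical_closed_basis H z n a L"
  by (auto simp: numerical_closed_basis_def)

text \<open>\<open>w\<close> is the point reached by step 1, remembered only through its parameter
  \<tau> on the tangent line at the root.\<close>

locale refinement = root_family G eps F x_e r c
  for G :: "'p filter" and eps and F :: "'n::{finite,linorder} \<Rightarrow> 'n cpoly" and x_e r c +
  fixes X :: "'n \<Rightarrow> complex poly" and \<mu> :: nat
    and w :: "'p \<Rightarrow> 'n cvec" and \<tau> :: "'p \<Rightarrow> complex" and R :: "'p \<Rightarrow> 'n cmat"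
  assumes mu: "2 \<le> \<mu>" and X_0: "\<And>j. coeff (X j) 0 = x_e $ j" and X_1: "\<And>j. coeff (X j) 1 = r $ j"
    and contact: "\<And>i. \<forall>l<\<mu>. coeff (cev X (F i)) l = 0"
    and leading: "c = (\<chi> i. coeff (cev X (F i)) \<mu>)"
    and tau: "bigO G eps \<tau>" and w: "bigO G eps2 (\<lambda>p. w p - x_e - \<tau> p *s r)"
    and unitary: "\<forall>\<^sub>F p in G. unitary_matrix (R p)"
    and min_dir: "\<forall>\<^sub>F p in G. min_direction (jac F (w p)) (column first_index (R p))"
begin

section \<open>The contact curve near the point reached by step 1\<close>

abbreviation "r\<^sub>1 p \<equiv> column first_index (R p)"
abbreviation "J p \<equiv> jac F (w p)"

definition tangent :: "'p \<Rightarrow> 'n cvec" where "tangent p = (\<chi> j. poly (pderiv (X j)) (\<tau> p))"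
definition \<rho> :: "'p \<Rightarrow> complex" where "\<rho> p = cdot (tangent p) (r\<^sub>1 p)"
text \<open>The precision attainable in order \<open>k\<close>, dictated by
  \<open>Phi_contact\<close>. It only deteriorates as \<open>k\<close> grows, so errors of lower
  order never spoil a later estimate.\<close>

definition \<eta> :: "nat \<Rightarrow> 'p \<Rightarrow> real" where "\<eta> k = (if k + 2 \<le> \<mu> then eps2 else eps)"
definition z :: "'p \<Rightarrow> 'n cvec" where "z p = matrix_inv (R p) *v w p"
definition H :: "'p \<Rightarrow> 'n cvec \<Rightarrow> 'n cvec" where "H p = (\<lambda>z. system_map F (R p *v z))"

lemma w_eps: "bigO G eps (\<lambda>p. w p - x_e)"
proof -
  have "bigO G eps (\<lambda>p. (w p - x_e - \<tau> p *s r) + \<tau> p *s r)"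
    by (intro bigO_add bigO_mono[OF w eps2_eps] bigO_cmult_1 tau bigO_const)
  then show ?thesis by simp
qed

lemma w_1: "bigO G (\<lambda>_. 1) w"
  using bigO_add[OF bigO_mono[OF w_eps eps_1] bigO_const[of G x_e]] by simp

lemma J_eps: "bigO G eps (\<lambda>p. J p - jac F x_e)"
  by (rule jacobian_perturbation[OF w_eps eps_1])

lemma tau_1: "bigO G (\<lambda>_. 1) \<tau>"
  by (rule bigO_mono[OF tau eps_1])

lemma r1_1: "bigO G (\<lambda>_. 1) (\<lambda>p. r\<^sub>1 p)"
  by (rule v_1[OF J_eps min_dir])

lemma r1_norm: "\<forall>\<^sub>F p in G. cdot (r\<^sub>1 p) (r\<^sub>1 p) = 1"
  using min_dir by eventually_elim (simp add: cdot_self min_direction_def)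

lemma Rz: "\<forall>\<^sub>F p in G. R p *v z p = w p"
  using unitary by eventually_elim (simp add: z_def unitary_facts)

lemma eta_eps: "bigO G eps (\<eta> k)"
  by (simp add: \<eta>_def eps2_eps eps_self)

lemma eps2_eta: "bigO G (\<eta> k) eps2"
  by (auto simp: \<eta>_def eps2_eps intro: bigOI[where C = 1])

lemma eta_1: "bigO G (\<lambda>_. 1) (\<eta> k)"
  by (rule bigO_mono[OF eta_eps eps_1])

lemma eta_mono: "k \<le> l \<Longrightarrow> bigO G (\<eta> l) (\<eta> k)"
  by (auto simp: \<eta>_def eps2_eps intro: bigOI[where C = 1])

lemma eta_lim: "(\<eta> k \<longlongrightarrow> 0) G"
  by (simp add: \<eta>_def eps_lim eps2_lim)

text \<open>At parameter \<tau> the curve has left its tangent line only quadratically, so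
  \<open>w\<close> is as close to the curve as to the line.\<close>

lemma X_tau: "bigO G eps2 (\<lambda>p. (\<chi> j. poly (X j) (\<tau> p)) - w p)"
proof -
  have "bigO G eps2 (\<lambda>p. (\<chi> j. poly (X j) (\<tau> p)) - x_e - \<tau> p *s r)"
    using bigO_poly_taylor(3)[OF tau eps_1] by (simp add: bigO_vec_iff X_0[symmetric] X_1[symmetric])
  from bigO_diff[OF this w] show ?thesis by simp
qed

lemma tangent_r: "bigO G eps (\<lambda>p. tangent p - r)"
  using bigO_poly_taylor(2)[OF tau eps_1, of "pderiv q" for q]
  by (simp add: bigO_vec_iff tangent_def X_1[symmetric] coeff_pderiv)

lemma tangent_1: "bigO G (\<lambda>_. 1) tangent"
  using bigO_add[OF bigO_mono[OF tangent_r eps_1] bigO_const[of G r]] by simp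

lemma tangent_norm: "\<forall>\<^sub>F p in G. norm r / 2 \<le> norm (tangent p)"
proof -
  have "\<forall>\<^sub>F p in G. norm (tangent p - r) \<le> norm r / 2"
    by (rule bigO_eventually_small[OF tangent_r eps_lim]) (use kernel in simp)
  then show ?thesis
  proof eventually_elim
    case (elim p)
    then show ?case using norm_triangle_ineq2[of r "tangent p"] by (simp add: norm_minus_commute)
  qed
qed

definition \<Phi> :: "('p \<Rightarrow> complex poly) \<Rightarrow> 'p \<Rightarrow> 'n \<Rightarrow> complex poly" where
  "\<Phi> \<sigma> p j = pcompose (X j) (\<sigma> p)"

abbreviation "Fcoeff Y k \<equiv> \<chi> i. coeff (cev Y (F i)) k"

text \<open>The base point of the curve \<open>A\<close> is \<open>w\<close>, so the gradients in
  the expansion are the rows of the Jacobian that the algorithm uses.\<close>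

lemma system_taylor:
  assumes k: "k \<ge> 1" and e1: "bigO G (\<lambda>_. 1) e"
    and A: "\<And>i. i \<le> k \<Longrightarrow> bigO G (\<lambda>_. 1) (\<lambda>p. \<chi> j. coeff (A p j) i)"
    and D: "\<And>i. i < k \<Longrightarrow> bigO G e (\<lambda>p. \<chi> j. coeff (B p j - A p j) i)"
    and Dk: "bigO G (\<lambda>_. 1) (\<lambda>p. \<chi> j. coeff (B p j - A p j) k)"
    and A0: "\<forall>\<^sub>F p in G. (\<chi> j. coeff (A p j) 0) = w p"
  shows "bigO G e (\<lambda>p. Fcoeff (B p) k - Fcoeff (A p) k - J p *v (\<chi> j. coeff (B p j - A p j) k))"
    and "bigO G (\<lambda>_. 1) (\<lambda>p. Fcoeff (A p) k)"
proof -
  note T = cev_taylor[of k G e A B, OF k e1 A[unfolded bigO_vec_iff vec_lambda_beta, rule_format]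
    D[unfolded bigO_vec_iff vec_lambda_beta, rule_format] Dk[unfolded bigO_vec_iff vec_lambda_beta, rule_format]]
  let ?D = "\<lambda>p. \<chi> j. coeff (B p j - A p j) k"
  have "bigO G e (\<lambda>p. Fcoeff (B p) k - Fcoeff (A p) k - jac F (\<chi> j. coeff (A p j) 0) *v ?D p)"
    unfolding bigO_vec_iff
  proof
    fix i
    have "(Fcoeff (B p) k - Fcoeff (A p) k - jac F (\<chi> j. coeff (A p j) 0) *v ?D p) $ i =
      coeff (cev (B p) (F i) - cev (A p) (F i)) k -
      (\<Sum>j\<in>UNIV. grad (F i) (\<chi> j. coeff (A p j) 0) $ j * coeff (B p j - A p j) k)" for p
      by (simp add: matrix_vector_mult_def jac_def)
    then show "bigO G e (\<lambda>p. (Fcoeff (B p) k - Fcoeff (A p) k - jac F (\<chi> j. coeff (A p j) 0) *v ?D p) $ i)"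
      using T(1) by (simp only:)
  qed
  then show "bigO G e (\<lambda>p. Fcoeff (B p) k - Fcoeff (A p) k - J p *v ?D p)"
    by (rule bigO_cong[rotated]) (rule eventually_mono[OF A0], simp)
  show "bigO G (\<lambda>_. 1) (\<lambda>p. Fcoeff (A p) k)"
    unfolding bigO_vec_iff vec_lambda_beta using T(2) by blast
qed

lemma coeff_Phi_0: "coeff (\<sigma> p) 0 = \<tau> p \<Longrightarrow> coeff (\<Phi> \<sigma> p j) 0 = poly (X j) (\<tau> p)"
  by (simp add: \<Phi>_def poly_0_coeff_0[symmetric] poly_pcompose)

lemma coeff_Phi_1: "coeff (\<Phi> \<sigma> p j) 1 = poly (pderiv (X j)) (coeff (\<sigma> p) 0) * coeff (\<sigma> p) 1"
proof -
  have "coeff (\<Phi> \<sigma> p j) 1 = poly (pderiv (\<Phi> \<sigma> p j)) 0" by (simp add: poly_0_coeff_0 coeff_pderiv)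
  also have "\<dots> = poly (pderiv (X j)) (poly (\<sigma> p) 0) * poly (pderiv (\<sigma> p)) 0"
    by (simp add: \<Phi>_def pderiv_pcompose poly_pcompose)
  also have "\<dots> = poly (pderiv (X j)) (coeff (\<sigma> p) 0) * coeff (\<sigma> p) 1"
    by (simp add: poly_0_coeff_0 coeff_pderiv)
  finally show ?thesis .
qed

lemma Phi_contact:
  assumes \<sigma>: "\<And>k. bigO G (\<lambda>_. 1) (\<lambda>p. coeff (\<sigma> p) k)" and \<sigma>0: "\<And>p. coeff (\<sigma> p) 0 = \<tau> p"
  shows "k < \<mu> \<Longrightarrow> bigO G (\<eta> k) (\<lambda>p. Fcoeff (\<Phi> \<sigma> p) k)"
    and "bigO G eps2 (\<lambda>p. Fcoeff (\<Phi> \<sigma> p) (\<mu> - 1) - (of_nat \<mu> * \<tau> p * coeff (\<sigma> p) 1 ^ (\<mu> - 1)) *s c)"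
    and "bigO G eps (\<lambda>p. Fcoeff (\<Phi> \<sigma> p) \<mu> - coeff (\<sigma> p) 1 ^ \<mu> *s c)"
proof -
  have t: "bigO G eps (\<lambda>p. coeff (\<sigma> p) 0)" using tau by (simp add: \<sigma>0)
  have F: "cev (\<Phi> \<sigma> p) (F i) = pcompose (cev X (F i)) (\<sigma> p)" for p i
    by (simp add: pcompose_peval_curve \<Phi>_def[abs_def])
  note C = bigO_pcompose_contact[OF \<sigma> t eps_1 contact]
  show "bigO G (\<eta> k) (\<lambda>p. Fcoeff (\<Phi> \<sigma> p) k)" if "k < \<mu>"
    using C(1)[of k] C(4)[of k] that by (simp add: bigO_vec_iff F \<eta>_def)
  have "Suc (\<mu> - 1) = \<mu>" using mu by simp
  from C(2)[OF this]
  show "bigO G eps2 (\<lambda>p. Fcoeff (\<Phi> \<sigma> p) (\<mu> - 1) - (of_nat \<mu> * \<tau> p * coeff (\<sigma> p) 1 ^ (\<mu> - 1)) *s c)"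
    by (simp add: bigO_vec_iff F leading \<sigma>0)
  show "bigO G eps (\<lambda>p. Fcoeff (\<Phi> \<sigma> p) \<mu> - coeff (\<sigma> p) 1 ^ \<mu> *s c)"
    using C(3) by (simp add: bigO_vec_iff F leading)
qed

lemma Phi_1: "(\<And>k. bigO G (\<lambda>_. 1) (\<lambda>p. coeff (\<sigma> p) k)) \<Longrightarrow> bigO G (\<lambda>_. 1) (\<lambda>p. \<chi> j. coeff (\<Phi> \<sigma> p j) k)"
  unfolding bigO_vec_iff vec_lambda_beta \<Phi>_def by (intro allI bigO_coeff_pcompose)

lemma cev_const_curve: "cev (\<lambda>j. [:u j:]) q = [:poly_eval q (\<chi> j. u j):]"
  using cev_const[of "\<chi> j. u j" q] by simp

text \<open>The linear coefficient of the system along \<open>X (\<tau> + s)\<close> is small by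
  contact, and comparison with the constant curve at \<open>w\<close> identifies it with the
  Jacobian applied to the tangent. For \<mu> above two this makes the tangent at \<tau> a sharper
  test vector for \<open>r\<^sub>1\<close> than the kernel vector at the root.\<close>

lemma J_tangent: "bigO G (\<eta> 1) (\<lambda>p. J p *v tangent p)"
proof -
  let ?\<sigma> = "\<lambda>p. [:\<tau> p, 1:]" and ?A = "\<lambda>p j. [:w p $ j:]"
  have \<sigma>1: "bigO G (\<lambda>_. 1) (\<lambda>p. coeff (?\<sigma> p) k)" for k
    by (rule bigO_linear_coeff[OF tau_1 bigO_const])
  have D0: "bigO G eps2 (\<lambda>p. \<chi> j. coeff (\<Phi> ?\<sigma> p j - ?A p j) i)" if "i < 1" for i
    using X_tau that by (simp add: bigO_vec_iff coeff_Phi_0)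
  have D1: "(\<chi> j. coeff (\<Phi> ?\<sigma> p j - ?A p j) 1) = tangent p" for p
    using coeff_Phi_1[of ?\<sigma> p] by (simp add: vec_eq_iff tangent_def)
  have "bigO G eps2 (\<lambda>p. Fcoeff (\<Phi> ?\<sigma> p) 1 - Fcoeff (?A p) 1 - J p *v (\<chi> j. coeff (\<Phi> ?\<sigma> p j - ?A p j) 1))"
  proof (rule system_taylor(1)[OF _ eps2_1 _ D0])
    show "bigO G (\<lambda>_. 1) (\<lambda>p. \<chi> j. coeff (?A p j) i)" for i
      using w_1 by (cases i) (simp_all add: bigO_vec_iff)
    show "bigO G (\<lambda>_. 1) (\<lambda>p. \<chi> j. coeff (\<Phi> ?\<sigma> p j - ?A p j) 1)" unfolding D1 by (rule tangent_1)
  qed (simp_all add: vec_eq_iff)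
  moreover have "Fcoeff (?A p) 1 = 0" for p by (simp add: cev_const_curve vec_eq_iff)
  ultimately have 1: "bigO G eps2 (\<lambda>p. Fcoeff (\<Phi> ?\<sigma> p) 1 - J p *v tangent p)"
    unfolding D1 by simp
  have "bigO G (\<eta> 1) (\<lambda>p. Fcoeff (\<Phi> ?\<sigma> p) 1)"
    by (rule Phi_contact(1)[OF \<sigma>1]) (use mu in simp_all)
  from bigO_diff[OF this bigO_mono[OF 1 eps2_eta]] show ?thesis by simp
qed

lemma J_r1: "bigO G (\<eta> 1) (\<lambda>p. J p *v r\<^sub>1 p)"
  and tangent_r1: "bigO G (\<eta> 1) (\<lambda>p. tangent p - \<rho> p *s r\<^sub>1 p)"
  using alignment[OF J_eps min_dir J_tangent eta_lim _ tangent_norm tangent_1] kernel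
  by (simp_all add: \<rho>_def)

lemma rho_1: "bigO G (\<lambda>_. 1) \<rho>"
  unfolding \<rho>_def by (intro bigO_cdot_1 tangent_1 r1_1)

lemma rho_lower: "\<forall>\<^sub>F p in G. norm r / 4 \<le> norm (\<rho> p)"
proof -
  have "\<forall>\<^sub>F p in G. norm (tangent p - \<rho> p *s r\<^sub>1 p) \<le> norm r / 4"
    by (rule bigO_eventually_small[OF tangent_r1 eta_lim]) (use kernel in simp)
  then show ?thesis using tangent_norm min_dir
  proof eventually_elim
    case (elim p)
    have "norm (tangent p) \<le> norm (tangent p - \<rho> p *s r\<^sub>1 p) + norm (\<rho> p *s r\<^sub>1 p)"
      using norm_triangle_ineq[of "tangent p - \<rho> p *s r\<^sub>1 p" "\<rho> p *s r\<^sub>1 p"] by simp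
    then show ?case using elim by (simp add: norm_cmult_vec min_direction_def)
  qed
qed

lemma rho_nz: "\<forall>\<^sub>F p in G. \<rho> p \<noteq> 0"
  using rho_lower by eventually_elim (use kernel(2) in auto)

lemma inv_rho_1: "bigO G (\<lambda>_. 1) (\<lambda>p. inverse (\<rho> p))"
  by (rule bigO_inverse[OF _ rho_lower]) (use kernel(2) in simp)

text \<open>In \<open>tracks\<close> the reparametrisation \<open>\<sigma>\<close> is normalised so that the defects are orthogonal to
  \<open>r\<^sub>1\<close>, because the Jacobian controls only the components orthogonal to its smallest singular vector.\<close>

context
  fixes a :: "'p \<Rightarrow> nat \<Rightarrow> 'n cvec" and L :: "'p \<Rightarrow> nat \<Rightarrow> 'n diff_op"
begin

definition \<gamma> :: "nat \<Rightarrow> 'p \<Rightarrow> 'n \<Rightarrow> complex poly" where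
  "\<gamma> m p = xcurve (R p) (z p) (a p) m"

definition defect :: "nat \<Rightarrow> ('p \<Rightarrow> complex poly) \<Rightarrow> nat \<Rightarrow> 'p \<Rightarrow> 'n cvec" where
  "defect m \<sigma> k p = (\<chi> j. coeff (\<Phi> \<sigma> p j - \<gamma> m p j) k)"

definition tracks :: "nat \<Rightarrow> ('p \<Rightarrow> complex poly) \<Rightarrow> bool" where
  "tracks m \<sigma> \<longleftrightarrow> (\<forall>k. bigO G (\<lambda>_. 1) (\<lambda>p. coeff (\<sigma> p) k)) \<and> (\<forall>p. coeff (\<sigma> p) 0 = \<tau> p) \<and>
    (\<forall>p. coeff (\<sigma> p) 1 = inverse (\<rho> p)) \<and> (\<forall>p. \<forall>k\<ge>m. coeff (\<sigma> p) k = 0) \<and>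
    (\<forall>k<m. bigO G (\<eta> k) (defect m \<sigma> k)) \<and>
    (\<forall>k<m. 1 \<le> k \<longrightarrow> (\<forall>\<^sub>F p in G. cdot (defect m \<sigma> k p) (r\<^sub>1 p) = 0))"

definition P_vec :: "nat \<Rightarrow> 'p \<Rightarrow> 'n cvec" where
  "P_vec m p = apply_op_system (P_op (a p) (L p) m) (H p) (z p)"

definition M :: "nat \<Rightarrow> 'p \<Rightarrow> 'n cmat" where
  "M m p = bordered_matrix (P_op (a p) (L p) m) (H p) (z p)"

text \<open>What the computed curve ought to acquire in order \<open>m\<close>. Its first rotated
  coordinate has no term of order \<open>m \<ge> 2\<close>, so the part along
  \<open>r\<^sub>1\<close> cannot be matched and is removed.\<close>

definition e_orth :: "nat \<Rightarrow> ('p \<Rightarrow> complex poly) \<Rightarrow> 'p \<Rightarrow> 'n cvec" where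
  "e_orth m \<sigma> p = (let e = (\<chi> j. coeff (\<Phi> \<sigma> p j) m) in e - cdot e (r\<^sub>1 p) *s r\<^sub>1 p)"

lemma gamma_coeff:
  "(\<chi> j. coeff (\<gamma> m p j) k) = (if k = 0 then R p *v z p else if k = 1 then r\<^sub>1 p
    else if k < m then R p *v (a p k - a p k $ first_index *s axis first_index 1) else 0)"
  unfolding \<gamma>_def by (rule coeff_xcurve)

lemma gamma_0: "\<forall>\<^sub>F p in G. (\<chi> j. coeff (\<gamma> m p j) 0) = w p"
  using Rz by eventually_elim (simp add: gamma_coeff)

lemma defect_eq: "defect m \<sigma> k p = (\<chi> j. coeff (\<Phi> \<sigma> p j) k) - (\<chi> j. coeff (\<gamma> m p j) k)"
  by (simp add: defect_def vec_eq_iff)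

text \<open>The slope \<open>inverse (\<rho> p)\<close> gives the linear coefficient component one
  along \<open>r\<^sub>1\<close>, matching the first coordinate \<open>s\<close> of the computed
  curve.\<close>

lemma base_tracks: "tracks 2 (\<lambda>p. [:\<tau> p, inverse (\<rho> p):])"
proof -
  let ?\<sigma> = "\<lambda>p. [:\<tau> p, inverse (\<rho> p):]"
  have d0: "bigO G eps2 (defect 2 ?\<sigma> 0)"
  proof (rule bigO_cong[OF _ X_tau])
    show "\<forall>\<^sub>F p in G. (\<chi> j. poly (X j) (\<tau> p)) - w p = defect 2 ?\<sigma> 0 p"
      using gamma_0[of 2] by eventually_elim (simp add: defect_eq coeff_Phi_0)
  qed
  have d1: "defect 2 ?\<sigma> 1 p = inverse (\<rho> p) *s tangent p - r\<^sub>1 p" for p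
    unfolding defect_eq gamma_coeff coeff_Phi_1 by (simp add: vec_eq_iff tangent_def mult.commute)
  note d1' = d1[unfolded One_nat_def]
  have "bigO G (\<eta> 1) (\<lambda>p. inverse (\<rho> p) *s (tangent p - \<rho> p *s r\<^sub>1 p))"
    by (intro bigO_cmult_1 inv_rho_1 tangent_r1)
  moreover have "\<forall>\<^sub>F p in G. inverse (\<rho> p) *s (tangent p - \<rho> p *s r\<^sub>1 p) = defect 2 ?\<sigma> 1 p"
    using rho_nz by eventually_elim (simp add: d1' vec_eq_iff right_diff_distrib mult.assoc[symmetric])
  ultimately have D1: "bigO G (\<eta> 1) (defect 2 ?\<sigma> 1)" by (rule bigO_cong[rotated])
  have o: "\<forall>\<^sub>F p in G. cdot (defect 2 ?\<sigma> 1 p) (r\<^sub>1 p) = 0"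
    using rho_nz r1_norm
    by eventually_elim (simp add: d1' cdot_simps \<rho>_def[symmetric])
  have "bigO G (\<lambda>_. 1) (\<lambda>p. coeff (?\<sigma> p) k)" for k
    by (rule bigO_linear_coeff[OF tau_1 inv_rho_1])
  moreover have "\<forall>k\<ge>2. coeff (?\<sigma> p) k = 0" for p by (simp add: coeff_linear_eq_0)
  moreover have "bigO G (\<eta> k) (defect 2 ?\<sigma> k)" if "k < 2" for k
    using that D1 bigO_mono[OF d0 eps2_eta] by (auto simp: less_2_cases_iff)
  moreover have "\<forall>\<^sub>F p in G. cdot (defect 2 ?\<sigma> k p) (r\<^sub>1 p) = 0" if "k < 2" "1 \<le> k" for k
    using that o by (auto simp: less_2_cases_iff)
  ultimately show ?thesis unfolding tracks_def by simp
qed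

context
  fixes m :: nat and \<sigma> :: "'p \<Rightarrow> complex poly"
  assumes m: "2 \<le> m" "m \<le> \<mu>"
    and basis: "\<forall>\<^sub>F p in G. numerical_closed_basis (H p) (z p) m (a p) (L p)"
    and tracks: "tracks m \<sigma>"
begin

lemma sigma_1: "bigO G (\<lambda>_. 1) (\<lambda>p. coeff (\<sigma> p) k)"
  and sigma_0: "coeff (\<sigma> p) 0 = \<tau> p" and sigma_coeff_1: "coeff (\<sigma> p) 1 = inverse (\<rho> p)"
  and sigma_above: "m \<le> k \<Longrightarrow> coeff (\<sigma> p) k = 0"
  and defect_bound: "k < m \<Longrightarrow> bigO G (\<eta> k) (defect m \<sigma> k)"
  and defect_orth: "k < m \<Longrightarrow> 1 \<le> k \<Longrightarrow> \<forall>\<^sub>F p in G. cdot (defect m \<sigma> k p) (r\<^sub>1 p) = 0"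
  using tracks unfolding tracks_def by blast+

text \<open>Boundedness of the computed coefficients is inherited from the curve they track; scaling
  a singular vector to first entry one does not by itself bound the others.\<close>

lemma gamma_1: "bigO G (\<lambda>_. 1) (\<lambda>p. \<chi> j. coeff (\<gamma> m p j) k)"
proof (cases "k < m")
  case True
  have "bigO G (\<lambda>_. 1) (\<lambda>p. (\<chi> j. coeff (\<Phi> \<sigma> p j) k) - defect m \<sigma> k p)"
    by (intro bigO_diff Phi_1 sigma_1 bigO_mono[OF defect_bound[OF True] eta_1])
  then show ?thesis by (simp add: defect_eq)
next
  case False
  then show ?thesis using m by (simp add: gamma_coeff)
qed

lemma P_vec_gamma: "\<forall>\<^sub>F p in G. P_vec m p = Fcoeff (\<gamma> m p) m"
  using basis
proof eventually_elim
  case (elim p)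
  show ?case
    unfolding P_vec_def H_def \<gamma>_def
    by (rule apply_op_system_xcurve, rule closed_basis_P_lookup[OF elim]) (use m in auto)
qed

lemma defect_m: "defect m \<sigma> m p = (\<chi> j. coeff (\<Phi> \<sigma> p j) m)"
  using m by (simp add: defect_eq gamma_coeff)

text \<open>\<open>P_vec m\<close> is the coefficient of order \<open>m\<close> along the computed
  curve, which has no term of its own in that order yet. The comparison with the tracked curve
  therefore involves the full coefficient of the latter; its part along \<open>r\<^sub>1\<close> is
  dropped because the Jacobian nearly annihilates it.\<close>

lemma P_vec_1: "bigO G (\<lambda>_. 1) (P_vec m)"
  and P_vec_expansion: "bigO G (\<eta> (m - 1)) (\<lambda>p. Fcoeff (\<Phi> \<sigma> p) m - P_vec m p - J p *v e_orth m \<sigma> p)"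
proof -
  let ?e = "\<lambda>p. \<chi> j. coeff (\<Phi> \<sigma> p j) m"
  have d: "bigO G (\<eta> (m - 1)) (\<lambda>p. \<chi> j. coeff (\<Phi> \<sigma> p j - \<gamma> m p j) i)" if "i < m" for i
    using bigO_mono[OF defect_bound[OF that] eta_mono, of "m - 1"] that by (simp add: defect_def[abs_def])
  have dm: "bigO G (\<lambda>_. 1) (\<lambda>p. \<chi> j. coeff (\<Phi> \<sigma> p j - \<gamma> m p j) m)"
    unfolding defect_def[symmetric] defect_m by (rule Phi_1[OF sigma_1])
  have m1: "1 \<le> m" using m by simp
  note T = system_taylor[where A = "\<gamma> m" and B = "\<Phi> \<sigma>", OF m1 eta_1 gamma_1 d dm gamma_0]
  show "bigO G (\<lambda>_. 1) (P_vec m)"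
    by (rule bigO_cong[OF _ T(2)]) (use P_vec_gamma in \<open>auto elim: eventually_mono\<close>)
  have "bigO G (\<eta> (m - 1)) (\<lambda>p. Fcoeff (\<Phi> \<sigma> p) m - Fcoeff (\<gamma> m p) m - J p *v ?e p)"
    using T(1) by (simp only: defect_m[unfolded defect_def])
  moreover have "bigO G (\<eta> (m - 1)) (\<lambda>p. cdot (?e p) (r\<^sub>1 p) *s (J p *v r\<^sub>1 p))"
    using m by (intro bigO_cmult_1 bigO_cdot_1 Phi_1 sigma_1 r1_1 bigO_mono[OF J_r1 eta_mono]) simp
  ultimately have "bigO G (\<eta> (m - 1)) (\<lambda>p. (Fcoeff (\<Phi> \<sigma> p) m - Fcoeff (\<gamma> m p) m - J p *v ?e p) +
    cdot (?e p) (r\<^sub>1 p) *s (J p *v r\<^sub>1 p))" by (rule bigO_add)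
  moreover have "\<forall>\<^sub>F p in G. (Fcoeff (\<Phi> \<sigma> p) m - Fcoeff (\<gamma> m p) m - J p *v ?e p) +
    cdot (?e p) (r\<^sub>1 p) *s (J p *v r\<^sub>1 p) = Fcoeff (\<Phi> \<sigma> p) m - P_vec m p - J p *v e_orth m \<sigma> p"
    using P_vec_gamma
    by eventually_elim
      (simp add: e_orth_def Let_def matrix_vector_mult_diff_distrib vector_scalar_commute)
  ultimately show "bigO G (\<eta> (m - 1)) (\<lambda>p. Fcoeff (\<Phi> \<sigma> p) m - P_vec m p - J p *v e_orth m \<sigma> p)"
    by (rule bigO_cong[rotated])
qed

lemma e_orth_1: "bigO G (\<lambda>_. 1) (e_orth m \<sigma>)"
  unfolding e_orth_def Let_def by (intro bigO_diff bigO_cmult_1 bigO_cdot_1 Phi_1 sigma_1 r1_1)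

lemma e_orth_orth: "\<forall>\<^sub>F p in G. cdot (e_orth m \<sigma> p) (r\<^sub>1 p) = 0"
  using r1_norm by eventually_elim (simp add: e_orth_def Let_def cdot_simps)

lemma M_mult: "\<forall>\<^sub>F p in G. \<forall>h. M m p *v h = h $ first_index *s P_vec m p +
    J p *v (R p *v (h - h $ first_index *s axis first_index 1))"
  using Rz
proof eventually_elim
  case (elim p)
  show ?case using elim unfolding M_def P_vec_def H_def by (simp add: bordered_matrix_mult)
qed

text \<open>The test vector for the singular vector of stage \<open>m\<close>. The matrix sends it
  to \<open>P_vec m p + J p *v e_orth m \<sigma> p\<close>, which by the expansion is close to the
  coefficient of the system along the tracked curve, and this is small for
  \<open>m < \<mu>\<close>.\<close>

definition g :: "'p \<Rightarrow> 'n cvec" where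
  "g p = axis first_index 1 + conj_transpose (R p) *v e_orth m \<sigma> p"

lemma g_eq: "\<forall>\<^sub>F p in G. g p $ first_index = 1 \<and> R p *v (g p - axis first_index 1) = e_orth m \<sigma> p"
  using unitary e_orth_orth
  by eventually_elim (simp add: g_def unitary_facts axis_def)

lemma g_1: "bigO G (\<lambda>_. 1) g"
proof -
  have "bigO G (\<lambda>_. 1) (\<lambda>p. conj_transpose (R p) *v e_orth m \<sigma> p)"
    by (rule bigO_le[OF e_orth_1, where K = 1], rule eventually_mono[OF unitary]) (simp add: unitary_facts)
  from bigO_add[OF bigO_const this] show ?thesis by (simp add: g_def[abs_def])
qed

text \<open>Without first entry, the matrix acts as the Jacobian on the complement of
  \<open>r\<^sub>1\<close>; a first entry adds only a multiple of the bounded vector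
  \<open>P_vec m p\<close>. This is the input of the alignment lemma with the first entry as
  functional.\<close>

lemma M_nondegenerate:
  "\<exists>K. \<forall>\<^sub>F p in G. \<forall>h. norm h \<le> K * (norm (M m p *v h) + norm (h $ first_index))"
proof -
  obtain K where K: "K > 0" "\<forall>\<^sub>F p in G. \<forall>\<alpha> u. cdot u (r\<^sub>1 p) = 0 \<longrightarrow> norm \<alpha> + norm u \<le> K * norm (\<alpha> *s c + J p *v u)"
    by (rule orth_full_rank[OF J_eps min_dir])
  obtain C where C: "C > 0" "\<forall>\<^sub>F p in G. norm (P_vec m p) \<le> C * \<bar>1\<bar>" by (rule bigOE[OF P_vec_1])
  have "\<forall>\<^sub>F p in G. \<forall>h. norm h \<le> (K + K * C + 1) * (norm (M m p *v h) + norm (h $ first_index))"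
    using K(2) C(2) unitary M_mult
  proof eventually_elim
    case (elim p)
    show ?case
    proof
      fix h :: "'n cvec"
      let ?f = "h $ first_index"
      define h0 where "h0 = h - ?f *s axis first_index 1"
      have "h0 $ first_index = 0" by (simp add: h0_def axis_def)
      then have "cdot (R p *v h0) (r\<^sub>1 p) = 0" using elim(3) by (simp add: unitary_facts)
      then have "norm (R p *v h0) \<le> K * norm (J p *v (R p *v h0))"
        using elim(1)[rule_format, of "R p *v h0" 0] by simp
      moreover have "J p *v (R p *v h0) = M m p *v h - ?f *s P_vec m p"
        using elim(4)[rule_format, of h] by (simp add: h0_def)
      moreover have "norm (M m p *v h - ?f *s P_vec m p) \<le> norm (M m p *v h) + norm ?f * C"
        using norm_triangle_ineq4[of "M m p *v h" "?f *s P_vec m p"] mult_left_mono[OF elim(2), of "norm ?f"]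
        by (simp add: norm_cmult_vec)
      ultimately have "norm h0 \<le> K * (norm (M m p *v h) + norm ?f * C)"
        using elim(3) K(1) by (smt (verit) mult_left_mono unitary_facts(3))
      moreover have "norm h \<le> norm h0 + norm ?f"
        using norm_triangle_ineq[of h0 "?f *s axis first_index 1"]
        by (simp add: h0_def norm_cmult_vec)
      ultimately have "norm h \<le> K * norm (M m p *v h) + (K * C + 1) * norm ?f"
        by (simp add: algebra_simps)
      moreover have "K * norm (M m p *v h) \<le> (K + K * C + 1) * norm (M m p *v h)"
        using K(1) C(1) by (intro mult_right_mono) auto
      moreover have "(K * C + 1) * norm ?f \<le> (K + K * C + 1) * norm ?f"
        using K(1) C(1) by (intro mult_right_mono) auto
      ultimately show "norm h \<le> (K + K * C + 1) * (norm (M m p *v h) + norm ?f)"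
        unfolding distrib_left by linarith
    qed
  qed
  then show ?thesis by blast
qed

lemma M_g:
  assumes "m < \<mu>"
  shows "bigO G (\<eta> m) (\<lambda>p. M m p *v g p)"
proof -
  have "bigO G (\<eta> m) (\<lambda>p. Fcoeff (\<Phi> \<sigma> p) m - (Fcoeff (\<Phi> \<sigma> p) m - P_vec m p - J p *v e_orth m \<sigma> p))"
    by (intro bigO_diff[OF Phi_contact(1)[OF sigma_1 sigma_0 assms] bigO_mono[OF P_vec_expansion eta_mono]]) simp
  then show ?thesis
    by (rule bigO_cong[rotated])
      (use M_mult g_eq in \<open>eventually_elim, simp\<close>)
qed

lemma min_direction_M:
  assumes mu: "m < \<mu>" and v: "\<forall>\<^sub>F p in G. min_direction (M m p) (v p)"
  shows "\<forall>\<^sub>F p in G. v p $ first_index \<noteq> 0"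
    and "bigO G (\<eta> m) (\<lambda>p. g p - inverse (v p $ first_index) *s v p)"
proof -
  obtain K where K: "\<forall>\<^sub>F p in G. \<forall>h. norm h \<le> K * (norm (M m p *v h) + norm (h $ first_index))"
    using M_nondegenerate by blast
  have n: "\<forall>\<^sub>F p in G. 1 \<le> norm (g p)"
    using g_eq by eventually_elim (metis Finite_Cartesian_Product.norm_nth_le norm_one)
  have f: "bigO G (\<lambda>_. 1) (\<lambda>p. g p $ first_index)" using g_1 by (simp add: bigO_vec_iff)
  note al = min_direction_alignment[OF K _ v M_g[OF mu] eta_lim _ n f]
  have "\<exists>b>0. \<forall>\<^sub>F p in G. b \<le> norm (v p $ first_index)" by (rule al(2)) simp_all
  then obtain b where b: "b > 0" "\<forall>\<^sub>F p in G. b \<le> norm (v p $ first_index)" by blast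
  show "\<forall>\<^sub>F p in G. v p $ first_index \<noteq> 0"
    using b(2) by eventually_elim (use b(1) in auto)
  have "bigO G (\<eta> m) (\<lambda>p. g p - (g p $ first_index / v p $ first_index) *s v p)"
    by (rule al(3)) simp_all
  then show "bigO G (\<eta> m) (\<lambda>p. g p - inverse (v p $ first_index) *s v p)"
    by (rule bigO_cong[rotated]) (use g_eq in \<open>eventually_elim, simp add: inverse_eq_divide\<close>)
qed

lemma scaled_vector_exists:
  assumes "m < \<mu>"
  shows "\<forall>\<^sub>F p in G. \<exists>b. scaled_min_right_singular_vector (M m p) b"
proof -
  define v where "v p = (SOME v. min_direction (M m p) v)" for p
  have v: "min_direction (M m p) (v p)" for p
    unfolding v_def by (rule someI_ex[OF min_direction_exists])
  show ?thesis
    using min_direction_M(1)[OF assms always_eventually[OF allI[OF v]]]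
  proof eventually_elim
    case (elim p)
    then have "scaled_min_right_singular_vector (M m p) (inverse (v p $ first_index) *s v p)"
      unfolding scaled_min_right_singular_vector_def right_singular_vector_min
      by (intro exI[of _ "v p"] conjI v refl)
    then show ?case by (rule exI)
  qed
qed

text \<open>Alignment makes \<open>a p m\<close> agree with \<open>g p\<close>, which matches the
  tracked curve only orthogonally to \<open>r\<^sub>1\<close>. The part along
  \<open>r\<^sub>1\<close> is moved into the parametrisation by a new term of order \<open>m\<close>
  in \<sigma>.\<close>

lemma tracks_step:
  assumes mu: "m < \<mu>" and sc: "\<forall>\<^sub>F p in G. scaled_min_right_singular_vector (M m p) (a p m)"
  shows "\<exists>\<sigma>'. tracks (Suc m) \<sigma>'"
proof -
  define v where "v p = (SOME v. min_direction (M m p) v \<and> v $ first_index \<noteq> 0 \<and> a p m = inverse (v $ first_index) *s v)" for p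
  have v: "\<forall>\<^sub>F p in G. min_direction (M m p) (v p) \<and> v p $ first_index \<noteq> 0 \<and> a p m = inverse (v p $ first_index) *s v p"
    using sc
  proof eventually_elim
    case (elim p)
    then have "\<exists>v. min_direction (M m p) v \<and> v $ first_index \<noteq> 0 \<and> a p m = inverse (v $ first_index) *s v"
      unfolding scaled_min_right_singular_vector_def right_singular_vector_min .
    then show ?case unfolding v_def by (rule someI_ex)
  qed
  have am: "\<forall>\<^sub>F p in G. a p m $ first_index = 1"
    using v by eventually_elim simp
  have "\<forall>\<^sub>F p in G. min_direction (M m p) (v p)" using v by eventually_elim simp
  from min_direction_M(2)[OF mu this] have ga: "bigO G (\<eta> m) (\<lambda>p. g p - a p m)"
    by (rule bigO_cong[rotated]) (use v in \<open>eventually_elim, simp\<close>)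
  have Rga: "bigO G (\<eta> m) (\<lambda>p. R p *v (g p - a p m))"
    by (rule bigO_le[OF ga, where K = 1], rule eventually_mono[OF unitary]) (simp add: unitary_facts)
  define e where "e p = (\<chi> j. coeff (\<Phi> \<sigma> p j) m)" for p
  \<comment> \<open>Chosen so that \<open>t p *s tangent p\<close> cancels the component of
    \<open>e p\<close> along \<open>r\<^sub>1\<close>, the tangent having component
    \<open>\<rho> p\<close> there.\<close>
  define t where "t p = - (cdot (e p) (r\<^sub>1 p) * inverse (\<rho> p))" for p
  define \<sigma>' where "\<sigma>' p = \<sigma> p + monom (t p) m" for p
  have e1: "bigO G (\<lambda>_. 1) e" unfolding e_def by (rule Phi_1[OF sigma_1])
  have er: "bigO G (\<lambda>_. 1) (\<lambda>p. cdot (e p) (r\<^sub>1 p) * inverse (\<rho> p))"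
    by (intro bigO_mult_1 inv_rho_1 bigO_cdot_1 e1 r1_1)
  then have t1: "bigO G (\<lambda>_. 1) t" unfolding t_def by (rule bigO_minus)
  have m1: "1 \<le> m" using m by simp
  have \<Phi>_lt: "coeff (\<Phi> \<sigma>' p j) k = coeff (\<Phi> \<sigma> p j) k" if "k < m" for p j k
    unfolding \<Phi>_def \<sigma>'_def by (rule coeff_pcompose_add_monom(1)[OF m1 that])
  have \<Phi>_m: "(\<chi> j. coeff (\<Phi> \<sigma>' p j) m) = e p + t p *s tangent p" for p
    unfolding \<Phi>_def \<sigma>'_def coeff_pcompose_add_monom(2)[OF m1] sigma_0
    by (simp add: vec_eq_iff e_def \<Phi>_def tangent_def)
  have d_lt: "defect (Suc m) \<sigma>' k = defect m \<sigma> k" if "k < m" for k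
    unfolding fun_eq_iff defect_eq gamma_coeff using that by (simp add: \<Phi>_lt)
  have d_m: "defect (Suc m) \<sigma>' m p = e p + t p *s tangent p - R p *v (a p m - a p m $ first_index *s axis first_index 1)" for p
    unfolding defect_eq \<Phi>_m gamma_coeff using m by simp
  have "bigO G (\<eta> m) (\<lambda>p. R p *v (g p - a p m) -
    (cdot (e p) (r\<^sub>1 p) * inverse (\<rho> p)) *s (tangent p - \<rho> p *s r\<^sub>1 p))"
    by (intro bigO_diff Rga bigO_cmult_1 er bigO_mono[OF tangent_r1 eta_mono] m1)
  moreover have "\<forall>\<^sub>F p in G. R p *v (g p - a p m) -
    (cdot (e p) (r\<^sub>1 p) * inverse (\<rho> p)) *s (tangent p - \<rho> p *s r\<^sub>1 p) = defect (Suc m) \<sigma>' m p"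
    using am g_eq rho_nz
  proof eventually_elim
    case (elim p)
    have "R p *v (g p - a p m) = R p *v (g p - axis first_index 1) - R p *v (a p m - axis first_index 1)"
      by (simp add: matrix_vector_mult_diff_distrib)
    also have "\<dots> = e p - cdot (e p) (r\<^sub>1 p) *s r\<^sub>1 p - R p *v (a p m - axis first_index 1)"
      using elim(2) by (simp add: e_orth_def e_def Let_def)
    finally have 1: "R p *v (g p - a p m) = e p - cdot (e p) (r\<^sub>1 p) *s r\<^sub>1 p - R p *v (a p m - axis first_index 1)" .
    have 2: "(cdot (e p) (r\<^sub>1 p) * inverse (\<rho> p)) *s (tangent p - \<rho> p *s r\<^sub>1 p) =
      - (t p *s tangent p) - cdot (e p) (r\<^sub>1 p) *s r\<^sub>1 p"
      using elim(3) by (simp add: t_def vec_eq_iff algebra_simps)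
    show ?case unfolding 1 2 d_m using elim(1) by simp
  qed
  ultimately have dm: "bigO G (\<eta> m) (defect (Suc m) \<sigma>' m)" by (rule bigO_cong[rotated])
  have om: "\<forall>\<^sub>F p in G. cdot (defect (Suc m) \<sigma>' m p) (r\<^sub>1 p) = 0"
    using unitary rho_nz
  proof eventually_elim
    case (elim p)
    have "cdot (R p *v (a p m - a p m $ first_index *s axis first_index 1)) (r\<^sub>1 p) = 0"
      using elim(1) by (simp add: unitary_facts axis_def)
    then show ?case
      using elim(2) unfolding d_m cdot_simps t_def \<rho>_def[symmetric] by simp
  qed
  have \<sigma>'1: "bigO G (\<lambda>_. 1) (\<lambda>p. coeff (\<sigma>' p) k)" for k
    unfolding \<sigma>'_def coeff_add coeff_monom
    using t1 by (cases "m = k") (simp_all add: bigO_add sigma_1)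
  have "tracks (Suc m) \<sigma>'"
    unfolding tracks_def
  proof (intro conjI allI impI)
    show "bigO G (\<lambda>_. 1) (\<lambda>p. coeff (\<sigma>' p) k)" for k by (rule \<sigma>'1)
    show "coeff (\<sigma>' p) 0 = \<tau> p" for p using m by (simp add: \<sigma>'_def sigma_0)
    show "coeff (\<sigma>' p) 1 = inverse (\<rho> p)" for p
      using m sigma_coeff_1 by (simp add: \<sigma>'_def)
    show "coeff (\<sigma>' p) k = 0" if "Suc m \<le> k" for p k
      using that by (simp add: \<sigma>'_def sigma_above)
    show "bigO G (\<eta> k) (defect (Suc m) \<sigma>' k)" if "k < Suc m" for k
      using that dm defect_bound[of k] by (cases "k = m") (simp_all add: d_lt)
    show "\<forall>\<^sub>F p in G. cdot (defect (Suc m) \<sigma>' k p) (r\<^sub>1 p) = 0" if "k < Suc m" "1 \<le> k" for k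
      using that om defect_orth[of k] by (cases "k = m") (simp_all add: d_lt)
  qed
  then show ?thesis by blast
qed

end

lemma tracks_exists:
  assumes "2 \<le> m" "m \<le> \<mu>" "\<forall>\<^sub>F p in G. numerical_closed_basis (H p) (z p) m (a p) (L p)"
  shows "\<exists>\<sigma>. tracks m \<sigma>"
  using assms
proof (induction m rule: nat_induct_at_least)
  case base
  show ?case using base_tracks by blast
next
  case (Suc m)
  have B: "\<forall>\<^sub>F p in G. numerical_closed_basis (H p) (z p) m (a p) (L p)"
    using Suc.prems(2) by eventually_elim (rule closed_basis_mono)
  then obtain \<sigma> where \<sigma>: "tracks m \<sigma>" using Suc by auto
  have "\<forall>\<^sub>F p in G. scaled_min_right_singular_vector (M m p) (a p m)"
    using Suc.prems(2)
  proof eventually_elim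
    case (elim p)
    then show ?case using Suc.hyps unfolding numerical_closed_basis_def M_def by simp
  qed
  then show ?case using tracks_step[OF Suc.hyps(1) _ B \<sigma>] Suc.prems(1) by simp
qed

text \<open>Along the contact curve \<open>F\<close> is \<open>c t ^ \<mu>\<close> to leading order. Comparing the coefficients of order
  \<open>\<mu> - 1\<close> and \<open>\<mu>\<close> of \<open>c \<sigma> ^ \<mu>\<close> identifies the first component of the solution in step 4 as
  \<open>- \<mu> \<tau> \<rho>\<close> up to \<open>O(\<epsilon>\<^sup>2)\<close>.\<close>

context
  assumes basis: "\<forall>\<^sub>F p in G. numerical_closed_basis (H p) (z p) \<mu> (a p) (L p)"
begin

text \<open>Up to O(\<open>eps\<close>), \<open>P_vec \<mu> p\<close> is a nonzero multiple of
  \<open>c\<close> minus an image under the Jacobian, so the matrix inherits its nondegeneracy from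
  \<open>c\<close> being outside the range. The deviation \<delta> is absorbed for small
  \<open>eps\<close>.\<close>

lemma M_final_bound:
  assumes \<sigma>: "tracks \<mu> \<sigma>"
  shows "\<exists>K>0. \<forall>\<^sub>F p in G. \<forall>h. norm (h $ first_index) \<le> K * norm (M \<mu> p *v h)"
    and "\<forall>\<^sub>F p in G. \<forall>h. M \<mu> p *v h = 0 \<longrightarrow> h = 0"
proof -
  note ctx = mu order_refl basis \<sigma>
  let ?f = "first_index :: 'n"
  define \<delta> where "\<delta> p = P_vec \<mu> p + J p *v e_orth \<mu> \<sigma> p - inverse (\<rho> p) ^ \<mu> *s c" for p
  have "bigO G eps (\<lambda>p. (Fcoeff (\<Phi> \<sigma> p) \<mu> - coeff (\<sigma> p) 1 ^ \<mu> *s c) -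
    (Fcoeff (\<Phi> \<sigma> p) \<mu> - P_vec \<mu> p - J p *v e_orth \<mu> \<sigma> p))"
    by (intro bigO_diff Phi_contact(3) sigma_1[OF ctx] sigma_0[OF ctx]
      bigO_mono[OF P_vec_expansion[OF ctx] eta_eps])
  then have \<delta>: "bigO G eps \<delta>"
    unfolding \<delta>_def[abs_def] by (simp add: sigma_coeff_1[OF ctx, unfolded One_nat_def] algebra_simps)
  obtain C where C: "C > 0" "\<forall>\<^sub>F p in G. norm (\<delta> p) \<le> C * \<bar>eps p\<bar>" by (rule bigOE[OF \<delta>])
  obtain K where K: "K > 0" "\<forall>\<^sub>F p in G. \<forall>\<alpha> u. cdot u (r\<^sub>1 p) = 0 \<longrightarrow> norm \<alpha> + norm u \<le> K * norm (\<alpha> *s c + J p *v u)"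
    by (rule orth_full_rank[OF J_eps min_dir])
  obtain B where B: "B > 0" "\<forall>\<^sub>F p in G. norm (\<rho> p) \<le> B * \<bar>1\<bar>" by (rule bigOE[OF rho_1])
  \<comment> \<open>\<open>B ^ \<mu>\<close> undoes the factor
    \<open>inverse (\<rho> p) ^ \<mu>\<close> between the first entry and \<alpha>; \<open>K\<close>
    is the bound on the complement of \<open>r\<^sub>1\<close>.\<close>
  define D where "D = B ^ \<mu> * K"
  have D: "D > 0" using B(1) K(1) by (simp add: D_def)
  have "\<forall>\<^sub>F p in G. norm (\<delta> p) \<le> 1 / (2 * D)"
    by (rule bigO_eventually_small[OF \<delta> eps_lim]) (use D in simp)
  with K(2) B(2) unitary rho_nz M_mult[OF ctx] e_orth_orth[OF ctx]
  have main: "\<forall>\<^sub>F p in G. \<forall>h. norm (h $ ?f) \<le> (2 * D) * norm (M \<mu> p *v h) \<and> (M \<mu> p *v h = 0 \<longrightarrow> h = 0)"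
  proof eventually_elim
    case (elim p)
    show ?case
    proof
      fix h :: "'n cvec"
      define h0 where "h0 = h - h $ ?f *s axis ?f 1"
      define \<alpha> where "\<alpha> = h $ ?f * inverse (\<rho> p) ^ \<mu>"
      define u where "u = R p *v h0 - h $ ?f *s e_orth \<mu> \<sigma> p"
      have "h0 $ ?f = 0" by (simp add: h0_def axis_def)
      then have u: "cdot u (r\<^sub>1 p) = 0"
        using elim(3,6) by (simp add: u_def cdot_simps unitary_facts)
      have "M \<mu> p *v h = h $ ?f *s P_vec \<mu> p + J p *v (R p *v h0)"
        using elim(5) by (simp add: h0_def)
      then have Mh: "\<alpha> *s c + J p *v u = M \<mu> p *v h - h $ ?f *s \<delta> p"
        by (simp add: \<alpha>_def \<delta>_def u_def matrix_vector_mult_diff_distrib vector_scalar_commute vec_eq_iff algebra_simps)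
      have "norm \<alpha> + norm u \<le> K * norm (M \<mu> p *v h - h $ ?f *s \<delta> p)"
        using elim(1)[rule_format, OF u, of \<alpha>] unfolding Mh .
      also have "\<dots> \<le> K * (norm (M \<mu> p *v h) + norm (h $ ?f) * norm (\<delta> p))"
        using K(1) norm_triangle_ineq4[of "M \<mu> p *v h" "h $ ?f *s \<delta> p"]
        by (intro mult_left_mono) (simp_all add: norm_cmult_vec)
      finally have au: "norm \<alpha> + norm u \<le> K * (norm (M \<mu> p *v h) + norm (h $ ?f) * norm (\<delta> p))" .
      then have \<alpha>_le: "norm \<alpha> \<le> K * (norm (M \<mu> p *v h) + norm (h $ ?f) * norm (\<delta> p))"
        using norm_ge_zero[of u] by linarith
      have "norm (h $ ?f) = norm (\<rho> p) ^ \<mu> * norm \<alpha>"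
        using elim(4) by (simp add: \<alpha>_def norm_mult norm_power norm_inverse power_inverse)
      also have "\<dots> \<le> B ^ \<mu> * norm \<alpha>"
        using elim(2) by (intro mult_right_mono power_mono) auto
      also have "\<dots> \<le> B ^ \<mu> * (K * (norm (M \<mu> p *v h) + norm (h $ ?f) * norm (\<delta> p)))"
        using \<alpha>_le B(1) by (intro mult_left_mono) auto
      also have "\<dots> = D * norm (M \<mu> p *v h) + D * norm (h $ ?f) * norm (\<delta> p)"
        by (simp add: D_def algebra_simps)
      finally have "norm (h $ ?f) \<le> D * norm (M \<mu> p *v h) + D * norm (h $ ?f) * norm (\<delta> p)" .
      moreover have "D * norm (h $ ?f) * norm (\<delta> p) \<le> D * norm (h $ ?f) * (1 / (2 * D))"
        using elim(7) D by (intro mult_left_mono) auto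
      moreover have "D * norm (h $ ?f) * (1 / (2 * D)) = norm (h $ ?f) / 2" using D by simp
      ultimately have 1: "norm (h $ ?f) \<le> (2 * D) * norm (M \<mu> p *v h)" by simp
      moreover have "h = 0" if "M \<mu> p *v h = 0"
      proof -
        have hf: "h $ ?f = 0" using 1 that by simp
        have "norm \<alpha> + norm u \<le> 0" using au that hf by simp
        then have "norm u \<le> 0" using norm_ge_zero[of \<alpha>] by linarith
        then have "R p *v h = 0" by (simp add: u_def h0_def hf)
        then have "norm h = 0" using unitary_facts(3)[OF elim(3), of h] by simp
        then show ?thesis by simp
      qed
      ultimately show "norm (h $ ?f) \<le> (2 * D) * norm (M \<mu> p *v h) \<and> (M \<mu> p *v h = 0 \<longrightarrow> h = 0)"
        by blast
    qed
  qed
  show "\<exists>K>0. \<forall>\<^sub>F p in G. \<forall>h. norm (h $ ?f) \<le> K * norm (M \<mu> p *v h)"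
    by (rule exI[of _ "2 * D"]) (use D main in \<open>auto elim: eventually_mono\<close>)
  show "\<forall>\<^sub>F p in G. \<forall>h. M \<mu> p *v h = 0 \<longrightarrow> h = 0"
    using main by eventually_elim blast
qed

lemma final_system_solvable: "\<forall>\<^sub>F p in G. \<forall>b. \<exists>v. M \<mu> p *v v = b"
proof -
  obtain \<sigma> where \<sigma>: "tracks \<mu> \<sigma>" using tracks_exists[OF mu order_refl basis] by blast
  show ?thesis
    using M_final_bound(2)[OF \<sigma>]
  proof eventually_elim
    case (elim p)
    obtain N where "N ** M \<mu> p = mat 1"
      using iffD2[OF matrix_left_invertible_ker elim] by blast
    then have "M \<mu> p ** N = mat 1" by (simp only: matrix_left_right_inverse)
    then have "M \<mu> p *v (N *v b) = b" for b by (simp add: matrix_vector_mul_assoc)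
    then show ?case by (intro allI exI)
  qed
qed

lemma refined_error:
  assumes v: "\<forall>\<^sub>F p in G. M \<mu> p *v v p = - apply_op_system (L p (\<mu> - 1)) (H p) (z p)"
  shows "bigO G eps2 (\<lambda>p. w p + (v p $ first_index / of_nat \<mu>) *s r\<^sub>1 p - x_e)"
proof -
  obtain \<sigma> where \<sigma>: "tracks \<mu> \<sigma>" using tracks_exists[OF mu order_refl basis] by blast
  note ctx = mu order_refl basis \<sigma>
  let ?f = "first_index :: 'n" and ?d = "defect \<mu> \<sigma> (\<mu> - 1)"
  let ?L = "\<lambda>p. apply_op_system (L p (\<mu> - 1)) (H p) (z p)"
  \<comment> \<open>Makes \<open>\<beta> p * inverse (\<rho> p) ^ \<mu>\<close> the factor of
    \<open>c\<close> in the coefficient of order \<open>\<mu> - 1\<close>, so that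
    \<open>- h p\<close> nearly solves the linear system.\<close>
  define \<beta> where "\<beta> p = of_nat \<mu> * \<tau> p * \<rho> p" for p
  \<comment> \<open>The defect of order \<open>\<mu> - 1\<close> is merely O(\<open>eps\<close>), so
    it is built into the approximate solution; being orthogonal to \<open>r\<^sub>1\<close>, it does
    not touch the first entry of \<open>h p\<close>.\<close>
  define u where "u p = \<beta> p *s e_orth \<mu> \<sigma> p - ?d p" for p
  define h where "h p = \<beta> p *s axis ?f 1 + conj_transpose (R p) *v u p" for p
  have L: "\<forall>\<^sub>F p in G. ?L p = Fcoeff (\<gamma> \<mu> p) (\<mu> - 1)"
    using basis
  proof eventually_elim
    case (elim p)
    show ?case
      unfolding H_def \<gamma>_def
      by (rule apply_op_system_xcurve, rule closed_basis_lookup[OF elim]) (use mu in auto)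
  qed
  have d_orth: "\<forall>\<^sub>F p in G. cdot (?d p) (r\<^sub>1 p) = 0"
    by (rule defect_orth[OF ctx]) (use mu in auto)
  have d1: "bigO G (\<lambda>_. 1) ?d"
    by (rule bigO_mono[OF defect_bound[OF ctx] eta_1]) (use mu in simp)
  have "bigO G eps2 (\<lambda>p. Fcoeff (\<Phi> \<sigma> p) (\<mu> - 1) - Fcoeff (\<gamma> \<mu> p) (\<mu> - 1) -
    J p *v (\<chi> j. coeff (\<Phi> \<sigma> p j - \<gamma> \<mu> p j) (\<mu> - 1)))"
  proof (rule system_taylor(1)[where A = "\<gamma> \<mu>" and B = "\<Phi> \<sigma>", OF _ eps2_1 gamma_1[OF ctx] _ _ gamma_0])
    \<comment> \<open>Quadratic agreement is required only strictly below order
      \<open>\<mu> - 1\<close>; in that order itself boundedness of the defect is enough.\<close>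
    show "bigO G eps2 (\<lambda>p. \<chi> j. coeff (\<Phi> \<sigma> p j - \<gamma> \<mu> p j) i)" if "i < \<mu> - 1" for i
    proof -
      have "i < \<mu>" and e: "\<eta> i = eps2" using that by (auto simp: \<eta>_def)
      from defect_bound[OF ctx this(1)] show ?thesis unfolding e defect_def[abs_def] .
    qed
    show "bigO G (\<lambda>_. 1) (\<lambda>p. \<chi> j. coeff (\<Phi> \<sigma> p j - \<gamma> \<mu> p j) (\<mu> - 1))"
      using d1 unfolding defect_def[abs_def] .
  qed (use mu in simp)
  then have T: "bigO G eps2 (\<lambda>p. Fcoeff (\<Phi> \<sigma> p) (\<mu> - 1) - Fcoeff (\<gamma> \<mu> p) (\<mu> - 1) - J p *v ?d p)"
    unfolding defect_def[symmetric] .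
  have Fm: "bigO G eps2 (\<lambda>p. Fcoeff (\<Phi> \<sigma> p) (\<mu> - 1) - (of_nat \<mu> * \<tau> p * coeff (\<sigma> p) 1 ^ (\<mu> - 1)) *s c)"
    by (rule Phi_contact(2)[OF sigma_1[OF ctx] sigma_0[OF ctx]])
  have \<beta>: "bigO G eps \<beta>"
    unfolding \<beta>_def[abs_def] by (intro bigO_mult_1(1)[OF _ rho_1] bigO_mult_1(2)[OF bigO_const tau])
  have "bigO G eps (\<lambda>p. (Fcoeff (\<Phi> \<sigma> p) \<mu> - coeff (\<sigma> p) 1 ^ \<mu> *s c) -
    (Fcoeff (\<Phi> \<sigma> p) \<mu> - P_vec \<mu> p - J p *v e_orth \<mu> \<sigma> p))"
    by (intro bigO_diff Phi_contact(3) sigma_1[OF ctx] sigma_0[OF ctx]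
      bigO_mono[OF P_vec_expansion[OF ctx] eta_eps])
  \<comment> \<open>An expansion up to O(\<open>eps\<close>) suffices in order \<mu>, since
    multiplication by \<beta> supplies the second factor.\<close>
  then have "bigO G eps2 (\<lambda>p. \<beta> p *s ((Fcoeff (\<Phi> \<sigma> p) \<mu> - coeff (\<sigma> p) 1 ^ \<mu> *s c) -
    (Fcoeff (\<Phi> \<sigma> p) \<mu> - P_vec \<mu> p - J p *v e_orth \<mu> \<sigma> p)))"
    by (rule bigO_cmult[OF \<beta>])
  from bigO_add[OF bigO_diff[OF this Fm] T]
  have Mh: "bigO G eps2 (\<lambda>p. M \<mu> p *v (v p + h p))"
  proof (rule bigO_cong[rotated])
    show "\<forall>\<^sub>F p in G. \<beta> p *s ((Fcoeff (\<Phi> \<sigma> p) \<mu> - coeff (\<sigma> p) 1 ^ \<mu> *s c) -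
      (Fcoeff (\<Phi> \<sigma> p) \<mu> - P_vec \<mu> p - J p *v e_orth \<mu> \<sigma> p)) -
      (Fcoeff (\<Phi> \<sigma> p) (\<mu> - 1) - (of_nat \<mu> * \<tau> p * coeff (\<sigma> p) 1 ^ (\<mu> - 1)) *s c) +
      (Fcoeff (\<Phi> \<sigma> p) (\<mu> - 1) - Fcoeff (\<gamma> \<mu> p) (\<mu> - 1) - J p *v ?d p) = M \<mu> p *v (v p + h p)"
      using v L M_mult[OF ctx] unitary rho_nz e_orth_orth[OF ctx] d_orth
    proof eventually_elim
      case (elim p)
      have "cdot (u p) (r\<^sub>1 p) = 0"
        using elim(6,7) by (simp add: u_def cdot_simps)
      then have hf: "h p $ ?f = \<beta> p"
        using elim(4) by (simp add: h_def unitary_facts axis_def)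
      then have "R p *v (h p - h p $ ?f *s axis ?f 1) = u p"
        using elim(4) by (simp add: h_def unitary_facts)
      then have Mhp: "M \<mu> p *v h p = \<beta> p *s P_vec \<mu> p + J p *v u p"
        using elim(3)[rule_format, of "h p"] hf by simp
      have "coeff (\<sigma> p) 1 ^ \<mu> = coeff (\<sigma> p) 1 ^ (\<mu> - 1) * coeff (\<sigma> p) 1"
        using mu by (metis Suc_diff_1 less_le_trans pos2 power_Suc2)
      then have "\<beta> p * coeff (\<sigma> p) 1 ^ \<mu> = of_nat \<mu> * \<tau> p * coeff (\<sigma> p) 1 ^ (\<mu> - 1)"
        using elim(5) sigma_coeff_1[OF ctx, of p] by (simp add: \<beta>_def)
      then show ?case
        unfolding matrix_vector_right_distrib elim(1) elim(2) Mhp u_def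
        by (simp add: matrix_vector_mult_diff_distrib vector_scalar_commute vec_eq_iff algebra_simps)
    qed
  qed
  obtain K where K: "\<forall>\<^sub>F p in G. \<forall>h. norm (h $ ?f) \<le> K * norm (M \<mu> p *v h)"
    using M_final_bound(1)[OF \<sigma>] by blast
  have "bigO G eps2 (\<lambda>p. (v p + h p) $ ?f)"
    by (rule bigO_le[OF Mh, where K = K], rule eventually_mono[OF K], erule spec)
  moreover have "\<forall>\<^sub>F p in G. (v p + h p) $ ?f = v p $ ?f + \<beta> p"
    using unitary e_orth_orth[OF ctx] d_orth
    by eventually_elim (simp add: h_def u_def unitary_facts axis_def cdot_simps)
  ultimately have v\<beta>: "bigO G eps2 (\<lambda>p. v p $ ?f + \<beta> p)" by (rule bigO_cong[rotated])
  \<comment> \<open>The correction is \<open>- \<tau> \<rho>\<close> times \<open>r\<^sub>1\<close>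
    up to O(\<open>eps2\<close>). Replacing \<open>\<rho>\<close> times \<open>r\<^sub>1\<close> by
    the tangent, and the tangent by \<open>r\<close>, costs O(\<open>eps\<close>) each, which the
    factor \<tau> makes quadratic. What is left is the error of step 1 off the tangent line.\<close>
  have B: "bigO G eps2 (\<lambda>p. (w p - x_e - \<tau> p *s r) - \<tau> p *s (tangent p - r) + \<tau> p *s (tangent p - \<rho> p *s r\<^sub>1 p) +
    ((v p $ ?f + \<beta> p) * inverse (of_nat \<mu>)) *s r\<^sub>1 p)"
    by (intro bigO_add bigO_diff w bigO_cmult[OF tau tangent_r] bigO_cmult[OF tau bigO_mono[OF tangent_r1 eta_eps]]
      bigO_cmult_1(1)[OF _ r1_1] bigO_mult_1(1)[OF v\<beta> bigO_const])
  have E: "(w p - x_e - \<tau> p *s r) - \<tau> p *s (tangent p - r) + \<tau> p *s (tangent p - \<rho> p *s r\<^sub>1 p) +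
    ((v p $ ?f + \<beta> p) * inverse (of_nat \<mu>)) *s r\<^sub>1 p = w p + (v p $ ?f / of_nat \<mu>) *s r\<^sub>1 p - x_e" for p
    using mu by (simp add: \<beta>_def vec_eq_iff field_simps)
  show ?thesis using B unfolding E .
qed

end

end

end

section \<open>The refinement theorem\<close>

text \<open>Estimates along this filter, with \<open>p\<close> ranging over all runs of the algorithm, are uniform in the
  choices made by the run.\<close>

definition small_filter :: "('p \<Rightarrow> bool) \<Rightarrow> ('p \<Rightarrow> real) \<Rightarrow> 'p filter" where
  "small_filter V e = inf (filtercomap e (nhds 0)) (principal {p. V p \<and> 0 < e p})"

lemma eventually_small_filter:
  "eventually P (small_filter V e) \<longleftrightarrow> (\<exists>d>0. \<forall>p. V p \<and> 0 < e p \<and> e p < d \<longrightarrow> P p)"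
proof
  assume "eventually P (small_filter V e)"
  then obtain Q where Q: "eventually Q (nhds 0)" "\<And>p. Q (e p) \<Longrightarrow> V p \<Longrightarrow> 0 < e p \<Longrightarrow> P p"
    unfolding small_filter_def eventually_inf_principal eventually_filtercomap by auto
  obtain d where d: "d > 0" "\<And>t. dist t 0 < d \<Longrightarrow> Q t"
    using Q(1) unfolding eventually_nhds_metric by blast
  show "\<exists>d>0. \<forall>p. V p \<and> 0 < e p \<and> e p < d \<longrightarrow> P p"
    by (rule exI[of _ d]) (use d Q(2) in auto)
next
  assume "\<exists>d>0. \<forall>p. V p \<and> 0 < e p \<and> e p < d \<longrightarrow> P p"
  then obtain d where d: "d > 0" "\<And>p. V p \<Longrightarrow> 0 < e p \<Longrightarrow> e p < d \<Longrightarrow> P p" by blast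
  have "eventually (\<lambda>t. t < d) (nhds 0)"
    unfolding eventually_nhds_metric by (rule exI[of _ d]) (use d(1) in \<open>auto simp: dist_real_def\<close>)
  then show "eventually P (small_filter V e)"
    unfolding small_filter_def eventually_inf_principal eventually_filtercomap
    by (rule exI[of _ "\<lambda>t. t < d", OF conjI]) (use d(2) in auto)
qed

lemma small_filter_valid: "\<forall>\<^sub>F p in small_filter V e. V p"
  unfolding eventually_small_filter by (rule exI[of _ 1]) simp

lemma small_filter_lim: "(e \<longlongrightarrow> 0) (small_filter V e)"
  unfolding small_filter_def by (rule tendsto_mono[OF inf_le1 filterlim_filtercomap])

section \<open>Partial runs of the algorithm and uniform constants\<close>

lemma P_op_cong:
  assumes "k \<ge> 1" "\<And>i. i < k \<Longrightarrow> a i = a' i" "\<And>i. i < k \<Longrightarrow> L i = L' i"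
  shows "P_op a L k = P_op a' L' k"
proof -
  have "Q_op a L k j = Q_op a' L' k j" for j
    unfolding Q_op_def by (rule sum.cong) (use assms in auto)
  then show ?thesis using assms by (simp add: P_op_def)
qed

text \<open>Each \<open>P_op\<close> uses only data of earlier stages, so overwriting stage
  \<open>m\<close> leaves the previous operators valid.\<close>

lemma closed_basis_extend:
  assumes B: "numerical_closed_basis H z m a L" and m: "2 \<le> m"
    and b: "scaled_min_right_singular_vector (bordered_matrix (P_op a L m) H z) b"
  shows "\<exists>a' L'. numerical_closed_basis H z (Suc m) a' L'"
proof -
  let ?a = "a(m := b)"
  let ?L = "L(m := P_op a L m + (\<Sum>j\<in>UNIV - {first_index}. op_scale (b $ j) (D_op (axis j 1))))"
  have P: "P_op ?a ?L k = P_op a L k" if "2 \<le> k" "k \<le> m" for k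
    by (rule P_op_cong) (use that in auto)
  have "numerical_closed_basis H z (Suc m) ?a ?L"
    unfolding numerical_closed_basis_def
  proof (intro conjI ballI)
    show "?L 0 = D_op 0" "?L 1 = D_op (axis first_index 1)"
      using B m by (auto simp: numerical_closed_basis_def)
    fix k assume k: "k \<in> {2..<Suc m}"
    then have Pk: "P_op ?a ?L k = P_op a L k" by (intro P) auto
    show "scaled_min_right_singular_vector (bordered_matrix (P_op ?a ?L k) H z) (?a k)"
      "?L k = P_op ?a ?L k + (\<Sum>j\<in>UNIV - {first_index}. op_scale (?a k $ j) (D_op (axis j 1)))"
      unfolding Pk using B b k by (cases "k = m"; simp add: numerical_closed_basis_def)+
  qed
  then show ?thesis by blast
qed

lemma refiner_step2_iff:
  "refiner_step2 F w R \<longleftrightarrow> unitary_matrix R \<and> min_direction (jac F w) (column first_index R)"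
  by (simp add: refiner_step2_def Let_def complex_jacobian_system right_singular_vector_min)

definition valid_start :: "('n::{finite,linorder} \<Rightarrow> 'n cpoly) \<Rightarrow> 'n cvec \<Rightarrow> 'n cvec \<Rightarrow> 'n cmat \<Rightarrow> bool" where
  "valid_start F x y R \<longleftrightarrow> refiner_step1 F x y \<and>
    smallest_singular_value (complex_jacobian (system_map F) x) > 0 \<and> refiner_step2 F (x + y) R"

definition run_basis ::
    "('n::{finite,linorder} \<Rightarrow> 'n cpoly) \<Rightarrow> 'n cvec \<Rightarrow> 'n cmat \<Rightarrow> nat \<Rightarrow> (nat \<Rightarrow> 'n cvec) \<Rightarrow> (nat \<Rightarrow> 'n diff_op) \<Rightarrow> bool" where
  "run_basis F w R = numerical_closed_basis (\<lambda>z. system_map F (R *v z)) (matrix_inv R *v w)"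

definition run_matrix ::
    "('n::{finite,linorder} \<Rightarrow> 'n cpoly) \<Rightarrow> 'n cvec \<Rightarrow> 'n cmat \<Rightarrow> nat \<Rightarrow> (nat \<Rightarrow> 'n cvec) \<Rightarrow> (nat \<Rightarrow> 'n diff_op) \<Rightarrow> 'n cmat" where
  "run_matrix F w R m a L = bordered_matrix (P_op a L m) (\<lambda>z. system_map F (R *v z)) (matrix_inv R *v w)"

definition run_rhs ::
    "('n::{finite,linorder} \<Rightarrow> 'n cpoly) \<Rightarrow> 'n cvec \<Rightarrow> 'n cmat \<Rightarrow> 'n diff_op \<Rightarrow> 'n cvec" where
  "run_rhs F w R D = apply_op_system D (\<lambda>z. system_map F (R *v z)) (matrix_inv R *v w)"

lemma refiner_returns_iff:
  "refiner_returns F \<mu> x x_new \<longleftrightarrow> (\<exists>y R a L v. refiner_step1 F x y \<and> refiner_step2 F (x + y) R \<and>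
     run_basis F (x + y) R \<mu> a L \<and>
     run_matrix F (x + y) R \<mu> a L *v v = - run_rhs F (x + y) R (L (\<mu> - 1)) \<and>
     x_new = x + y + (v $ first_index / of_nat \<mu>) *s column first_index R)"
  unfolding refiner_returns_def refiner_step4_def run_basis_def run_matrix_def run_rhs_def Let_def by blast

locale singular_root =
  fixes F :: "'n::{finite,linorder} \<Rightarrow> 'n cpoly" and x_e r c :: "'n cvec"
    and X :: "'n \<Rightarrow> complex poly" and \<mu> :: nat
  assumes root: "system_map F x_e = 0" and kernel: "jac F x_e *v r = 0" "r \<noteq> 0"
    and kernel_one: "\<And>u. jac F x_e *v u = 0 \<Longrightarrow> \<exists>t. u = t *s r"
    and not_range: "\<And>u. c \<noteq> jac F x_e *v u"
    and mu: "2 \<le> \<mu>" and X_0: "\<And>j. coeff (X j) 0 = x_e $ j" and X_1: "\<And>j. coeff (X j) 1 = r $ j"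
    and contact: "\<And>i. \<forall>l<\<mu>. coeff (cev X (F i)) l = 0"
    and leading: "c = (\<chi> i. coeff (cev X (F i)) \<mu>)"
begin

lemma refinement_exists:
  fixes x y :: "'p \<Rightarrow> 'n cvec" and R :: "'p \<Rightarrow> 'n cmat"
  assumes lim: "((\<lambda>p. norm (x p - x_e)) \<longlongrightarrow> 0) G" and V: "\<forall>\<^sub>F p in G. valid_start F (x p) (y p) (R p)"
  shows "\<exists>\<tau>. refinement G (\<lambda>p. norm (x p - x_e)) F x_e r c X \<mu> (\<lambda>p. x p + y p) \<tau> R"
proof -
  interpret root_family G "\<lambda>p. norm (x p - x_e)" F x_e r c
    by unfold_locales (fact lim root kernel kernel_one not_range)+
  have "bigO G (\<lambda>p. norm (x p - x_e)) (\<lambda>p. x p - x_e)" by (rule bigOI[where C = 1]) simp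
  moreover have "\<forall>\<^sub>F p in G. refiner_step1 F (x p) (y p)"
    "\<forall>\<^sub>F p in G. smallest_singular_value (complex_jacobian (system_map F) (x p)) > 0"
    using V by (eventually_elim, simp add: valid_start_def)+
  ultimately obtain \<tau> where \<tau>: "bigO G (\<lambda>p. norm (x p - x_e)) \<tau>"
    "bigO G eps2 (\<lambda>p. x p + y p - x_e - \<tau> p *s r)"
    by (rule step1_error)
  have U: "\<forall>\<^sub>F p in G. unitary_matrix (R p)"
    "\<forall>\<^sub>F p in G. min_direction (jac F (x p + y p)) (column first_index (R p))"
    using V by (eventually_elim, simp add: valid_start_def refiner_step2_iff)+
  have "refinement G (\<lambda>p. norm (x p - x_e)) F x_e r c X \<mu> (\<lambda>p. x p + y p) \<tau> R"
    by unfold_locales (fact mu X_0 X_1 contact leading \<tau> U)+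
  then show ?thesis by blast
qed

lemma error_bound:
  "\<exists>C>0. \<exists>d>0. \<forall>x x_new. 0 < norm (x - x_e) \<and> norm (x - x_e) < d \<and>
     smallest_singular_value (complex_jacobian (system_map F) x) > 0 \<and> refiner_returns F \<mu> x x_new \<longrightarrow>
     norm (x_new - x_e) \<le> C * (norm (x - x_e))\<^sup>2"
proof -
  let ?x = "\<lambda>p. fst p" and ?y = "\<lambda>p. fst (snd p)" and ?R = "\<lambda>p. fst (snd (snd p))"
    and ?a = "\<lambda>p. fst (snd (snd (snd p)))" and ?L = "\<lambda>p. fst (snd (snd (snd (snd p))))"
    and ?v = "\<lambda>p. snd (snd (snd (snd (snd p))))"
  define V :: "'n cvec \<times> 'n cvec \<times> 'n cmat \<times> (nat \<Rightarrow> 'n cvec) \<times> (nat \<Rightarrow> 'n diff_op) \<times> 'n cvec \<Rightarrow> bool"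
    where "V p \<longleftrightarrow> valid_start F (?x p) (?y p) (?R p) \<and>
      run_basis F (?x p + ?y p) (?R p) \<mu> (?a p) (?L p) \<and>
      run_matrix F (?x p + ?y p) (?R p) \<mu> (?a p) (?L p) *v ?v p =
        - run_rhs F (?x p + ?y p) (?R p) (?L p (\<mu> - 1))" for p
  define G where "G = small_filter V (\<lambda>p. norm (?x p - x_e))"
  have V: "\<forall>\<^sub>F p in G. V p" unfolding G_def by (rule small_filter_valid)
  have "\<forall>\<^sub>F p in G. valid_start F (?x p) (?y p) (?R p)"
    using V by eventually_elim (simp add: V_def)
  then obtain \<tau> where "refinement G (\<lambda>p. norm (?x p - x_e)) F x_e r c X \<mu> (\<lambda>p. ?x p + ?y p) \<tau> ?R"
    using refinement_exists[of ?x G ?y ?R] small_filter_lim[of "\<lambda>p. norm (?x p - x_e)" V]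
    unfolding G_def by blast
  then interpret ref: refinement G "\<lambda>p. norm (?x p - x_e)" F x_e r c X \<mu> "\<lambda>p. ?x p + ?y p" \<tau> ?R .
  have basis: "\<forall>\<^sub>F p in G. numerical_closed_basis (ref.H p) (ref.z p) \<mu> (?a p) (?L p)"
    using V by eventually_elim (simp add: V_def run_basis_def ref.H_def ref.z_def)
  have "\<forall>\<^sub>F p in G. ref.M ?a ?L \<mu> p *v ?v p = - apply_op_system (?L p (\<mu> - 1)) (ref.H p) (ref.z p)"
    using V by eventually_elim (simp add: V_def run_matrix_def run_rhs_def ref.M_def ref.H_def ref.z_def)
  from ref.refined_error[OF basis this]
  obtain C where C: "C > 0" "\<forall>\<^sub>F p in G. norm (?x p + ?y p + (?v p $ first_index / of_nat \<mu>) *s column first_index (?R p) - x_e)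
    \<le> C * \<bar>norm (?x p - x_e) * norm (?x p - x_e)\<bar>"
    by (rule bigOE)
  obtain d where d: "d > 0" "\<And>p. V p \<Longrightarrow> 0 < norm (?x p - x_e) \<Longrightarrow> norm (?x p - x_e) < d \<Longrightarrow>
    norm (?x p + ?y p + (?v p $ first_index / of_nat \<mu>) *s column first_index (?R p) - x_e)
    \<le> C * \<bar>norm (?x p - x_e) * norm (?x p - x_e)\<bar>"
    using C(2) unfolding G_def eventually_small_filter by blast
  show ?thesis
  proof (rule exI[of _ C], rule conjI[OF C(1)], rule exI[of _ d], rule conjI[OF d(1)], intro allI impI, elim conjE)
    fix x x_new
    assume x: "0 < norm (x - x_e)" "norm (x - x_e) < d"
      "smallest_singular_value (complex_jacobian (system_map F) x) > 0" "refiner_returns F \<mu> x x_new"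
    obtain y R a L v where run: "refiner_step1 F x y" "refiner_step2 F (x + y) R"
      "run_basis F (x + y) R \<mu> a L" "run_matrix F (x + y) R \<mu> a L *v v = - run_rhs F (x + y) R (L (\<mu> - 1))"
      "x_new = x + y + (v $ first_index / of_nat \<mu>) *s column first_index R"
      using x(4) unfolding refiner_returns_iff by blast
    have "V (x, y, R, a, L, v)" using run x(3) by (simp add: V_def valid_start_def)
    from d(2)[OF this] show "norm (x_new - x_e) \<le> C * (norm (x - x_e))\<^sup>2"
      using x(1,2) run(5) by (simp add: power2_eq_square)
  qed
qed

text \<open>The estimates for a basis of length \<open>m\<close> apply to runs carried out only that
  far. They show that such a run can go on: a singular vector with nonzero first entry exists, or,
  at the last stage, the linear system is solvable.\<close>

lemma run_step_exists:
  assumes m: "2 \<le> m" "m \<le> \<mu>"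
  shows "\<exists>d>0. \<forall>x y R a L. 0 < norm (x - x_e) \<and> norm (x - x_e) < d \<and> valid_start F x y R \<and>
    run_basis F (x + y) R m a L \<longrightarrow>
    (if m < \<mu> then \<exists>b. scaled_min_right_singular_vector (run_matrix F (x + y) R m a L) b
      else \<forall>b. \<exists>v. run_matrix F (x + y) R m a L *v v = b)"
proof -
  let ?x = "\<lambda>p. fst p" and ?y = "\<lambda>p. fst (snd p)" and ?R = "\<lambda>p. fst (snd (snd p))"
    and ?a = "\<lambda>p. fst (snd (snd (snd p)))" and ?L = "\<lambda>p. snd (snd (snd (snd p)))"
  define V :: "'n cvec \<times> 'n cvec \<times> 'n cmat \<times> (nat \<Rightarrow> 'n cvec) \<times> (nat \<Rightarrow> 'n diff_op) \<Rightarrow> bool"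
    where "V p \<longleftrightarrow> valid_start F (?x p) (?y p) (?R p) \<and>
      run_basis F (?x p + ?y p) (?R p) m (?a p) (?L p)" for p
  let ?M = "\<lambda>p. run_matrix F (?x p + ?y p) (?R p) m (?a p) (?L p)"
  let ?P = "\<lambda>p. if m < \<mu> then \<exists>b. scaled_min_right_singular_vector (?M p) b else \<forall>b. \<exists>v. ?M p *v v = b"
  define G where "G = small_filter V (\<lambda>p. norm (?x p - x_e))"
  have V: "\<forall>\<^sub>F p in G. V p" unfolding G_def by (rule small_filter_valid)
  have "\<forall>\<^sub>F p in G. valid_start F (?x p) (?y p) (?R p)"
    using V by eventually_elim (simp add: V_def)
  then obtain \<tau> where "refinement G (\<lambda>p. norm (?x p - x_e)) F x_e r c X \<mu> (\<lambda>p. ?x p + ?y p) \<tau> ?R"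
    using refinement_exists[of ?x G ?y ?R] small_filter_lim[of "\<lambda>p. norm (?x p - x_e)" V]
    unfolding G_def by blast
  then interpret ref: refinement G "\<lambda>p. norm (?x p - x_e)" F x_e r c X \<mu> "\<lambda>p. ?x p + ?y p" \<tau> ?R .
  have basis: "\<forall>\<^sub>F p in G. numerical_closed_basis (ref.H p) (ref.z p) m (?a p) (?L p)"
    using V by eventually_elim (simp add: V_def run_basis_def ref.H_def ref.z_def)
  have M: "ref.M ?a ?L m p = ?M p" for p
    by (simp add: run_matrix_def ref.M_def ref.H_def ref.z_def)
  obtain \<sigma> where \<sigma>: "ref.tracks ?a m \<sigma>" using ref.tracks_exists[OF m basis] by blast
  have "\<forall>\<^sub>F p in G. ?P p"
  proof (cases "m < \<mu>")
    case True
    show ?thesis using ref.scaled_vector_exists[OF m basis \<sigma> True] True unfolding M by simp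
  next
    case False
    then have "m = \<mu>" using m by simp
    then have "\<forall>\<^sub>F p in G. \<forall>b. \<exists>v. ref.M ?a ?L m p *v v = b"
      using ref.final_system_solvable[of ?a ?L] basis by simp
    then show ?thesis unfolding M using False by simp
  qed
  then obtain d where d: "d > 0" "\<And>p. V p \<Longrightarrow> 0 < norm (?x p - x_e) \<Longrightarrow> norm (?x p - x_e) < d \<Longrightarrow> ?P p"
    unfolding G_def eventually_small_filter by blast
  show ?thesis
  proof (rule exI[of _ d], rule conjI[OF d(1)], intro allI impI, elim conjE)
    fix x y R a L
    assume x: "0 < norm (x - x_e)" "norm (x - x_e) < d" and "valid_start F x y R" "run_basis F (x + y) R m a L"
    then have "V (x, y, R, a, L)" by (simp add: V_def)
    then show "if m < \<mu> then \<exists>b. scaled_min_right_singular_vector (run_matrix F (x + y) R m a L) b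
      else \<forall>b. \<exists>v. run_matrix F (x + y) R m a L *v v = b"
      by (rule d(2)[of "(x, y, R, a, L)", unfolded prod.sel, OF _ x])
  qed
qed

text \<open>Each extension may shrink the admissible radius, which is harmless over finitely many
  stages. The first two operators are prescribed, so the induction starts with an arbitrary
  radius.\<close>

lemma run_basis_exists:
  assumes "2 \<le> m" "m \<le> \<mu>"
  shows "\<exists>d>0. \<forall>x y R. 0 < norm (x - x_e) \<and> norm (x - x_e) < d \<and> valid_start F x y R \<longrightarrow>
    (\<exists>a L. run_basis F (x + y) R m a L)"
  using assms
proof (induction m rule: nat_induct_at_least)
  case base
  have "run_basis F w R 2 (\<lambda>_. 0) (\<lambda>k. if k = 0 then D_op 0 else D_op (axis first_index 1))" for w R
    by (simp add: run_basis_def numerical_closed_basis_def)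
  then show ?case using zero_less_one[where 'a = real] by blast
next
  case (Suc m)
  obtain d where d: "d > 0" "\<And>x y R. 0 < norm (x - x_e) \<Longrightarrow> norm (x - x_e) < d \<Longrightarrow> valid_start F x y R \<Longrightarrow>
    \<exists>a L. run_basis F (x + y) R m a L"
    using Suc by auto
  obtain d' where d': "d' > 0" "\<And>x y R a L. 0 < norm (x - x_e) \<Longrightarrow> norm (x - x_e) < d' \<Longrightarrow> valid_start F x y R \<Longrightarrow>
    run_basis F (x + y) R m a L \<Longrightarrow> \<exists>b. scaled_min_right_singular_vector (run_matrix F (x + y) R m a L) b"
    using run_step_exists[of m] Suc.hyps Suc.prems by auto
  show ?case
  proof (rule exI[of _ "min d d'"], (intro conjI allI impI; (elim conjE)?))
    show "0 < min d d'" using d(1) d'(1) by simp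
    fix x y R
    assume x: "0 < norm (x - x_e)" "norm (x - x_e) < min d d'" "valid_start F x y R"
    then obtain a L where B: "run_basis F (x + y) R m a L" using d(2)[of x y R] by auto
    obtain b where b: "scaled_min_right_singular_vector (run_matrix F (x + y) R m a L) b"
      using d'(2)[OF x(1) _ x(3) B] x(2) by auto
    show "\<exists>a L. run_basis F (x + y) R (Suc m) a L"
      using closed_basis_extend[OF B[unfolded run_basis_def] Suc.hyps(1) b[unfolded run_matrix_def]]
      unfolding run_basis_def .
  qed
qed

lemma refiner_defined:
  "\<exists>d>0. \<forall>x y. 0 < norm (x - x_e) \<and> norm (x - x_e) < d \<and>
     smallest_singular_value (complex_jacobian (system_map F) x) > 0 \<and> refiner_step1 F x y \<longrightarrow>
     (\<exists>x_new. refiner_returns F \<mu> x x_new)"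
proof -
  obtain d where d: "d > 0" "\<And>x y R. 0 < norm (x - x_e) \<Longrightarrow> norm (x - x_e) < d \<Longrightarrow> valid_start F x y R \<Longrightarrow>
    \<exists>a L. run_basis F (x + y) R \<mu> a L"
    using run_basis_exists[OF mu order_refl] by auto
  obtain d' where d': "d' > 0" "\<And>x y R a L. 0 < norm (x - x_e) \<Longrightarrow> norm (x - x_e) < d' \<Longrightarrow> valid_start F x y R \<Longrightarrow>
    run_basis F (x + y) R \<mu> a L \<Longrightarrow> \<forall>b. \<exists>v. run_matrix F (x + y) R \<mu> a L *v v = b"
    using run_step_exists[OF mu order_refl] by auto
  show ?thesis
  proof (rule exI[of _ "min d d'"], (intro conjI allI impI; (elim conjE)?))
    show "0 < min d d'" using d(1) d'(1) by simp
    fix x y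
    assume x: "0 < norm (x - x_e)" "norm (x - x_e) < min d d'"
      "smallest_singular_value (complex_jacobian (system_map F) x) > 0" "refiner_step1 F x y"
    \<comment> \<open>Any minimising vector can be completed to a unitary matrix, so the second step
      never fails.\<close>
    obtain r\<^sub>1 where r1: "min_direction (jac F (x + y)) r\<^sub>1" using min_direction_exists by blast
    then have "norm r\<^sub>1 = 1" by (simp add: min_direction_def)
    then obtain R where "unitary_matrix R" "column first_index R = r\<^sub>1" by (rule unitary_completion)
    then have R: "refiner_step2 F (x + y) R" using r1 by (simp add: refiner_step2_iff)
    have V: "valid_start F x y R" using x R by (simp add: valid_start_def)
    obtain a L where B: "run_basis F (x + y) R \<mu> a L" using d(2)[OF x(1) _ V] x(2) by auto
    obtain v where "run_matrix F (x + y) R \<mu> a L *v v = - run_rhs F (x + y) R (L (\<mu> - 1))"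
      using d'(2)[OF x(1) _ V B] x(2) by auto
    then show "\<exists>x_new. refiner_returns F \<mu> x x_new"
      unfolding refiner_returns_iff using x(4) R B by blast
  qed
qed

end

text \<open>The generator is normalised to have an entry equal to one; that coordinate becomes the
  parameter of the contact curve.\<close>

lemma corank_one_kernel:
  fixes A :: "'n::finite cmat"
  assumes "corank A = 1"
  obtains r i where "A *v r = 0" "r $ i = 1" "\<And>u. A *v u = 0 \<Longrightarrow> \<exists>t. u = t *s r"
proof -
  let ?K = "{v. A *v v = 0}"
  have sub: "vec.subspace ?K"
    by (auto simp: vec.subspace_def matrix_vector_right_distrib vector_scalar_commute)
  obtain B where B: "B \<subseteq> ?K" "vec.independent B" "?K \<subseteq> vec.span B" "card B = 1"
    using vec.basis_exists[of ?K] assms unfolding corank_def by metis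
  obtain s where s: "B = {s}" using B(4) by (rule card_1_singletonE)
  have "s \<noteq> 0" using B(2) s vec.dependent_zero by auto
  then obtain i where i: "s $ i \<noteq> 0" by (auto simp: vec_eq_iff)
  let ?r = "inverse (s $ i) *s s"
  show ?thesis
  proof (rule that[of ?r i])
    show "A *v ?r = 0" using B(1) s by (simp add: vector_scalar_commute)
    show "?r $ i = 1" using i by simp
    fix u assume "A *v u = 0"
    then have "u \<in> vec.span {s}" using B(3) s by auto
    then obtain k where "u = k *s s" by (auto simp: vec.span_singleton)
    then have "u = (k * s $ i) *s ?r" using i by (simp add: vector_smult_assoc)
    then show "\<exists>t. u = t *s ?r" by blast
  qed
qed

theorem theorem3p16:
  fixes F :: "'n::{finite,linorder} \<Rightarrow> 'n cpoly"
    and x_e :: "'n cvec"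
    and \<mu> :: nat
  assumes isolated: "x_e isolated_in {x. system_map F x = 0}"
    and singular: "\<not> invertible (complex_jacobian (system_map F) x_e)"
    and multiplicity: "has_multiplicity F x_e \<mu>"
    and corank_one: "corank (complex_jacobian (system_map F) x_e) = 1"
  shows "\<forall>c::real. c > 0 \<longrightarrow>
    (\<exists>\<epsilon>\<^sub>0::real. \<exists>C::real. \<epsilon>\<^sub>0 > 0 \<and> C > 0 \<and>
      (\<forall>(x :: 'n cvec) (y :: 'n cvec) (\<epsilon> :: real).
         norm (x - x_e) = \<epsilon> \<and> 0 < \<epsilon> \<and> \<epsilon> < \<epsilon>\<^sub>0 \<and>
         smallest_singular_value (complex_jacobian (system_map F) x) > 0 \<and>
         refiner_step1 F x y \<and> norm (x + y - x_e) \<ge> c * \<epsilon> \<longrightarrow>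
         (\<exists>x_new. refiner_returns F \<mu> x x_new) \<and>
         (\<forall>x_new. refiner_returns F \<mu> x x_new \<longrightarrow> norm (x_new - x_e) \<le> C * \<epsilon>\<^sup>2)))"
proof -
  have root: "system_map F x_e = 0" using isolated by (simp add: isolated_in_def)
  then have F0: "poly_eval (F i) x_e = 0" for i by (simp add: system_map_def vec_eq_iff)
  obtain r i\<^sub>0 where r: "jac F x_e *v r = 0" "r $ i\<^sub>0 = 1" "\<And>u. jac F x_e *v u = 0 \<Longrightarrow> \<exists>t. u = t *s r"
    using corank_one_kernel[OF corank_one[unfolded complex_jacobian_system]] by blast
  obtain X where X: "contact_curve F x_e i\<^sub>0 \<mu> X" "\<And>j. coeff (X j) 1 = r $ j" "\<mu> \<ge> 2"
    "\<And>u. (\<chi> i. coeff (cev X (F i)) \<mu>) \<noteq> jac F x_e *v u"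
    using contact_curve_exists[OF multiplicity F0 r] by blast
  have "r \<noteq> 0" using r(2) by auto
  interpret singular_root F x_e r "\<chi> i. coeff (cev X (F i)) \<mu>" X \<mu>
    using X(1) by unfold_locales (auto simp: root r X(2)[unfolded One_nat_def] X(3,4) \<open>r \<noteq> 0\<close> contact_curve_def)
  obtain C d where C: "C > 0" "d > 0" "\<And>x x_new. 0 < norm (x - x_e) \<Longrightarrow> norm (x - x_e) < d \<Longrightarrow>
     smallest_singular_value (complex_jacobian (system_map F) x) > 0 \<Longrightarrow> refiner_returns F \<mu> x x_new \<Longrightarrow>
     norm (x_new - x_e) \<le> C * (norm (x - x_e))\<^sup>2"
    using error_bound by blast
  obtain d' where d': "d' > 0" "\<And>x y. 0 < norm (x - x_e) \<Longrightarrow> norm (x - x_e) < d' \<Longrightarrow>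
     smallest_singular_value (complex_jacobian (system_map F) x) > 0 \<Longrightarrow> refiner_step1 F x y \<Longrightarrow>
     \<exists>x_new. refiner_returns F \<mu> x x_new"
    using refiner_defined by blast
  show ?thesis
  proof (intro allI impI, rule exI[of _ "min d d'"], rule exI[of _ C], (intro conjI allI impI; (elim conjE)?))
    show "0 < min d d'" "0 < C" using C(1,2) d'(1) by simp_all
    fix x y \<epsilon>
    assume x: "norm (x - x_e) = \<epsilon>" "0 < \<epsilon>" "\<epsilon> < min d d'"
      "smallest_singular_value (complex_jacobian (system_map F) x) > 0" "refiner_step1 F x y"
    show "\<exists>x_new. refiner_returns F \<mu> x x_new" using d'(2)[of x y] x by simp
    show "norm (x_new - x_e) \<le> C * \<epsilon>\<^sup>2" if "refiner_returns F \<mu> x x_new" for x_new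
      using C(3)[of x x_new] x that by simp
  qed
qed

end
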